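(* Let $S^-:\tilde{\mathfrak H}\to\tilde{\mathfrak H}$ be the linear map $S^-(U)=P_{\rm sym}^-UP_{\rm sym}^-$. Then $S^-(\tilde{\mathfrak H})=S^-(\widetilde{AW}(3,Q_0))$. Consequently the antispherical subalgebra $S^-(\tilde{\mathfrak H})$ is isomorphic to the algebra $AW(3,Q_0;qa,qb,c,d)$: the map $$U\mapsto (ab-1)^{-1}\,\widetilde U\,(T_1+ab),$$ where $U\mapsto\widetilde U$ sends words $U$ in $AW(3,Q_0;qa,qb,c,d)$ involving $K_0,K_1$ to the corresponding words $\widetilde U$ in $\widetilde{AW}(3,Q_0)$ involving $qK_0,K_1$ (that is, $K_0$ is replaced by $qK_0$; extended linearly), is a well-defined algebra isomorphism from $AW(3,Q_0;qa,qb,c,d)$ onto $S^-(\tilde{\mathfrak H})$.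
   Context: All algebras are associative unital algebras over $\mathbb C$. Parameters: $q,a,b,c,d\in\mathbb C$ with $q\ne0$, $q^m\ne1$ for $m=1,2,\ldots$; $a,b,c,d\ne0$; $abcd\ne q^{-m}$ for $m=0,1,2,\ldots$; and $ab\ne1$. Let $e_1=a+b+c+d$, $e_2=ab+ac+bc+ad+bd+cd$, $e_3=abc+abd+acd+bcd$, $e_4=abcd$. Structure constants: $B=(1-q^{-1})^2(e_3+qe_1)$, $C_0=(q-q^{-1})^2$, $C_1=q^{-1}(q-q^{-1})^2e_4$, $D_0=-q^{-3}(1-q)^2(1+q)(e_4+qe_2+q^2)$, $D_1=-q^{-3}(1-q)^2(1+q)(e_1e_4+qe_3)$, $$Q_0=q^{-4}(1-q)^2\bigl(q^4(e_4-e_2)+q^3(e_1^2-e_1e_3-2e_2)-q^2(e_2e_4+2e_4+e_2)+q(e_3^2-2e_2e_4-e_1e_3)+e_4(1-e_2)\bigr),$$ $E=-q^{-2}(1-q)^3(c+d)$, $F_0=q^{-3}(1-q)^3(1+q)(cd+q)$, $F_1=q^{-3}(1-q)^3(1+q)(a+b)cd$, $$G=-q^{-4}(1-q)^3\bigl((a+b)(c+d)(cd(q^2+1)+q)-q(ab+1)((c^2+d^2)(q+1)-cd)+(cd+e_4)(q^2+1)+(e_2+e_4-ab)q^3\bigr).$$ The algebra $AW(3,Q_0)$ is generated by $K_0,K_1$ with relations $$(q+q^{-1})K_1K_0K_1-K_1^2K_0-K_0K_1^2=BK_1+C_0K_0+D_0,$$ $$(q+q^{-1})K_0K_1K_0-K_0^2K_1-K_1K_0^2=BK_0+C_1K_1+D_1,$$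 and $Q=Q_0$, where $$Q=K_1K_0K_1K_0-(q^2+1+q^{-2})K_0K_1K_0K_1+(q+q^{-1})K_0^2K_1^2+(q+q^{-1})(C_0K_0^2+C_1K_1^2)$$ $$+B\bigl((q+1+q^{-1})K_0K_1+K_1K_0\bigr)+(q+1+q^{-1})(D_0K_0+D_1K_1).$$ $AW(3,Q_0;qa,qb,c,d)$ denotes $AW(3,Q_0)$ with $a,b$ replaced by $qa,qb$, respectively, in all of $B,C_0,C_1,D_0,D_1,Q_0$ (with $c,d,q$ unchanged). The algebra $\widetilde{AW}(3,Q_0)$ (with the unshifted parameters $a,b,c,d$) is generated by $K_0,K_1,T_1$ such that $(T_1+ab)(T_1+1)=0$, $T_1$ commutes with $K_0,K_1$, and $$(q+q^{-1})K_1K_0K_1-K_1^2K_0-K_0K_1^2=BK_1+C_0K_0+D_0+EK_1(T_1+ab)+F_0(T_1+ab),$$ $$(q+q^{-1})K_0K_1K_0-K_0^2K_1-K_1K_0^2=BK_0+C_1K_1+D_1+EK_0(T_1+ab)+F_1(T_1+ab),$$ $$Q_0=(K_1K_0)^2-(q^2+1+q^{-2})K_0(K_1K_0)K_1+(q+q^{-1})K_0^2K_1^2+(q+q^{-1})(C_0K_0^2+C_1K_1^2)$$ $$+\bigl(B+E(T_1+ab)\bigr)\bigl((q+1+q^{-1})K_0K_1+K_1K_0\bigr)+(q+1+q^{-1})\bigl(D_0+F_0(T_1+ab)\bigr)K_0$$ $$+(q+1+q^{-1})\bigl(D_1+F_1(T_1+ab)\bigr)K_1+G(T_1+ab).$$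 The double affine Hecke algebra $\tilde{\mathfrak H}$ (type $(C_1^\vee,C_1)$) is generated by $T_1,Y,Y^{-1},Z,Z^{-1}$ with relations $YY^{-1}=1=Y^{-1}Y$, $ZZ^{-1}=1=Z^{-1}Z$ and $T_1^2=-(ab+1)T_1-ab$, $T_1Z=Z^{-1}T_1+(ab+1)Z^{-1}-(a+b)$, $T_1Z^{-1}=ZT_1-(ab+1)Z^{-1}+(a+b)$, $T_1Y=q^{-1}abcd\,Y^{-1}T_1-(ab+1)Y+ab(1+q^{-1}cd)$, $T_1Y^{-1}=q(abcd)^{-1}YT_1+q(abcd)^{-1}(1+ab)Y-q(cd)^{-1}(1+q^{-1}cd)$, $YZ=qZY+(1+ab)cd\,Z^{-1}Y^{-1}T_1-(a+b)cd\,Y^{-1}T_1-(1+q^{-1}cd)Z^{-1}T_1-(1-q)(1+ab)(1+q^{-1}cd)Z^{-1}+(c+d)T_1+(1-q)(a+b)(1+q^{-1}cd)$, $YZ^{-1}=q^{-1}Z^{-1}Y-q^{-2}(1+ab)cd\,Z^{-1}Y^{-1}T_1+q^{-2}(a+b)cd\,Y^{-1}T_1+q^{-1}(1+q^{-1}cd)Z^{-1}T_1-q^{-1}(c+d)T_1$, $Y^{-1}Z=q^{-1}ZY^{-1}-q(ab)^{-1}(1+ab)Z^{-1}Y^{-1}T_1+(ab)^{-1}(a+b)Y^{-1}T_1+q(abcd)^{-1}(1+q^{-1}cd)Z^{-1}T_1+q(abcd)^{-1}(1-q)(1+ab)(1+q^{-1}cd)Z^{-1}-(abcd)^{-1}(c+d)T_1-(abcd)^{-1}(1-q)(1+ab)(c+d)$,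 $Y^{-1}Z^{-1}=qZ^{-1}Y^{-1}+q(ab)^{-1}(1+ab)Z^{-1}Y^{-1}T_1-(ab)^{-1}(a+b)Y^{-1}T_1-q^2(abcd)^{-1}(1+q^{-1}cd)Z^{-1}T_1+q(abcd)^{-1}(c+d)T_1$. It is known (earlier work) that there is a unique injective algebra homomorphism $\widetilde{AW}(3,Q_0)\to\tilde{\mathfrak H}$ with $K_0\mapsto Y+q^{-1}abcd\,Y^{-1}$, $K_1\mapsto Z+Z^{-1}$, $T_1\mapsto T_1$; via it $\widetilde{AW}(3,Q_0)$ is regarded as a subalgebra of $\tilde{\mathfrak H}$ (its elements commute with $T_1$). $P_{\rm sym}^-=(ab-1)^{-1}(T_1+ab)\in\tilde{\mathfrak H}$, which is idempotent. The image $S^-(\tilde{\mathfrak H})=P_{\rm sym}^-\tilde{\mathfrak H}P_{\rm sym}^-$ is closed under multiplication, with unit $P_{\rm sym}^-$, and is called the antispherical subalgebra of $\tilde{\mathfrak H}$. *)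

theory Defs
  imports
    Complex_Main
    "HOL-Library.Poly_Mapping"
    "HOL-Algebra.QuotRing"
    "HOL-Algebra.Module"
begin

section \<open>Associative algebras over the complex numbers by generators and relations\<close>

text \<open>
  An algebra is a \<^type>\<open>module\<close> record with scalars in \<^typ>\<open>complex\<close>: a ring together with
  a scalar multiplication.  (The locale \<^locale>\<open>algebra\<close> cannot be used, as it assumes
  commutativity.)

  The free algebra on the type \<open>'g\<close> is the monoid algebra of the monoid of words over \<open>'g\<close>.
  \<^theory>\<open>HOL-Library.Poly_Mapping\<close> provides the convolution product for an additively
  written, not necessarily commutative, monoid, so concatenation of words is written \<open>+\<close>.
\<close>

datatype 'g fword = Word (letters: "'g list")

instantiation fword :: (type) monoid_add
begin
definition "0 = Word []"
definition "v + w = Word (letters v @ letters w)"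
instance by standard (auto simp: zero_fword_def plus_fword_def)
end

type_synonym 'g free = "'g fword \<Rightarrow>\<^sub>0 complex"

definition gen :: "'g \<Rightarrow> 'g free" where
  "gen g = Poly_Mapping.single (Word [g]) 1"

definition scale :: "complex \<Rightarrow> 'g free \<Rightarrow> 'g free"  (infixr \<open>\<cdot>\<close> 75) where
  "k \<cdot> p = Poly_Mapping.single 0 k * p"

definition free_alg :: "(complex, 'g free) module" where
  "free_alg = \<lparr>carrier = UNIV, mult = (*), one = 1, zero = 0, add = (+), smult = scale\<rparr>"

definition alg_quot :: "(complex, 'b) module \<Rightarrow> 'b set \<Rightarrow> (complex, 'b set) module" where
  "alg_quot A I = ring.extend (A Quot I)
     (module.fields (\<lambda>k X. \<Union>x\<in>X. I +>\<^bsub>A\<^esub> (k \<odot>\<^bsub>A\<^esub> x)))"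

text \<open>
  A set of relations is a set \<open>R\<close> of elements of the free algebra, each of which is to become
  zero; the ideal generated is two-sided.
\<close>

definition presented :: "'g free set \<Rightarrow> (complex, 'g free set) module" where
  "presented R = alg_quot free_alg (Idl\<^bsub>free_alg\<^esub> R)"

definition cls :: "'g free set \<Rightarrow> 'g free \<Rightarrow> 'g free set" where
  "cls R p = Idl\<^bsub>free_alg\<^esub> R +>\<^bsub>free_alg\<^esub> p"

text \<open>Substitution of \<open>\<phi> g\<close> for each generator \<open>g\<close> in a noncommutative polynomial.\<close>

definition eval_free :: "(complex, 'b) module \<Rightarrow> ('g \<Rightarrow> 'b) \<Rightarrow> 'g free \<Rightarrow> 'b" where
  "eval_free A \<phi> p =
     (\<Oplus>\<^bsub>A\<^esub>w\<in>Poly_Mapping.keys p. Poly_Mapping.lookup p w \<odot>\<^bsub>A\<^esub>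
        foldr (\<lambda>g x. \<phi> g \<otimes>\<^bsub>A\<^esub> x) (letters w) \<one>\<^bsub>A\<^esub>)"

text \<open>
  The map induced on a presented algebra.  It is meaningful when \<open>eval_free A \<phi>\<close> is constant on
  every coset, that is, when the \<open>\<phi> g\<close> satisfy the relations in \<open>A\<close>.
\<close>

definition induced_map :: "(complex, 'b) module \<Rightarrow> ('g \<Rightarrow> 'b) \<Rightarrow> 'g free set \<Rightarrow> 'b" where
  "induced_map A \<phi> X = the_elem (eval_free A \<phi> ` X)"

definition alg_iso :: "(complex, 'a) module \<Rightarrow> (complex, 'b) module \<Rightarrow> ('a \<Rightarrow> 'b) set" where
  "alg_iso A B = {h \<in> ring_iso A B. \<forall>k. \<forall>x\<in>carrier A. h (k \<odot>\<^bsub>A\<^esub> x) = k \<odot>\<^bsub>B\<^esub> h x}"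

section \<open>Structure constants\<close>

definition e1 :: "complex \<Rightarrow> complex \<Rightarrow> complex \<Rightarrow> complex \<Rightarrow> complex" where
  "e1 a b c d = a + b + c + d"

definition e2 :: "complex \<Rightarrow> complex \<Rightarrow> complex \<Rightarrow> complex \<Rightarrow> complex" where
  "e2 a b c d = a*b + a*c + b*c + a*d + b*d + c*d"

definition e3 :: "complex \<Rightarrow> complex \<Rightarrow> complex \<Rightarrow> complex \<Rightarrow> complex" where
  "e3 a b c d = a*b*c + a*b*d + a*c*d + b*c*d"

definition e4 :: "complex \<Rightarrow> complex \<Rightarrow> complex \<Rightarrow> complex \<Rightarrow> complex" where
  "e4 a b c d = a*b*c*d"

definition cB :: "complex \<Rightarrow> complex \<Rightarrow> complex \<Rightarrow> complex \<Rightarrow> complex \<Rightarrow> complex" where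
  "cB q a b c d = (1 - 1/q)^2 * (e3 a b c d + q * e1 a b c d)"

definition cC0 :: "complex \<Rightarrow> complex" where
  "cC0 q = (q - 1/q)^2"

definition cC1 :: "complex \<Rightarrow> complex \<Rightarrow> complex \<Rightarrow> complex \<Rightarrow> complex \<Rightarrow> complex" where
  "cC1 q a b c d = 1/q * (q - 1/q)^2 * e4 a b c d"

definition cD0 :: "complex \<Rightarrow> complex \<Rightarrow> complex \<Rightarrow> complex \<Rightarrow> complex \<Rightarrow> complex" where
  "cD0 q a b c d = - (1/q^3) * (1-q)^2 * (1+q) * (e4 a b c d + q * e2 a b c d + q^2)"

definition cD1 :: "complex \<Rightarrow> complex \<Rightarrow> complex \<Rightarrow> complex \<Rightarrow> complex \<Rightarrow> complex" where
  "cD1 q a b c d = - (1/q^3) * (1-q)^2 * (1+q) * (e1 a b c d * e4 a b c d + q * e3 a b c d)"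

definition cQ0 :: "complex \<Rightarrow> complex \<Rightarrow> complex \<Rightarrow> complex \<Rightarrow> complex \<Rightarrow> complex" where
  "cQ0 q a b c d =
    (let e1 = e1 a b c d; e2 = e2 a b c d; e3 = e3 a b c d; e4 = e4 a b c d in
     1/q^4 * (1-q)^2 *
       (q^4 * (e4 - e2) + q^3 * (e1^2 - e1*e3 - 2*e2) - q^2 * (e2*e4 + 2*e4 + e2)
        + q * (e3^2 - 2*e2*e4 - e1*e3) + e4 * (1 - e2)))"

definition cE :: "complex \<Rightarrow> complex \<Rightarrow> complex \<Rightarrow> complex" where
  "cE q c d = - (1/q^2) * (1-q)^3 * (c + d)"

definition cF0 :: "complex \<Rightarrow> complex \<Rightarrow> complex \<Rightarrow> complex" where
  "cF0 q c d = 1/q^3 * (1-q)^3 * (1+q) * (c*d + q)"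

definition cF1 :: "complex \<Rightarrow> complex \<Rightarrow> complex \<Rightarrow> complex \<Rightarrow> complex \<Rightarrow> complex" where
  "cF1 q a b c d = 1/q^3 * (1-q)^3 * (1+q) * (a+b) * c * d"

definition cG :: "complex \<Rightarrow> complex \<Rightarrow> complex \<Rightarrow> complex \<Rightarrow> complex \<Rightarrow> complex" where
  "cG q a b c d =
    - (1/q^4) * (1-q)^3 *
      ((a+b) * (c+d) * (c*d*(q^2+1) + q) - q * (a*b+1) * ((c^2+d^2)*(q+1) - c*d)
       + (c*d + e4 a b c d) * (q^2+1) + (e2 a b c d + e4 a b c d - a*b) * q^3)"

section \<open>The algebra \<open>AW(3,Q\<^sub>0)\<close>\<close>

datatype aw_gen = K0 | K1

definition AW_rels :: "complex \<Rightarrow> complex \<Rightarrow> complex \<Rightarrow> complex \<Rightarrow> complex \<Rightarrow> aw_gen free set" where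
  "AW_rels q a b c d =
    (let k0 = gen K0; k1 = gen K1;
         B = cB q a b c d; C0 = cC0 q; C1 = cC1 q a b c d;
         D0 = cD0 q a b c d; D1 = cD1 q a b c d; Q0 = cQ0 q a b c d in
     { (q + 1/q) \<cdot> (k1*k0*k1) - k1^2*k0 - k0*k1^2 - (B \<cdot> k1 + C0 \<cdot> k0 + D0 \<cdot> 1),
       (q + 1/q) \<cdot> (k0*k1*k0) - k0^2*k1 - k1*k0^2 - (B \<cdot> k0 + C1 \<cdot> k1 + D1 \<cdot> 1),
       k1*k0*k1*k0 - (q^2 + 1 + 1/q^2) \<cdot> (k0*k1*k0*k1) + (q + 1/q) \<cdot> (k0^2*k1^2)
         + (q + 1/q) \<cdot> (C0 \<cdot> k0^2 + C1 \<cdot> k1^2)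
         + B \<cdot> ((q + 1 + 1/q) \<cdot> (k0*k1) + k1*k0)
         + (q + 1 + 1/q) \<cdot> (D0 \<cdot> k0 + D1 \<cdot> k1)
         - Q0 \<cdot> 1 })"

definition AW :: "complex \<Rightarrow> complex \<Rightarrow> complex \<Rightarrow> complex \<Rightarrow> complex
    \<Rightarrow> (complex, aw_gen free set) module" where
  "AW q a b c d = presented (AW_rels q a b c d)"

section \<open>The central extension of \<open>AW(3,Q\<^sub>0)\<close>\<close>

datatype awt_gen = tK0 | tK1 | tT1

definition AWt_rels :: "complex \<Rightarrow> complex \<Rightarrow> complex \<Rightarrow> complex \<Rightarrow> complex \<Rightarrow> awt_gen free set" where
  "AWt_rels q a b c d =
    (let k0 = gen tK0; k1 = gen tK1; T1 = gen tT1; X = T1 + (a*b) \<cdot> 1;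
         B = cB q a b c d; C0 = cC0 q; C1 = cC1 q a b c d;
         D0 = cD0 q a b c d; D1 = cD1 q a b c d; Q0 = cQ0 q a b c d;
         E = cE q c d; F0 = cF0 q c d; F1 = cF1 q a b c d; G = cG q a b c d in
     { X * (T1 + 1),
       T1*k0 - k0*T1,
       T1*k1 - k1*T1,
       (q + 1/q) \<cdot> (k1*k0*k1) - k1^2*k0 - k0*k1^2
         - (B \<cdot> k1 + C0 \<cdot> k0 + D0 \<cdot> 1 + E \<cdot> (k1*X) + F0 \<cdot> X),
       (q + 1/q) \<cdot> (k0*k1*k0) - k0^2*k1 - k1*k0^2
         - (B \<cdot> k0 + C1 \<cdot> k1 + D1 \<cdot> 1 + E \<cdot> (k0*X) + F1 \<cdot> X),
       (k1*k0)^2 - (q^2 + 1 + 1/q^2) \<cdot> (k0*(k1*k0)*k1) + (q + 1/q) \<cdot> (k0^2*k1^2)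
         + (q + 1/q) \<cdot> (C0 \<cdot> k0^2 + C1 \<cdot> k1^2)
         + (B \<cdot> 1 + E \<cdot> X) * ((q + 1 + 1/q) \<cdot> (k0*k1) + k1*k0)
         + (q + 1 + 1/q) \<cdot> ((D0 \<cdot> 1 + F0 \<cdot> X) * k0)
         + (q + 1 + 1/q) \<cdot> ((D1 \<cdot> 1 + F1 \<cdot> X) * k1)
         + G \<cdot> X
         - Q0 \<cdot> 1 })"

definition AWt :: "complex \<Rightarrow> complex \<Rightarrow> complex \<Rightarrow> complex \<Rightarrow> complex
    \<Rightarrow> (complex, awt_gen free set) module" where
  "AWt q a b c d = presented (AWt_rels q a b c d)"

section \<open>The double affine Hecke algebra of type \<open>(C\<^sub>1\<^sup>\<or>, C\<^sub>1)\<close>\<close>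

text \<open>The generators \<open>hY'\<close> and \<open>hZ'\<close> stand for the inverses of \<open>hY\<close> and \<open>hZ\<close>.\<close>

datatype daha_gen = hT1 | hY | hY' | hZ | hZ'

definition DAHA_rels :: "complex \<Rightarrow> complex \<Rightarrow> complex \<Rightarrow> complex \<Rightarrow> complex \<Rightarrow> daha_gen free set" where
  "DAHA_rels q a b c d =
    (let T1 = gen hT1; Y = gen hY; Y' = gen hY'; Z = gen hZ; Z' = gen hZ';
         r = 1 + 1/q*c*d in
     { Y*Y' - 1, Y'*Y - 1, Z*Z' - 1, Z'*Z - 1,
       T1^2 - (- (a*b+1) \<cdot> T1 - (a*b) \<cdot> 1),
       T1*Z - (Z'*T1 + (a*b+1) \<cdot> Z' - (a+b) \<cdot> 1),
       T1*Z' - (Z*T1 - (a*b+1) \<cdot> Z' + (a+b) \<cdot> 1),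
       T1*Y - ((1/q*a*b*c*d) \<cdot> (Y'*T1) - (a*b+1) \<cdot> Y + (a*b*r) \<cdot> 1),
       T1*Y' - ((q/(a*b*c*d)) \<cdot> (Y*T1) + (q/(a*b*c*d)*(1+a*b)) \<cdot> Y - (q/(c*d)*r) \<cdot> 1),
       Y*Z - (q \<cdot> (Z*Y) + ((1+a*b)*c*d) \<cdot> (Z'*Y'*T1) - ((a+b)*c*d) \<cdot> (Y'*T1)
         - r \<cdot> (Z'*T1) - ((1-q)*(1+a*b)*r) \<cdot> Z' + (c+d) \<cdot> T1 + ((1-q)*(a+b)*r) \<cdot> 1),
       Y*Z' - ((1/q) \<cdot> (Z'*Y) - (1/q^2*(1+a*b)*c*d) \<cdot> (Z'*Y'*T1)
         + (1/q^2*(a+b)*c*d) \<cdot> (Y'*T1) + (1/q*r) \<cdot> (Z'*T1) - (1/q*(c+d)) \<cdot> T1),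
       Y'*Z - ((1/q) \<cdot> (Z*Y') - (q/(a*b)*(1+a*b)) \<cdot> (Z'*Y'*T1) + (1/(a*b)*(a+b)) \<cdot> (Y'*T1)
         + (q/(a*b*c*d)*r) \<cdot> (Z'*T1) + (q/(a*b*c*d)*(1-q)*(1+a*b)*r) \<cdot> Z'
         - (1/(a*b*c*d)*(c+d)) \<cdot> T1 - (1/(a*b*c*d)*(1-q)*(1+a*b)*(c+d)) \<cdot> 1),
       Y'*Z' - (q \<cdot> (Z'*Y') + (q/(a*b)*(1+a*b)) \<cdot> (Z'*Y'*T1) - (1/(a*b)*(a+b)) \<cdot> (Y'*T1)
         - (q^2/(a*b*c*d)*r) \<cdot> (Z'*T1) + (q/(a*b*c*d)*(c+d)) \<cdot> T1) })"

definition DAHA :: "complex \<Rightarrow> complex \<Rightarrow> complex \<Rightarrow> complex \<Rightarrow> complex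
    \<Rightarrow> (complex, daha_gen free set) module" where
  "DAHA q a b c d = presented (DAHA_rels q a b c d)"

text \<open>The canonical homomorphism of the extended algebra into the double affine Hecke algebra.\<close>

definition embed_gen :: "complex \<Rightarrow> complex \<Rightarrow> complex \<Rightarrow> complex \<Rightarrow> complex
    \<Rightarrow> awt_gen \<Rightarrow> daha_gen free set" where
  "embed_gen q a b c d g = cls (DAHA_rels q a b c d)
     (case g of
        tK0 \<Rightarrow> gen hY + (1/q*a*b*c*d) \<cdot> gen hY'
      | tK1 \<Rightarrow> gen hZ + gen hZ'
      | tT1 \<Rightarrow> gen hT1)"

definition AWt_embed :: "complex \<Rightarrow> complex \<Rightarrow> complex \<Rightarrow> complex \<Rightarrow> complex
    \<Rightarrow> awt_gen free set \<Rightarrow> daha_gen free set" where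
  "AWt_embed q a b c d = induced_map (DAHA q a b c d) (embed_gen q a b c d)"

section \<open>The antispherical subalgebra\<close>

definition P_sym_minus :: "complex \<Rightarrow> complex \<Rightarrow> complex \<Rightarrow> complex \<Rightarrow> complex
    \<Rightarrow> daha_gen free set" where
  "P_sym_minus q a b c d =
     cls (DAHA_rels q a b c d) ((1/(a*b - 1)) \<cdot> (gen hT1 + (a*b) \<cdot> 1))"

definition S_minus :: "complex \<Rightarrow> complex \<Rightarrow> complex \<Rightarrow> complex \<Rightarrow> complex
    \<Rightarrow> daha_gen free set \<Rightarrow> daha_gen free set" where
  "S_minus q a b c d U =
     P_sym_minus q a b c d \<otimes>\<^bsub>DAHA q a b c d\<^esub> U \<otimes>\<^bsub>DAHA q a b c d\<^esub> P_sym_minus q a b c d"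

definition antispherical :: "complex \<Rightarrow> complex \<Rightarrow> complex \<Rightarrow> complex \<Rightarrow> complex
    \<Rightarrow> (complex, daha_gen free set) module" where
  "antispherical q a b c d =
     (DAHA q a b c d)\<lparr>carrier := S_minus q a b c d ` carrier (DAHA q a b c d),
                      one := P_sym_minus q a b c d\<rparr>"

text \<open>
  The passage from a noncommutative polynomial \<open>U\<close> in \<open>K0\<close>, \<open>K1\<close> to the element of the extended
  algebra obtained by replacing \<open>K0\<close> by \<open>q K0\<close>.  Its domain is the free algebra, since it need
  not respect the relations before multiplication by \<open>T1 + a b\<close>.
\<close>

definition tilde :: "complex \<Rightarrow> complex \<Rightarrow> complex \<Rightarrow> complex \<Rightarrow> complex
    \<Rightarrow> aw_gen free \<Rightarrow> awt_gen free set" where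
  "tilde q a b c d = eval_free (AWt q a b c d)
     (\<lambda>g. cls (AWt_rels q a b c d) (case g of K0 \<Rightarrow> q \<cdot> gen tK0 | K1 \<Rightarrow> gen tK1))"

end

theory Submission
  imports
    Defs
    "HOL-Library.Function_Algebras"
    "HOL-Computational_Algebra.Polynomial"
    "HOL-Analysis.Continuum_Not_Denumerable"
begin

text \<open>
  Write \<open>T\<close> for \<open>T\<^sub>1\<close> and \<open>e\<close> for \<open>P\<^sub>s\<^sub>y\<^sub>m\<^sup>-\<close>.  The element \<open>K\<^sub>0 = Y + q\<^sup>-\<^sup>1 a b c d Y\<^sup>-\<^sup>1\<close> commutes with \<open>Y\<close> and \<open>T\<close>, the
  element \<open>K\<^sub>1 = Z + Z\<^sup>-\<^sup>1\<close> commutes with \<open>Z\<close> and \<open>T\<close>, and \<open>Y\<close>, \<open>Z\<close> are quadratic over them.  Hence the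
  Hecke algebra is spanned by \<open>f(K\<^sub>1) {1, Z} {1, Y} g(K\<^sub>0) T\<^sup>i\<close>, and since \<open>e\<close> commutes with \<open>K\<^sub>0\<close> and \<open>K\<^sub>1\<close>, the
  corner \<open>e H e\<close> is governed by \<open>e Z e\<close>, \<open>e Y e\<close> and \<open>e Z Y e\<close>.  Each of these is \<open>e\<close> times a
  polynomial in \<open>K\<^sub>0, K\<^sub>1\<close>; for \<open>e Z Y e\<close> it is essentially the \<open>q\<close>-commutator \<open>K\<^sub>2 = q K\<^sub>0 K\<^sub>1 - K\<^sub>1 K\<^sub>0\<close>.

  On \<open>e\<close> the element \<open>T\<close> acts as \<open>-1\<close>, which turns the relations of the extended algebra into those
  of the Askey-Wilson algebra for \<open>q K\<^sub>0\<close>, \<open>K\<^sub>1\<close> with \<open>a, b\<close> replaced by \<open>q a, q b\<close>.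

  For injectivity, the Askey-Wilson algebra is spanned by \<open>K\<^sub>0\<^sup>n K\<^sub>1\<^sup>m\<close> and \<open>K\<^sub>0\<^sup>n K\<^sub>1 K\<^sub>0 K\<^sub>1\<^sup>m\<close>.  The Hecke algebra acts
  on functions on the orbit \<open>q\<^sup>k z\<^sup>\<plusminus>\<^sup>1\<close> of a generic point \<open>z\<close>.  Applying a vanishing combination to a function
  supported at \<open>z\<^sup>\<plusminus>\<^sup>1\<close> and evaluating at the far end of the support isolates the terms of top degree
  in \<open>K\<^sub>0\<close>: their coefficients satisfy \<open>\<alpha>(z + 1/z) + (z/q + q/z) \<beta>(z + 1/z) = 0\<close> for all generic \<open>z\<close>, so
  \<open>\<alpha> = \<beta> = 0\<close>.
\<close>

section \<open>Free algebras\<close>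

lemma scale_conv_map: "k \<cdot> p = Poly_Mapping.map ((*) k) p"
  by (simp add: scale_def mult_map_scale_conv_mult)

lemma lookup_scale [simp]: "Poly_Mapping.lookup (k \<cdot> p) w = k * Poly_Mapping.lookup p w"
  by (simp add: scale_conv_map map.rep_eq when_def)

interpretation free: vector_space "scale :: complex \<Rightarrow> 'g free \<Rightarrow> 'g free"
  by unfold_locales (auto intro!: poly_mapping_eqI simp: lookup_add algebra_simps)

lemma scale_mult_left [simp]: "(k \<cdot> p) * r = k \<cdot> (p * r)"
  by (simp add: scale_def mult.assoc)

lemma single_word_induct [case_names zero add single]:
  assumes "P 0" "\<And>p r. P p \<Longrightarrow> P r \<Longrightarrow> P (p + r)" "\<And>w k. P (Poly_Mapping.single w k)"
  shows "P (p :: 'g free)"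
proof (induction p rule: update_induct)
  case const
  show ?case by (rule assms)
next
  case (update f w k)
  have "Poly_Mapping.update w k f = f + Poly_Mapping.single w k"
    using update(1) by (intro poly_mapping_eqI) (auto simp: lookup_update lookup_add lookup_single in_keys_iff when_def)
  with update assms show ?case by auto
qed

lemma single_zero_commute: "Poly_Mapping.single 0 k * p = p * Poly_Mapping.single 0 k" for p :: "'g free"
  by (induction p rule: single_word_induct) (auto simp: mult_single algebra_simps)

lemma scale_mult_right [simp]: "p * (k \<cdot> r) = k \<cdot> (p * r)"
  by (metis mult.assoc scale_def single_zero_commute)

lemma single_scale: "Poly_Mapping.single w k = k \<cdot> Poly_Mapping.single w 1"
  by (simp add: scale_def mult_single)

lemma single_Nil: "Poly_Mapping.single (Word []) 1 = (1 :: 'g free)"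
  by (metis single_one zero_fword_def)

lemma single_Cons: "Poly_Mapping.single (Word (g # gs)) 1 = gen g * Poly_Mapping.single (Word gs) 1"
  by (simp add: gen_def mult_single plus_fword_def)

text \<open>Peeling off the leftmost letter matches the recursion of the evaluation maps below; zero
  needs no case of its own, being the multiple 0 of 1.\<close>

lemma free_induct [case_names one gen add scale]:
  assumes "P 1" "\<And>g p. P p \<Longrightarrow> P (gen g * p)"
    "\<And>p r. P p \<Longrightarrow> P r \<Longrightarrow> P (p + r)" "\<And>k p. P p \<Longrightarrow> P (k \<cdot> p)"
  shows "P (p :: 'g free)"
proof (induction p rule: single_word_induct)
  case zero
  show ?case using assms(4)[OF assms(1), of 0] by simp
next
  case (single w k)
  have "P (Poly_Mapping.single (Word gs) 1)" for gs
    by (induction gs) (auto simp: single_Nil single_Cons assms)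
  then show ?case
    by (metis single_scale assms(4) fword.exhaust)
qed (rule assms)

text \<open>The representation of the free algebra in which a letter \<open>g\<close> acts by the
  operator \<open>\<rho> g\<close>. It serves twice: left multiplications give the substitution
  homomorphisms, difference operators give the basic representation.\<close>

definition act :: "(complex \<Rightarrow> 'v \<Rightarrow> 'v) \<Rightarrow> ('g \<Rightarrow> 'v \<Rightarrow> 'v)
    \<Rightarrow> 'g free \<Rightarrow> 'v \<Rightarrow> 'v::ab_group_add" where
  "act sc \<rho> p v = (\<Sum>w\<in>Poly_Mapping.keys p. sc (Poly_Mapping.lookup p w) (foldr \<rho> (letters w) v))"

locale free_action = vector_space sc for sc :: "complex \<Rightarrow> 'v::ab_group_add \<Rightarrow> 'v" +
  fixes \<rho> :: "'g \<Rightarrow> 'v \<Rightarrow> 'v"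
  assumes \<rho>_add: "\<rho> g (x + y) = \<rho> g x + \<rho> g y" and \<rho>_scale: "\<rho> g (sc k x) = sc k (\<rho> g x)"
begin

abbreviation "A \<equiv> act sc \<rho>"

lemma act_superset:
  assumes "finite W" "Poly_Mapping.keys p \<subseteq> W"
  shows "A p v = (\<Sum>w\<in>W. sc (Poly_Mapping.lookup p w) (foldr \<rho> (letters w) v))"
  unfolding act_def using assms by (intro sum.mono_neutral_left) (auto simp: in_keys_iff)

lemma act_add: "A (p + r) v = A p v + A r v"
proof -
  let ?W = "Poly_Mapping.keys p \<union> Poly_Mapping.keys r"
  have "Poly_Mapping.keys (p + r) \<subseteq> ?W" by (rule keys_add)
  then show ?thesis
    by (simp add: act_superset[of ?W] lookup_add scale_left_distrib sum.distrib)
qed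

lemma act_scale: "A (k \<cdot> p) v = sc k (A p v)"
proof -
  have "Poly_Mapping.keys (k \<cdot> p) \<subseteq> Poly_Mapping.keys p" by (auto simp: in_keys_iff)
  then show ?thesis
    by (simp add: act_superset[of "Poly_Mapping.keys p"] scale_sum_right)
qed

lemma act_zero [simp]: "A 0 v = 0"
  by (simp add: act_def)

lemma act_uminus: "A (- p) v = - A p v"
  by (metis act_add act_zero add.right_inverse minus_unique)

lemma act_diff: "A (p - r) v = A p v - A r v"
  using act_add[of p "- r" v] by (simp add: act_uminus)

lemma act_word: "A (Poly_Mapping.single w 1) v = foldr \<rho> (letters w) v"
  by (simp add: act_def)

lemma act_one [simp]: "A 1 v = v"
  using act_word[of "Word []"] by (simp add: single_Nil)

lemma act_gen: "A (gen g) v = \<rho> g v"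
  by (simp add: gen_def act_word)

lemma act_gen_mult: "A (gen g * p) v = \<rho> g (A p v)"
proof -
  have z: "\<rho> g 0 = 0" using \<rho>_add[of g 0 0] by simp
  show ?thesis
  proof (induction p rule: single_word_induct)
    case (single w k)
    have "gen g * Poly_Mapping.single w k = k \<cdot> Poly_Mapping.single (Word (g # letters w)) 1"
      by (simp add: single_Cons, metis fword.collapse scale_mult_right single_scale)
    moreover have "A (Poly_Mapping.single w k) v = sc k (foldr \<rho> (letters w) v)"
      by (subst single_scale) (simp add: act_scale act_word)
    ultimately show ?case
      by (simp add: act_scale act_word \<rho>_scale)
  qed (auto simp: act_add algebra_simps \<rho>_add z)
qed

lemma act_mult: "A (p * r) v = A p (A r v)"
  by (induction p rule: free_induct) (auto simp: act_add act_scale act_gen_mult algebra_simps mult.assoc)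

lemma act_vscale: "A p (sc k x) = sc k (A p x)"
  by (induction p rule: free_induct) (auto simp: act_add act_scale act_gen_mult \<rho>_scale scale_right_distrib mult.commute)

end

text \<open>As an action by left multiplications, applied to 1, substitution inherits linearity from
  \<open>free_action\<close>; \<open>act_subst\<close> then makes it multiplicative.\<close>

definition subst :: "('g \<Rightarrow> 'h free) \<Rightarrow> 'g free \<Rightarrow> 'h free" where
  "subst f p = act scale (\<lambda>g x. f g * x) p 1"

interpretation subst: free_action scale "\<lambda>g x. f g * x" for f :: "'g \<Rightarrow> 'h free"
  by unfold_locales (auto simp: algebra_simps)

lemma act_subst: "act scale (\<lambda>g x. f g * x) p x = subst f p * x"
  unfolding subst_def
  by (induction p rule: free_induct)
    (auto simp: subst.act_add subst.act_scale subst.act_gen_mult algebra_simps mult.assoc)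

lemma subst_add [simp]: "subst f (p + r) = subst f p + subst f r"
  and subst_diff [simp]: "subst f (p - r) = subst f p - subst f r"
  and subst_uminus [simp]: "subst f (- p) = - subst f p"
  and subst_scale [simp]: "subst f (k \<cdot> p) = k \<cdot> subst f p"
  and subst_zero [simp]: "subst f 0 = 0"
  and subst_one [simp]: "subst f 1 = 1"
  and subst_gen [simp]: "subst f (gen g) = f g"
  by (simp_all add: subst_def subst.act_add subst.act_diff subst.act_uminus subst.act_scale subst.act_gen)

lemma subst_mult [simp]: "subst f (p * r) = subst f p * subst f r"
  by (metis act_subst subst.act_mult subst_def)

lemma subst_power [simp]: "subst f (p ^ n) = subst f p ^ n"
  by (induction n) simp_all

section \<open>Presented algebras\<close>

lemma free_alg_simps [simp]:
  "carrier free_alg = UNIV" "x \<otimes>\<^bsub>free_alg\<^esub> y = x * y" "\<one>\<^bsub>free_alg\<^esub> = 1"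
  "\<zero>\<^bsub>free_alg\<^esub> = 0" "x \<oplus>\<^bsub>free_alg\<^esub> y = x
      + y" "k \<odot>\<^bsub>free_alg\<^esub> x = k \<cdot> x"
  by (simp_all add: free_alg_def)

lemma ring_free_alg: "ring (free_alg :: (complex, 'g free) module)"
proof (rule ringI)
  have "\<exists>y. y + x = 0" for x :: "'g free" by (rule exI[of _ "- x"]) simp
  then show "abelian_group (free_alg :: (complex, 'g free) module)"
    by (intro abelian_groupI) (auto simp: algebra_simps)
  show "Group.monoid (free_alg :: (complex, 'g free) module)"
    by (rule monoidI) (auto simp: mult.assoc)
qed (auto simp: algebra_simps)

lemma a_minus_free_alg: "x \<ominus>\<^bsub>free_alg\<^esub> y = x - y"
proof -
  interpret ring free_alg by (rule ring_free_alg)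
  have "\<ominus>\<^bsub>free_alg\<^esub> y = - y"
    using minus_equality[of "- y" y] by simp
  then show ?thesis by (simp add: a_minus_def)
qed

abbreviation rel_ideal :: "'g free set \<Rightarrow> 'g free set" where
  "rel_ideal R \<equiv> Idl\<^bsub>free_alg\<^esub> R"

lemma ideal_Id: "ideal (rel_ideal R) free_alg"
  by (rule ring.genideal_ideal[OF ring_free_alg]) simp

lemma rel_ideal_add: "x \<in> rel_ideal R \<Longrightarrow> y \<in> rel_ideal R \<Longrightarrow> x + y \<in> rel_ideal R"
  using additive_subgroup.a_closed[OF ideal.axioms(1)[OF ideal_Id]] by fastforce

lemma rel_ideal_mult_left: "x \<in> rel_ideal R \<Longrightarrow> y * x \<in> rel_ideal R"
  using ideal.I_l_closed[OF ideal_Id] by fastforce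

lemma rel_ideal_mult_right: "x \<in> rel_ideal R \<Longrightarrow> x * y \<in> rel_ideal R"
  using ideal.I_r_closed[OF ideal_Id] by fastforce

lemma rel_ideal_zero: "0 \<in> rel_ideal R"
  using additive_subgroup.zero_closed[OF ideal.axioms(1)[OF ideal_Id]] by fastforce

lemma rel_ideal_scale: "x \<in> rel_ideal R \<Longrightarrow> k \<cdot> x \<in> rel_ideal R"
  unfolding scale_def by (rule rel_ideal_mult_left)

lemma rel_ideal_uminus: "x \<in> rel_ideal R \<Longrightarrow> - x \<in> rel_ideal R"
  using rel_ideal_scale[of x R "-1"] by simp

lemma rel_ideal_gen: "x \<in> R \<Longrightarrow> x \<in> rel_ideal R"
  using ring.genideal_self[OF ring_free_alg, of R] by auto

lemma rel_ideal_least: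
  assumes "x \<in> rel_ideal R" "\<And>r. r \<in> R \<Longrightarrow> P r" "P 0" "\<And>x y. P x \<Longrightarrow> P
      y \<Longrightarrow> P (x + y)"
    "\<And>x y. P x \<Longrightarrow> P (y * x)" "\<And>x y. P x \<Longrightarrow> P (x * y)"
  shows "P x"
proof -
  \<comment> \<open>Negation is multiplication by -1 and is therefore absent from the closure
    hypotheses.\<close>
  have neg: "P (- x)" if "P x" for x using assms(5)[OF that, of "-1"] by simp
  interpret ring free_alg by (rule ring_free_alg)
  have inv: "\<ominus>\<^bsub>free_alg\<^esub> y = - y" for y
    using a_minus_free_alg[of 0 y] by (simp add: a_minus_def)
  have "ideal {x. P x} free_alg"
  proof (rule idealI[OF ring_free_alg])
    show "subgroup {x. P x} (add_monoid free_alg)"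
    proof (rule subgroup.intro)
      show "inv\<^bsub>add_monoid free_alg\<^esub> x \<in> {x. P x}" if "x \<in> {x. P x}" for x
        using that neg unfolding a_inv_def[symmetric] inv by simp
    qed (use assms(3,4) in auto)
  qed (use assms in auto)
  then show ?thesis
    using genideal_minimal[of "{x. P x}" R] assms(1,2) by auto
qed

lemma cls_eq_iff: "cls R x = cls R y \<longleftrightarrow> x - y \<in> rel_ideal R"
  using ring.quotient_eq_iff_same_a_r_cos[OF ring_free_alg ideal_Id, of x y R]
  by (simp add: cls_def a_minus_free_alg)

lemma cls_eq_set: "cls R x = {y. y - x \<in> rel_ideal R}"
  unfolding cls_def a_r_coset_def r_coset_def by (force simp: algebra_simps)

lemma cls_self: "x \<in> cls R x"
  by (simp add: cls_eq_set rel_ideal_zero)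

lemma presented_simps:
  "carrier (presented R) = range (cls R)" "monoid.mult (presented R) = rcoset_mult free_alg (rel_ideal R)"
  "monoid.one (presented R) = cls R 1" "ring.zero (presented R) = rel_ideal R" "ring.add (presented R) = set_add free_alg"
  "module.smult (presented R) = (\<lambda>k X. \<Union>x\<in>X. cls R (k \<cdot> x))"
  by (auto simp: presented_def alg_quot_def ring.defs module.defs FactRing_def A_RCOSETS_def' cls_def)

lemma presented_carrier [simp]: "carrier (presented R) = range (cls R)"
  by (rule presented_simps)

lemma presented_one: "\<one>\<^bsub>presented R\<^esub> = cls R 1"
  by (rule presented_simps)

lemma presented_zero: "\<zero>\<^bsub>presented R\<^esub> = cls R 0"
  by (auto simp: presented_simps cls_eq_set)

lemma presented_mult [simp]: "cls R x \<otimes>\<^bsub>presented R\<^esub> cls R y = cls R (x * y)"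
  using ideal.rcoset_mult_add[OF ideal_Id, of x y R] by (simp add: presented_simps cls_def)

lemma presented_add [simp]: "cls R x \<oplus>\<^bsub>presented R\<^esub> cls R y = cls R (x + y)"
  using ideal.a_rcos_sum[OF ideal_Id, of x y R] by (simp add: presented_simps cls_def)

lemma presented_smult [simp]: "k \<odot>\<^bsub>presented R\<^esub> cls R x = cls R (k \<cdot> x)"
proof -
  have "cls R (k \<cdot> y) = cls R (k \<cdot> x)" if "y \<in> cls R x" for y
  proof -
    from that have "y - x \<in> rel_ideal R" by (simp add: cls_eq_set)
    from rel_ideal_scale[OF this, of k] show ?thesis
      by (simp add: cls_eq_iff free.scale_right_diff_distrib)
  qed
  then have "(\<lambda>y. cls R (k \<cdot> y)) ` cls R x = {cls R (k \<cdot> x)}"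
    using cls_self[of x R] by blast
  then show ?thesis
    by (simp only: presented_simps) simp
qed

lemma ring_presented: "ring (presented R)"
proof (rule ringI)
  have *: "\<exists>y. cls R (y + x) = cls R 0" for x by (rule exI[of _ "- x"]) simp
  show "abelian_group (presented R)"
    by (intro abelian_groupI) (use * in \<open>auto simp: presented_zero algebra_simps\<close>)
  show "Group.monoid (presented R)"
    by (rule monoidI) (auto simp: presented_one mult.assoc)
qed (auto simp: algebra_simps)

lemma finsum_presented:
  "finite W \<Longrightarrow> (\<Oplus>\<^bsub>presented R\<^esub>w\<in>W. cls R (f w)) = cls R (\<Sum>w\<in>W. f w)"
proof (induction W rule: finite_induct)
  case empty
  interpret ring "presented R" by (rule ring_presented)
  show ?case by (simp add: presented_zero)
next
  case (insert w W)
  interpret ring "presented R" by (rule ring_presented)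
  from insert show ?case by (subst finsum_insert) auto
qed

lemma eval_free_presented:
  "eval_free (presented R) (\<lambda>g. cls R (f g)) p = cls R (subst f p)"
proof -
  have "foldr (\<lambda>g x. cls R (f g) \<otimes>\<^bsub>presented R\<^esub> x) ws \<one>\<^bsub>presented R\<^esub>
        = cls R (foldr (\<lambda>g x. f g * x) ws 1)" for ws
    by (induction ws) (auto simp: presented_one)
  then show ?thesis
    by (simp add: eval_free_def finsum_presented subst_def act_def)
qed

lemma subst_Id:
  assumes "\<And>r. r \<in> R \<Longrightarrow> subst f r \<in> rel_ideal R'" "x \<in> rel_ideal R"
  shows "subst f x \<in> rel_ideal R'"
  using assms(2) by (rule rel_ideal_least) (auto intro: assms rel_ideal_zero rel_ideal_add rel_ideal_mult_left
      rel_ideal_mult_right)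

text \<open>A function that is constant on cosets has a singleton as its image. This turns both
  \<open>induced_map\<close> and \<open>\<Phi>\<close> into computations with a
  representative.\<close>

lemma the_elem_image_cls:
  assumes "\<And>x y. x - y \<in> rel_ideal R \<Longrightarrow> h x = h y"
  shows "the_elem (h ` cls R x) = h x"
proof -
  have "h ` cls R x = {h x}"
    using assms cls_self[of x R] unfolding cls_eq_set by blast
  then show ?thesis by simp
qed

lemma induced_map_presented:
  assumes "\<And>r. r \<in> R \<Longrightarrow> subst f r \<in> rel_ideal R'"
  shows "induced_map (presented R') (\<lambda>g. cls R' (f g)) (cls R x) = cls R' (subst f x)"
  unfolding induced_map_def
  by (subst the_elem_image_cls) (auto simp: eval_free_presented cls_eq_iff subst_Id[OF assms] simp flip: subst_diff)

text \<open>The projection onto a complement of the ideal models the quotient inside the type \<open>'g free\<close>.\<close>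

lemma exists_projection:
  obtains \<pi> :: "'g free \<Rightarrow> 'g free" where
    "\<And>x y. \<pi> (x + y) = \<pi> x + \<pi> y" "\<And>k x. \<pi> (k \<cdot> x) = k \<cdot> \<pi> x"
    "\<And>x. \<pi> x = 0 \<longleftrightarrow> x \<in> rel_ideal R" "\<And>x. x - \<pi> x \<in> rel_ideal R"
proof -
  interpret vector_space_pair "scale :: _ \<Rightarrow> 'g free \<Rightarrow> _" "scale :: _ \<Rightarrow> 'g free
      \<Rightarrow> _" ..
  have "free.subspace (rel_ideal R)"
    by (rule free.subspaceI) (auto intro: rel_ideal_zero rel_ideal_add rel_ideal_scale)
  \<comment> \<open>The identity of the subspace \<open>rel_ideal R\<close> extends to a linear map
    \<open>g\<close> on the whole space with values in the ideal; the projection is the identity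
    minus \<open>g\<close>.\<close>
  from linear_exists_left_inverse_on[OF free.linear_id this]
  obtain g where g: "range g \<subseteq> rel_ideal R" "Vector_Spaces.linear scale scale g" "\<And>v. v \<in>
      rel_ideal R \<Longrightarrow> g v = v"
    by auto
  interpret g: Vector_Spaces.linear scale scale g by fact
  show thesis
    by (rule that[of "\<lambda>x. x - g x"])
      (use g in \<open>auto simp: g.add g.scale free.scale_right_diff_distrib image_subset_iff, metis\<close>)
qed

section \<open>The extended Askey-Wilson relations in the double affine Hecke algebra\<close>

text \<open>
  The parameters are \<open>q' = 1/q\<close>, \<open>p = a b\<close>, \<open>p' = 1/p\<close>, \<open>s = a + b\<close>, \<open>m = c d\<close>, \<open>t = c + d\<close>; all
  relations only involve these.  \<open>W\<close> stands for \<open>q\<^sup>-\<^sup>1 a b c d Y\<^sup>-\<^sup>1\<close>.  The operators act on a whole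
  type, in which the module sits as the image of the idempotent \<open>J\<close>; hence \<open>J\<close> takes the place of
  the identity.
\<close>

locale daha_ops =
  fixes q q' p p' s m t :: complex and J T Y W Z Z' :: "'g free \<Rightarrow> 'g free"
  assumes q': "q * q' = 1" and p': "p * p' = 1"
    and op_add: "f \<in> {J, T, Y, W, Z, Z'} \<Longrightarrow> f (x + y) = f x + f y"
    and op_scale: "f \<in> {J, T, Y, W, Z, Z'} \<Longrightarrow> f (k \<cdot> x) = k \<cdot> f x"
    and J_op: "f \<in> {J, T, Y, W, Z, Z'} \<Longrightarrow> J (f x) = f x"
    and op_J: "f \<in> {J, T, Y, W, Z, Z'} \<Longrightarrow> f (J x) = f x"
    and YW: "Y (W x) = (p * m * q') \<cdot> J x" and WY: "W (Y x) = (p * m * q') \<cdot> J x"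
    and ZZ': "Z (Z' x) = J x" and Z'Z: "Z' (Z x) = J x"
    and TT: "T (T x) = - (p + 1) \<cdot> T x - p \<cdot> J x"
    and TZ: "T (Z x) = Z' (T x) + (p + 1) \<cdot> Z' x - s \<cdot> J x"
    and TZ': "T (Z' x) = Z (T x) - (p + 1) \<cdot> Z' x + s \<cdot> J x"
    and TY: "T (Y x) = W (T x) - (p + 1) \<cdot> Y x + (p * (1 + m*q')) \<cdot> J x"
    and TW: "T (W x) = Y (T x) + (p + 1) \<cdot> Y x - (p * (1 + m*q')) \<cdot> J x"
    and YZ: "Y (Z x) = q \<cdot> Z (Y x) + ((1+p)*q*p') \<cdot> Z' (W (T x)) - (s*q*p') \<cdot> W (T x)
         - (1 + m*q') \<cdot> Z' (T x) - ((1-q)*(1+p)*(1 + m*q')) \<cdot> Z' x + t \<cdot> T x + ((1-q)*s*(1 + m*q')) \<cdot> J x"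
    and YZ': "Y (Z' x) = q' \<cdot> Z' (Y x) - ((1+p)*q'*p') \<cdot> Z' (W (T x)) + (s*q'*p') \<cdot> W (T x)
         + ((1 + m*q')*q') \<cdot> Z' (T x) - (t*q') \<cdot> T x"
    and WZ: "W (Z x) = q' \<cdot> Z (W x) - (q*(1+p)*p') \<cdot> Z' (W (T x)) + (s*p') \<cdot> W (T x)
         + (1 + m*q') \<cdot> Z' (T x) + ((1-q)*(1+p)*(1 + m*q')) \<cdot> Z' x - (t*q') \<cdot> T x
             - ((1-q)*(1+p)*t*q') \<cdot> J x"
    and WZ': "W (Z' x) = q \<cdot> Z' (W x) + (q*(1+p)*p') \<cdot> Z' (W (T x)) - (s*p') \<cdot> W (T x)
         - (q*(1 + m*q')) \<cdot> Z' (T x) + t \<cdot> T x"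
begin

lemma op_uminus: "f \<in> {J, T, Y, W, Z, Z'} \<Longrightarrow> f (- x) = - f x"
  using op_scale[of f "-1" x] by simp

lemma op_diff: "f \<in> {J, T, Y, W, Z, Z'} \<Longrightarrow> f (x - y) = f x - f y"
  using op_add[of f x "- y"] by (simp add: op_uminus)

lemmas linear = op_add[of J] op_add[of T] op_add[of Y] op_add[of W] op_add[of Z] op_add[of Z']
  op_scale[of J] op_scale[of T] op_scale[of Y] op_scale[of W] op_scale[of Z] op_scale[of Z']
  op_diff[of J] op_diff[of T] op_diff[of Y] op_diff[of W] op_diff[of Z] op_diff[of Z']
  op_uminus[of J] op_uminus[of T] op_uminus[of Y] op_uminus[of W] op_uminus[of Z] op_uminus[of Z']
  J_op[of J] J_op[of T] J_op[of Y] J_op[of W] J_op[of Z] J_op[of Z']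
  op_J[of J] op_J[of T] op_J[of Y] op_J[of W] op_J[of Z] op_J[of Z']

lemmas rules = linear[simplified] YW WY ZZ' Z'Z TT TZ TZ' TY TW YZ YZ' WZ WZ'

lemma q'': "q * (q' * k) = k" and p'': "p * (p' * k) = k"
  using q' p' by (simp_all add: mult.assoc[symmetric])

lemmas normalize = lookup_add lookup_minus lookup_scale lookup_uminus
lemmas laurent = q' p' q'' p'' power2_eq_square power3_eq_cube power4_eq_xxxx algebra_simps

section \<open>Askey-Wilson operators and their relations on the eigenspaces of
  \<open>T\<close>\<close>

definition "K0' x = Y x + W x"
definition "K1' x = Z x + Z' x"
definition "K2' x = q \<cdot> K0' (K1' x) - K1' (K0' x)"

lemma T_K0: "T (K0' x) = K0' (T x)"
  by (rule poly_mapping_eqI) (simp add: K0'_def rules normalize algebra_simps)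

lemma T_K1: "T (K1' x) = K1' (T x)"
  by (rule poly_mapping_eqI) (simp add: K1'_def rules normalize algebra_simps)

lemma K_linear [simp]:
  "K0' (x + y) = K0' x + K0' y" "K0' (x - y) = K0' x - K0' y" "K0' (k \<cdot> x) = k \<cdot> K0' x" "K0' (- x) = - K0' x"
  "K1' (x + y) = K1' x + K1' y" "K1' (x - y) = K1' x - K1' y" "K1' (k \<cdot> x) = k \<cdot> K1' x" "K1' (- x) = - K1' x"
  "J (K0' x) = K0' x" "J (K1' x) = K1' x" "K0' (J x) = K0' x" "K1' (J x) = K1' x"
  by (simp_all add: K0'_def K1'_def rules algebra_simps)

lemma T_K2: "T (K2' x) = K2' (T x)"
  by (simp add: K2'_def T_K0 T_K1 rules)

text \<open>The structure constants in the parameters of the locale: e1 = s + t, e2 = p + m + s t,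
  e3 = p t + s m, e4 = p m, and c^2 + d^2 = t^2 - 2 m.\<close>

definition "B = (1 - q')^2 * (p*t + s*m + q*(s+t))"
definition "C0 = (q - q')^2"
definition "C1 = q' * (q - q')^2 * p * m"
definition "D0 = - (q'^3) * (1-q)^2 * (1+q) * (p*m + q*(p+m+s*t) + q^2)"
definition "D1 = - (q'^3) * (1-q)^2 * (1+q) * ((s+t)*p*m + q*(p*t+s*m))"
definition "Q0 = q'^4 * (1-q)^2 * (q^4 * (p*m - (p+m+s*t)) + q^3 * ((s+t)^2 - (s+t)*(p*t+s*m) - 2*(p+m+s*t))
   - q^2 * ((p+m+s*t)*(p*m) + 2*(p*m) + (p+m+s*t)) + q * ((p*t+s*m)^2 - 2*(p+m+s*t)*(p*m) - (s+t)*(p*t+s*m))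
   + p*m*(1-(p+m+s*t)))"
definition "E = - (q'^2) * (1-q)^3 * t"
definition "F0 = q'^3 * (1-q)^3 * (1+q) * (m + q)"
definition "F1 = q'^3 * (1-q)^3 * (1+q) * s * m"
definition "G = - (q'^4) * (1-q)^3 * (s*t*(m*(q^2+1)+q) - q*(p+1)*((t^2-2*m)*(q+1) - m) + (m+p*m)*(q^2+1) + (m+s*t+p*m)*q^3)"

lemmas constants = B_def C0_def C1_def D0_def D1_def Q0_def E_def F0_def F1_def G_def

text \<open>
  In terms of the \<open>q\<close>-commutator \<open>K2'\<close> the cubic relations become \<open>q\<close>-commutation relations, and
  the quartic expression needs no word longer than two \<open>K2'\<close>.
\<close>

lemma casimir_conv:
  "K1' (K0' (K1' (K0' x))) - (q^2 + 1 + q'^2) \<cdot> K0' (K1' (K0' (K1' x))) + (q + q') \<cdot> K0' (K0' (K1' (K1' x)))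
   = q'^2 \<cdot> K2' (K2' x) + (q'^2 - 1) \<cdot> K1' (K0' (K2' x)) - q \<cdot> K1' (K2' (K0' x) - q' \<cdot> K0' (K2' x))
     + q \<cdot> (K1' (K2' (K0' x)) - q' \<cdot> K2' (K1' (K0' x))) - (q + q') \<cdot> K0' (K1' (K2' x) - q' \<cdot> K2' (K1' x))"
  by (rule poly_mapping_eqI, simp add: K2'_def normalize) (simp add: laurent)

text \<open>The condition on \<open>e\<close> says (e + 1)(e + p) = 0. Keeping \<open>e\<close>
  symbolic covers both eigenvalues of \<open>T\<close> by one computation, in which \<open>T\<close>
  becomes a scalar on \<open>x\<close>.\<close>

definition "eig e x \<longleftrightarrow> e*e = - (p+1)*e - p \<and> J x = x \<and> T x = e \<cdot> x"

lemma eig_K: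
  assumes "eig e x" shows "eig e (K0' x)" "eig e (K1' x)" "eig e (K2' x)"
  using assms by (simp_all add: eig_def T_K0 T_K1 T_K2) (simp_all add: K2'_def rules algebra_simps)

text \<open>Up to the factor q^2 - 1 and the scalar \<open>\<gamma> e\<close>, this is the normal
  form of the q-commutator on an eigenspace, as \<open>K2_eq\<close> shows. Its leading monomial Z Y
  links the q-commutator with the compression of Z Y.\<close>

definition "D e x = Z (Y x) + (1 + e + e*p') \<cdot> Z' (W x) - (e*(1+m*q')) \<cdot> Z' x - (e*s*p') \<cdot> W x"
definition "\<gamma> e = (q-1) * ((2*e+p+1)*t - q*s - s*m)"
text \<open>On the \<open>e\<close>-eigenspace T + p is the scalar e + p, so the terms with
  \<open>E\<close>, \<open>F0\<close> and \<open>F1\<close> merge into the coefficients of the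
  unextended relations.\<close>

definition "B' e = B + (e+p)*E"
definition "D0' e = D0 + (e+p)*F0"
definition "D1' e = D1 + (e+p)*F1"

lemma D_linear [simp]:
  "D e (x + y) = D e x + D e y" "D e (x - y) = D e x - D e y" "D e (k \<cdot> x) = k \<cdot> D e x"
  by (simp_all add: D_def rules algebra_simps)

lemma eigD:
  assumes "eig e x"
  shows "e*e = - (p+1)*e - p" "e*(e*k) = - (p+1)*(e*k) - p*k" "J x = x" "T x = e \<cdot> x"
  using assms by (auto simp: eig_def left_diff_distrib simp flip: mult.assoc)

lemma K2_eq:
  assumes "eig e x"
  shows "K2' x = (q^2-1) \<cdot> D e x + \<gamma> e \<cdot> x"
  by (rule poly_mapping_eqI, simp add: eigD(3,4)[OF assms] K2'_def K1'_def K0'_def rules normalize D_def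
      \<gamma>_def) (simp add: eigD(1,2)[OF assms] laurent)

lemma rel4:
  assumes "eig e x"
  shows "K1' (K2' x) - q' \<cdot> K2' (K1' x) = B' e \<cdot> K1' x + C0 \<cdot> K0' x + D0' e \<cdot> x"
  unfolding K2_eq[OF assms] K2_eq[OF eig_K(2)[OF assms]]
  by (rule poly_mapping_eqI, simp add: eigD(3,4)[OF assms] K1'_def K0'_def rules normalize constants D_def
      \<gamma>_def B'_def D0'_def) (simp add: eigD(1,2)[OF assms] laurent)

lemma rel5:
  assumes "eig e x"
  shows "K2' (K0' x) - q' \<cdot> K0' (K2' x) = B' e \<cdot> K0' x + C1 \<cdot> K1' x + D1' e \<cdot> x"
  unfolding K2_eq[OF assms] K2_eq[OF eig_K(1)[OF assms]]
  by (rule poly_mapping_eqI, simp add: eigD(3,4)[OF assms] K1'_def K0'_def rules normalize constants D_def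
      \<gamma>_def B'_def D1'_def) (simp add: eigD(1,2)[OF assms] laurent)

text \<open>Normal forms: every word is a combination of monomials \<open>Z\<^sup>i Y\<^sup>j x\<close>, with \<open>W\<close> for \<open>Y\<^sup>-\<^sup>1\<close>.\<close>

lemma K0_D:
  assumes "eig e x"
  shows "K0' (D e x) = q \<cdot> Z (Y (Y x))
      + (q*e + q + q*p'*e) \<cdot> Z' (W (W x))
      + (- (q*p'*s*e)) \<cdot> W (W x)
      + (- (q*e) - m*e) \<cdot> Z' (Y x)
      + (- (q*e) - m*e) \<cdot> Z' (W x)
      + (q'^2*p*m) \<cdot> Z x
      + (- (q*s) - s*m + s + t*e + q'*s*m - q'*t*e) \<cdot> Y x
      + (- (q*s) - s*m + s + t*e + q'*s*m - q'*t*e) \<cdot> W x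
      + (p*m*e + m*e + q'^2*p*m) \<cdot> Z' x
      + (p*s*m + p*t + s*m - q'*p*s*m + q'*p*m*t - q'*p*t - 2*q'*s*m*e - q'*s*m - q'^2*p*m*t + q'^2*s*m*e) \<cdot> x"
  by (rule poly_mapping_eqI, simp add: eigD(3,4)[OF assms] K0'_def rules normalize D_def) (simp add: eigD(1,2)[OF assms] laurent)

lemma D_D:
  assumes "eig e x"
  shows "D e (D e x) = q \<cdot> Z (Z (Y (Y x)))
      + (q*e + q + q*p'*e) \<cdot> Z' (Z' (W (W x)))
      + (- (q*p'*s*e)) \<cdot> Z (W (W x))
      + (- (q*p'*s*e)) \<cdot> Z' (W (W x))
      + (- (q*e) - m*e) \<cdot> Z' (Z' (Y x))
      + (- (q*e) - m*e) \<cdot> Z' (Z' (W x))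
      + (- (q*s) - p*t - s*m + s - t + q'*s*m - q'*t*e) \<cdot> Z (Y x)
      + (- (q*s) - s*m + t*e) \<cdot> Z (W x)
      + (q*e + q*p'*e) \<cdot> W (W x)
      + (- (q*s) - s*m + t*e) \<cdot> Z' (Y x)
      + (- (q*s) - s*m + s*e + s + p'*s*e + q'*p*t*e + q'*p*t + q'*s*m*e + q'*s*m + q'*t*e + q'*t + q'*p'*s*m*e
          + q'*p'*t*e) \<cdot> Z' (W x)
      + (p*m*e + m*e) \<cdot> Z' (Z' x)
      + (p*s*m + p*t + s*m + q'*p*m*t - q'*s*m*e) \<cdot> Z x
      + (q*p + q + p*m + s*t + m - e - q'*m*e) \<cdot> Y x
      + (q*p + q + p*m + m - e - p'*s^2*e - q'*s*t*e - q'*s*t - q'*m*e - q'*p'*s^2*m*e - q'*p'*s*t*e) \<cdot> W x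
      + (p*s*m + s*m - s*e - q'*p*t*e - q'*p*t - 3*q'*s*m*e - q'*t*e - q'^2*p*m*t*e - q'^2*p*m*t - q'^2*s*m^2*e
          - q'^2*m*t*e) \<cdot> Z' x
      + (- (p^2*m) - 2*p*m - p - m - 2*q'*p*m - q'*s^2*m + q'*s*t*e - q'^2*p*m^2 + q'^2*p*m*e + 2*q'^2*p*m
          + q'^2*s*m*t*e + q'^2*m*e) \<cdot> x"
  by (rule poly_mapping_eqI, simp add: eigD(3,4)[OF assms] rules normalize D_def) (simp add: eigD(1,2)[OF assms] laurent)

text \<open>The coefficient of each normal form monomial vanishes separately.\<close>

lemma casimir_D:
  assumes "eig e x"
  shows "(q'^2*(q^2-1)^2) \<cdot> D e (D e x) + (2*q'^2*(q^2-1)*\<gamma> e + q'*B' e*(q^2-1)) \<cdot> D e x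
    + ((q'^2-1)*(q^2-1)) \<cdot> K1' (K0' (D e x)) + ((q'^2-1)*\<gamma> e + (1+q')*B' e) \<cdot> K1' (K0' x)
    + (q*C0) \<cdot> K0' (K0' x) + (q'*C1) \<cdot> K1' (K1' x) + ((1+q)*D0' e) \<cdot> K0' x + ((1+q')*D1' e) \<cdot> K1' x
    + (q'^2*(\<gamma> e)^2 + q'*B' e*\<gamma> e + (e+p)*G - Q0) \<cdot> x = 0"
proof -
  note ee = eigD(1,2)[OF assms] and x = eigD(3,4)[OF assms]
  \<comment> \<open>Names for the nine coefficients keep the collection of monomials at the end
    linear in them.\<close>
  define A1 where "A1 = q'^2*(q^2-1)^2"
  define A2 where "A2 = 2*q'^2*(q^2-1)*\<gamma> e + q'*B' e*(q^2-1)"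
  define A3 where "A3 = (q'^2-1)*(q^2-1)"
  define A4 where "A4 = (q'^2-1)*\<gamma> e + (1+q')*B' e"
  define A5 where "A5 = q*C0"
  define A6 where "A6 = q'*C1"
  define A7 where "A7 = (1+q)*D0' e"
  define A8 where "A8 = (1+q')*D1' e"
  define A9 where "A9 = q'^2*(\<gamma> e)^2 + q'*B' e*\<gamma> e + (e+p)*G - Q0"
  note A = A1_def A2_def A3_def A4_def A5_def A6_def A7_def A8_def A9_def \<gamma>_def B'_def D0'_def D1'_def
  have h0: "A1*(q) + A3*(q) = 0"
    unfolding A constants by (simp add: ee laurent)
  have h1: "A1*(q*e + q + q*p'*e) + A3*(q*e + q + q*p'*e) = 0"
    unfolding A constants by (simp add: ee laurent)
  have h2: "A1*(- (q*p'*s*e)) + A3*(- (q*p'*s*e)) = 0"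
    unfolding A constants by (simp add: ee laurent)
  have h3: "A1*(- (q*p'*s*e)) + A3*(- (q*p'*s*e)) = 0"
    unfolding A constants by (simp add: ee laurent)
  have h4: "A1*(- (q*e) - m*e) + A3*(- (q*e) - m*e) = 0"
    unfolding A constants by (simp add: ee laurent)
  have h5: "A1*(- (q*e) - m*e) + A3*(- (q*e) - m*e) = 0"
    unfolding A constants by (simp add: ee laurent)
  have h6: "A3*(q'^2*p*m) + A6 = 0"
    unfolding A constants by (simp add: ee laurent)
  have h7: "A1*(- (q*s) - p*t - s*m + s - t + q'*s*m - q'*t*e) + A2 + A3*(- (q*s) - s*m + s + t*e + q'*s*m - q'*t*e) + A4 = 0"
    unfolding A constants by (simp add: ee laurent)
  have h8: "A1*(- (q*s) - s*m + t*e) + A3*(- (q*s) - s*m + s + t*e + q'*s*m - q'*t*e) + A4 = 0"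
    unfolding A constants by (simp add: ee laurent)
  have h9: "A3*(q) + A5 = 0"
    unfolding A constants by (simp add: ee laurent)
  have h10: "A1*(q*e + q*p'*e) + A3*(q*e + q + q*p'*e) + A5 = 0"
    unfolding A constants by (simp add: ee laurent)
  have h11: "A1*(- (q*s) - s*m + t*e) + A3*(- (q*s) - s*m + s + t*e + q'*s*m - q'*t*e) + A4 = 0"
    unfolding A constants by (simp add: ee laurent)
  have h12: "A1*(- (q*s) - s*m + s*e + s + p'*s*e + q'*p*t*e + q'*p*t + q'*s*m*e + q'*s*m + q'*t*e + q'*t
      + q'*p'*s*m*e + q'*p'*t*e) + A2*(e + 1 + p'*e) + A3*(- (q*s) - s*m + s + t*e + q'*s*m - q'*t*e) + A4 = 0"
    unfolding A constants by (simp add: ee laurent)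
  have h13: "A1*(p*m*e + m*e) + A3*(p*m*e + m*e + q'^2*p*m) + A6 = 0"
    unfolding A constants by (simp add: ee laurent)
  have h14: "A1*(p*s*m + p*t + s*m + q'*p*m*t - q'*s*m*e) + A3*(p*s*m + p*t + s*m - q'*p*s*m + q'*p*m*t - q'*p*t
      - 2*q'*s*m*e - q'*s*m - q'^2*p*m*t + q'^2*s*m*e) + A8 = 0"
    unfolding A constants by (simp add: ee laurent)
  have h15: "A1*(q*p + q + p*m + s*t + m - e - q'*m*e) + A3*(- (q*e) - m*e) + A7 = 0"
    unfolding A constants by (simp add: ee laurent)
  have h16: "A1*(q*p + q + p*m + m - e - p'*s^2*e - q'*s*t*e - q'*s*t - q'*m*e - q'*p'*s^2*m*e - q'*p'*s*t*e)
      + A2*(- (p'*s*e)) + A3*(- (q*e) - m*e) + A7 = 0"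
    unfolding A constants by (simp add: ee laurent)
  have h17: "A1*(p*s*m + s*m - s*e - q'*p*t*e - q'*p*t - 3*q'*s*m*e - q'*t*e - q'^2*p*m*t*e - q'^2*p*m*t
      - q'^2*s*m^2*e - q'^2*m*t*e) + A2*(- (e) - q'*m*e) + A3*(p*s*m + p*t + s*m - q'*p*s*m + q'*p*m*t - q'*p*t
      - 2*q'*s*m*e - q'*s*m - q'^2*p*m*t + q'^2*s*m*e) + A8 = 0"
    unfolding A constants by (simp add: ee laurent)
  have h18: "A1*(- (p^2*m) - 2*p*m - p - m - 2*q'*p*m - q'*s^2*m + q'*s*t*e - q'^2*p*m^2 + q'^2*p*m*e + 2*q'^2*p*m
      + q'^2*s*m*t*e + q'^2*m*e) + A3*(p*m*e + m*e + 2*q'^2*p*m) + A5*(2*q'*p*m) + A6*(2) + A9 = 0"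
    unfolding A constants by (simp add: ee laurent)
  have "A1 \<cdot> D e (D e x) + A2 \<cdot> D e x + A3 \<cdot> K1' (K0' (D e x)) + A4 \<cdot> K1' (K0' x)
    + A5 \<cdot> K0' (K0' x) + A6 \<cdot> K1' (K1' x) + A7 \<cdot> K0' x + A8 \<cdot> K1' x
        + A9 \<cdot> x = (A1*(q) + A3*(q)) \<cdot> Z (Z (Y (Y x)))
      + (A1*(q*e + q + q*p'*e) + A3*(q*e + q + q*p'*e)) \<cdot> Z' (Z' (W (W x)))
      + (A1*(- (q*p'*s*e)) + A3*(- (q*p'*s*e))) \<cdot> Z (W (W x))
      + (A1*(- (q*p'*s*e)) + A3*(- (q*p'*s*e))) \<cdot> Z' (W (W x))
      + (A1*(- (q*e) - m*e) + A3*(- (q*e) - m*e)) \<cdot> Z' (Z' (Y x))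
      + (A1*(- (q*e) - m*e) + A3*(- (q*e) - m*e)) \<cdot> Z' (Z' (W x))
      + (A3*(q'^2*p*m) + A6) \<cdot> Z (Z x)
      + (A1*(- (q*s) - p*t - s*m + s - t + q'*s*m - q'*t*e) + A2 + A3*(- (q*s) - s*m + s + t*e + q'*s*m - q'*t*e)
          + A4) \<cdot> Z (Y x)
      + (A1*(- (q*s) - s*m + t*e) + A3*(- (q*s) - s*m + s + t*e + q'*s*m - q'*t*e) + A4) \<cdot> Z (W x)
      + (A3*(q) + A5) \<cdot> Y (Y x)
      + (A1*(q*e + q*p'*e) + A3*(q*e + q + q*p'*e) + A5) \<cdot> W (W x)
      + (A1*(- (q*s) - s*m + t*e) + A3*(- (q*s) - s*m + s + t*e + q'*s*m - q'*t*e) + A4) \<cdot> Z' (Y x)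
      + (A1*(- (q*s) - s*m + s*e + s + p'*s*e + q'*p*t*e + q'*p*t + q'*s*m*e + q'*s*m + q'*t*e + q'*t + q'*p'*s*m*e
          + q'*p'*t*e) + A2*(e + 1 + p'*e) + A3*(- (q*s) - s*m + s + t*e + q'*s*m - q'*t*e) + A4) \<cdot> Z' (W x)
      + (A1*(p*m*e + m*e) + A3*(p*m*e + m*e + q'^2*p*m) + A6) \<cdot> Z' (Z' x)
      + (A1*(p*s*m + p*t + s*m + q'*p*m*t - q'*s*m*e) + A3*(p*s*m + p*t + s*m - q'*p*s*m + q'*p*m*t - q'*p*t
          - 2*q'*s*m*e - q'*s*m - q'^2*p*m*t + q'^2*s*m*e) + A8) \<cdot> Z x
      + (A1*(q*p + q + p*m + s*t + m - e - q'*m*e) + A3*(- (q*e) - m*e) + A7) \<cdot> Y x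
      + (A1*(q*p + q + p*m + m - e - p'*s^2*e - q'*s*t*e - q'*s*t - q'*m*e - q'*p'*s^2*m*e - q'*p'*s*t*e)
          + A2*(- (p'*s*e)) + A3*(- (q*e) - m*e) + A7) \<cdot> W x
      + (A1*(p*s*m + s*m - s*e - q'*p*t*e - q'*p*t - 3*q'*s*m*e - q'*t*e - q'^2*p*m*t*e - q'^2*p*m*t - q'^2*s*m^2*e
          - q'^2*m*t*e) + A2*(- (e) - q'*m*e) + A3*(p*s*m + p*t + s*m - q'*p*s*m + q'*p*m*t - q'*p*t - 2*q'*s*m*e
          - q'*s*m - q'^2*p*m*t + q'^2*s*m*e) + A8) \<cdot> Z' x
      + (A1*(- (p^2*m) - 2*p*m - p - m - 2*q'*p*m - q'*s^2*m + q'*s*t*e - q'^2*p*m^2 + q'^2*p*m*e + 2*q'^2*p*m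
          + q'^2*s*m*t*e + q'^2*m*e) + A3*(p*m*e + m*e + 2*q'^2*p*m) + A5*(2*q'*p*m) + A6*(2) + A9) \<cdot> x"
    unfolding D_D[OF assms] K0_D[OF assms]
    by (rule poly_mapping_eqI, simp add: x K1'_def K0'_def rules normalize D_def) (simp add: ee laurent)
  then show ?thesis
    unfolding h0 h1 h2 h3 h4 h5 h6 h7 h8 h9 h10 h11 h12 h13 h14 h15 h16 h17 h18 unfolding A1_def A2_def A3_def A4_def
        A5_def A6_def A7_def A8_def A9_def by simp
qed

lemma rel4_eig:
  assumes "eig e x"
  shows "(q + q') \<cdot> K1' (K0' (K1' x)) - K1' (K1' (K0' x)) - K0' (K1' (K1' x))
    = B' e \<cdot> K1' x + C0 \<cdot> K0' x + D0' e \<cdot> x"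
  unfolding rel4[OF assms, symmetric]
  by (rule poly_mapping_eqI) (simp add: K2'_def normalize laurent)

lemma rel5_eig:
  assumes "eig e x"
  shows "(q + q') \<cdot> K0' (K1' (K0' x)) - K0' (K0' (K1' x)) - K1' (K0' (K0' x))
    = B' e \<cdot> K0' x + C1 \<cdot> K1' x + D1' e \<cdot> x"
  unfolding rel5[OF assms, symmetric]
  by (rule poly_mapping_eqI) (simp add: K2'_def normalize laurent)

text \<open>Besides the square of \<open>K2'\<close> and \<open>K1' (K0' (K2' x))\<close>,
  \<open>casimir_conv\<close> leaves only q-commutators, which \<open>rel4\<close> and
  \<open>rel5\<close> evaluate. Writing \<open>K2'\<close> through \<open>D\<close> reduces the rest
  to \<open>casimir_D\<close>.\<close>

lemma casimir_eig:
  assumes "eig e x"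
  shows "K1' (K0' (K1' (K0' x))) - (q^2 + 1 + q'^2) \<cdot> K0' (K1' (K0' (K1' x))) + (q + q') \<cdot> K0' (K0' (K1' (K1' x)))
    + (q + q') \<cdot> (C0 \<cdot> K0' (K0' x) + C1 \<cdot> K1' (K1' x))
    + B' e \<cdot> ((q + 1 + q') \<cdot> K0' (K1' x) + K1' (K0' x))
    + (q + 1 + q') \<cdot> (D0' e \<cdot> K0' x + D1' e \<cdot> K1' x) + ((e + p) * G) \<cdot> x = Q0 \<cdot> x"
proof -
  have K01: "K0' (K1' x) = q' \<cdot> ((q^2-1) \<cdot> D e x + \<gamma> e \<cdot> x + K1' (K0' x))"
    unfolding K2_eq[OF assms, symmetric] K2'_def by (simp add: q' mult.commute)
  have KD: "K0' (K2' x) = (q^2-1) \<cdot> K0' (D e x) + \<gamma> e \<cdot> K0' x"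
    by (simp add: K2_eq[OF assms])
  have "K2' (K2' x) = (q^2-1) \<cdot> D e (K2' x) + \<gamma> e \<cdot> K2' x"
    by (rule K2_eq[OF eig_K(3)[OF assms]])
  also have "\<dots> = (q^2-1) \<cdot> ((q^2-1) \<cdot> D e (D e x) + \<gamma> e \<cdot> D e x)
      + \<gamma> e \<cdot> ((q^2-1) \<cdot> D e x + \<gamma> e \<cdot> x)"
    by (simp add: K2_eq[OF assms])
  finally have KK: "K2' (K2' x) = \<dots>" .
  have "K1' (K0' (K1' (K0' x))) - (q^2 + 1 + q'^2) \<cdot> K0' (K1' (K0' (K1' x))) + (q + q') \<cdot> K0' (K0' (K1' (K1' x)))
    = q'^2 \<cdot> K2' (K2' x) + (q'^2 - 1) \<cdot> K1' (K0' (K2' x))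
      - q \<cdot> K1' (B' e \<cdot> K0' x + C1 \<cdot> K1' x + D1' e \<cdot> x)
      + q \<cdot> (B' e \<cdot> K1' (K0' x) + C0 \<cdot> K0' (K0' x) + D0' e \<cdot> K0' x)
      - (q + q') \<cdot> K0' (B' e \<cdot> K1' x + C0 \<cdot> K0' x + D0' e \<cdot> x)"
    unfolding casimir_conv rel5[OF assms] rel4[OF assms] rel4[OF eig_K(1)[OF assms]] ..
  then show ?thesis
    apply (simp add: KD KK K01)
    apply (rule poly_mapping_eqI)
    subgoal for k
      using arg_cong[OF casimir_D[OF assms], of "\<lambda>v. Poly_Mapping.lookup v k"]
      by (simp add: normalize laurent)
    done
qed

text \<open>For p \<noteq> 1 the eigenvalues -1 and -p are distinct, and k (T + p) and -k (T + 1)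
  with k = 1/(p - 1) are complementary spectral projections. An additive map that factors through
  \<open>J\<close> is thus determined by its values on eigenvectors.\<close>

lemma eig_decomposition:
  assumes "p \<noteq> 1" "\<And>x y. F (x + y) = F x + F y" "\<And>x. F (J x) = F x"
    "\<And>e x. eig e x \<Longrightarrow> F x = (0 :: 'g free)"
  shows "F x = 0"
proof -
  define k where "k = 1 / (p - 1)"
  have 1: "eig (-1) (k \<cdot> (T x + p \<cdot> J x))"
    unfolding eig_def
    by (auto intro!: poly_mapping_eqI simp: rules normalize algebra_simps)
  have 2: "eig (-p) ((- k) \<cdot> (T x + J x))"
    unfolding eig_def
    by (auto intro!: poly_mapping_eqI simp: rules normalize algebra_simps)
  have "k * (p - 1) = 1" using assms(1) by (simp add: k_def)
  moreover have "k * (u + p * v) - k * (u + v) = (k * (p - 1)) * v" for u v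
    by (simp add: algebra_simps)
  ultimately have *: "k * (u + p * v) - k * (u + v) = v" for u v
    by (metis mult_1)
  have Jx: "J x = k \<cdot> (T x + p \<cdot> J x) + (- k) \<cdot> (T x + J x)"
    by (rule poly_mapping_eqI) (simp only: normalize mult_minus_left add_uminus_conv_diff *)
  have "F (J x) = 0"
    by (subst Jx) (simp only: assms(2) assms(4)[OF 1] assms(4)[OF 2] add_0)
  then show ?thesis by (simp add: assms(3))
qed

lemma rel4_all:
  assumes "p \<noteq> 1"
  shows "(q + q') \<cdot> K1' (K0' (K1' x)) - K1' (K1' (K0' x)) - K0' (K1' (K1' x))
    - (B \<cdot> K1' x + C0 \<cdot> K0' x + D0 \<cdot> J x + E \<cdot> K1' (T x + p \<cdot> J x) + F0 \<cdot> (T x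
        + p \<cdot> J x)) = 0"
    (is "?F x = 0")
proof (rule eig_decomposition[of ?F, OF assms])
  show "?F x = 0" if "eig e x" for e x
    unfolding rel4_eig[OF that] using eigD(3,4)[OF that]
    by (intro poly_mapping_eqI) (simp add: normalize B'_def D0'_def algebra_simps)
qed (auto simp: rules algebra_simps)

lemma rel5_all:
  assumes "p \<noteq> 1"
  shows "(q + q') \<cdot> K0' (K1' (K0' x)) - K0' (K0' (K1' x)) - K1' (K0' (K0' x))
    - (B \<cdot> K0' x + C1 \<cdot> K1' x + D1 \<cdot> J x + E \<cdot> K0' (T x + p \<cdot> J x) + F1 \<cdot> (T x
        + p \<cdot> J x)) = 0"
    (is "?F x = 0")
proof (rule eig_decomposition[of ?F, OF assms])
  show "?F x = 0" if "eig e x" for e x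
    unfolding rel5_eig[OF that] using eigD(3,4)[OF that]
    by (intro poly_mapping_eqI) (simp add: normalize B'_def D1'_def algebra_simps)
qed (auto simp: rules algebra_simps)

lemma casimir_all:
  assumes "p \<noteq> 1"
  shows "K1' (K0' (K1' (K0' x))) - (q^2 + 1 + q'^2) \<cdot> K0' (K1' (K0' (K1' x))) + (q + q') \<cdot> K0' (K0' (K1' (K1' x)))
    + (q + q') \<cdot> (C0 \<cdot> K0' (K0' x) + C1 \<cdot> K1' (K1' x))
    + (B \<cdot> ((q + 1 + q') \<cdot> K0' (K1' x) + K1' (K0' x))
      + E \<cdot> (T ((q + 1 + q') \<cdot> K0' (K1' x) + K1' (K0' x)) + p \<cdot> ((q + 1 + q') \<cdot> K0' (K1' x)
          + K1' (K0' x))))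
    + (q + 1 + q') \<cdot> (D0 \<cdot> K0' x + F0 \<cdot> (T (K0' x) + p \<cdot> K0' x))
    + (q + 1 + q') \<cdot> (D1 \<cdot> K1' x + F1 \<cdot> (T (K1' x) + p \<cdot> K1' x)) + G \<cdot> (T x
        + p \<cdot> J x) - Q0 \<cdot> J x = 0"
    (is "?F x = 0")
proof (rule eig_decomposition[of ?F, OF assms])
  show "?F x = 0" if "eig e x" for e x
  proof (rule poly_mapping_eqI)
    fix k
    show "Poly_Mapping.lookup (?F x) k = Poly_Mapping.lookup 0 k"
      using arg_cong[OF casimir_eig[OF that], of "\<lambda>v. Poly_Mapping.lookup v k"] eigD(3,4)[OF that]
      by (simp add: normalize rules T_K0 T_K1 B'_def D0'_def D1'_def algebra_simps)
  qed
qed (auto simp: rules algebra_simps)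

text \<open>T + p is p - 1 times the antispherical idempotent, so on the eigenspace for -1 this
  formula and the next two compute the compressions of Z, Y and Z Y.\<close>

lemma minus_Z:
  assumes "eig (-1) v" shows "T (Z v) + p \<cdot> Z v = p \<cdot> K1' v - s \<cdot> v"
  by (rule poly_mapping_eqI)
    (simp add: eigD(3,4)[OF assms] K1'_def rules normalize algebra_simps)

lemma minus_Y:
  assumes "eig (-1) v" shows "T (Y v) + p \<cdot> Y v = (p * (1 + m*q')) \<cdot> v - K0' v"
  by (rule poly_mapping_eqI)
    (simp add: eigD(3,4)[OF assms] K0'_def rules normalize algebra_simps)

text \<open>The left-hand side is p \<open>D (-1) v\<close> - s \<open>K0' v\<close>, and
  \<open>K2_eq\<close> can be solved for \<open>D\<close> because q^2 \<noteq> 1.\<close>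

lemma minus_ZY:
  assumes "eig (-1) v" and "q^2 \<noteq> 1"
  shows "T (Z (Y v)) + p \<cdot> Z (Y v)
    = (p / (q^2-1)) \<cdot> (q \<cdot> K0' (K1' v) - K1' (K0' v) - \<gamma> (-1) \<cdot> v) - s \<cdot> K0' v"
proof -
  have "q \<cdot> K0' (K1' v) - K1' (K0' v) - \<gamma> (-1) \<cdot> v = (q^2-1) \<cdot> D (-1) v"
    using K2_eq[OF assms(1)] by (simp add: K2'_def)
  moreover have "T (Z (Y v)) + p \<cdot> Z (Y v) = p \<cdot> D (-1) v - s \<cdot> K0' v"
    by (rule poly_mapping_eqI)
      (simp add: eigD(3,4)[OF assms(1)] K0'_def D_def rules normalize laurent)
  ultimately show ?thesis
    using assms(2) by simp
qed

end

text \<open>One fixed choice, so that operators can be built from it. Equality of projections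
  replaces congruence modulo the ideal, which opens the quotient to rewriting.\<close>

definition proj :: "'g free set \<Rightarrow> 'g free \<Rightarrow> 'g free" where
  "proj R = (SOME \<pi>. (\<forall>x y. \<pi> (x + y) = \<pi> x
      + \<pi> y) \<and> (\<forall>k x. \<pi> (k \<cdot> x) = k \<cdot> \<pi> x)
     \<and> (\<forall>x. \<pi> x = 0 \<longleftrightarrow> x \<in> rel_ideal R) \<and> (\<forall>x. x
         - \<pi> x \<in> rel_ideal R))"

lemma proj_props:
  "(\<forall>x y. proj R (x + y) = proj R x + proj R y) \<and> (\<forall>k x. proj R (k \<cdot> x) = k \<cdot> proj R x)
     \<and> (\<forall>x. proj R x = 0 \<longleftrightarrow> x \<in> rel_ideal R) \<and> (\<forall>x. x
         - proj R x \<in> rel_ideal R)"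
proof -
  have "\<exists>\<pi>. (\<forall>x y. \<pi> (x + y) = \<pi> x
      + \<pi> y) \<and> (\<forall>k x. \<pi> (k \<cdot> x) = k \<cdot> \<pi> x)
     \<and> (\<forall>x. \<pi> x = 0 \<longleftrightarrow> x \<in> rel_ideal R) \<and> (\<forall>x. x
         - \<pi> x \<in> rel_ideal R)"
    by (rule exists_projection[of R]) blast
  then show ?thesis
    unfolding proj_def by (rule someI_ex)
qed

lemma proj_add: "proj R (x + y) = proj R x + proj R y"
  and proj_scale: "proj R (k \<cdot> x) = k \<cdot> proj R x"
  and proj_eq_0_iff: "proj R x = 0 \<longleftrightarrow> x \<in> rel_ideal R"
  and diff_proj: "x - proj R x \<in> rel_ideal R"
  using proj_props[of R] by blast+

lemma proj_uminus: "proj R (- x) = - proj R x"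
  using proj_scale[of R "-1" x] by simp

lemma proj_diff: "proj R (x - y) = proj R x - proj R y"
  using proj_add[of R x "- y"] by (simp add: proj_uminus)

lemma proj_eq_iff: "proj R x = proj R y \<longleftrightarrow> x - y \<in> rel_ideal R"
  using proj_eq_0_iff[of R "x - y"] by (simp add: proj_diff)

lemma proj_mult_proj: "proj R (y * proj R x) = proj R (y * x)"
  using rel_ideal_uminus[OF rel_ideal_mult_left[OF diff_proj[of x R], of y]] by (simp add: proj_eq_iff algebra_simps)

lemma proj_proj: "proj R (proj R x) = proj R x"
  using proj_mult_proj[of R 1 x] by simp

lemma proj_rel:
  assumes "r \<in> R" shows "proj R (r * x) = 0"
  using assms by (simp add: proj_eq_0_iff rel_ideal_mult_right rel_ideal_gen)

section \<open>Corners of the double affine Hecke algebra\<close>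

locale daha_params =
  fixes q a b c d :: complex
  assumes nz: "q \<noteq> 0" "a \<noteq> 0" "b \<noteq> 0" "c \<noteq> 0" "d \<noteq> 0" and ab: "a * b \<noteq> 1"
      and q2: "q^2 \<noteq> 1"
begin

abbreviation "R \<equiv> DAHA_rels q a b c d"
abbreviation "\<pi> \<equiv> proj R"

lemmas proj_expand = proj_add proj_diff proj_scale proj_uminus proj_mult_proj proj_proj
  left_diff_distrib right_diff_distrib distrib_left distrib_right mult.assoc
  free.scale_left_distrib free.scale_right_distrib free.scale_right_diff_distrib

definition "\<kappa> = 1/q*a*b*c*d"

lemma daha_rels:
  shows "gen hY*gen hY' - 1 \<in> R"
  and "gen hY'*gen hY - 1 \<in> R"
  and "gen hZ*gen hZ' - 1 \<in> R"
  and "gen hZ'*gen hZ - 1 \<in> R"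
  and "gen hT1^2 - (- (a*b+1) \<cdot> gen hT1 - (a*b) \<cdot> 1) \<in> R"
  and "gen hT1*gen hZ - (gen hZ'*gen hT1 + (a*b+1) \<cdot> gen hZ' - (a+b) \<cdot> 1) \<in> R"
  and "gen hT1*gen hZ' - (gen hZ*gen hT1 - (a*b+1) \<cdot> gen hZ' + (a+b) \<cdot> 1) \<in> R"
  and "gen hT1*gen hY - ((1/q*a*b*c*d) \<cdot> (gen hY'*gen hT1) - (a*b+1) \<cdot> gen hY + (a*b*(1
      + 1/q*c*d)) \<cdot> 1) \<in> R"
  and "gen hT1*gen hY' - ((q/(a*b*c*d)) \<cdot> (gen hY*gen hT1) + (q/(a*b*c*d)*(1+a*b)) \<cdot> gen hY
      - (q/(c*d)*(1 + 1/q*c*d)) \<cdot> 1) \<in> R"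
  and "gen hY*gen hZ - (q \<cdot> (gen hZ*gen hY) + ((1+a*b)*c*d) \<cdot> (gen hZ'*gen hY'*gen hT1)
      - ((a+b)*c*d) \<cdot> (gen hY'*gen hT1)
         - (1 + 1/q*c*d) \<cdot> (gen hZ'*gen hT1) - ((1-q)*(1+a*b)*(1 + 1/q*c*d)) \<cdot> gen hZ'
             + (c+d) \<cdot> gen hT1 + ((1-q)*(a+b)*(1 + 1/q*c*d)) \<cdot> 1) \<in> R"
  and "gen hY*gen hZ' - ((1/q) \<cdot> (gen hZ'*gen hY) - (1/q^2*(1+a*b)*c*d) \<cdot> (gen hZ'*gen hY'*gen hT1)
         + (1/q^2*(a+b)*c*d) \<cdot> (gen hY'*gen hT1) + (1/q*(1 + 1/q*c*d)) \<cdot> (gen hZ'*gen hT1)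
             - (1/q*(c+d)) \<cdot> gen hT1) \<in> R"
  and "gen hY'*gen hZ - ((1/q) \<cdot> (gen hZ*gen hY') - (q/(a*b)*(1+a*b)) \<cdot> (gen hZ'*gen hY'*gen hT1)
      + (1/(a*b)*(a+b)) \<cdot> (gen hY'*gen hT1)
         + (q/(a*b*c*d)*(1 + 1/q*c*d)) \<cdot> (gen hZ'*gen hT1) + (q/(a*b*c*d)*(1-q)*(1+a*b)*(1 + 1/q*c*d)) \<cdot> gen hZ'
         - (1/(a*b*c*d)*(c+d)) \<cdot> gen hT1 - (1/(a*b*c*d)*(1-q)*(1+a*b)*(c+d)) \<cdot> 1) \<in> R"
  and "gen hY'*gen hZ' - (q \<cdot> (gen hZ'*gen hY') + (q/(a*b)*(1+a*b)) \<cdot> (gen hZ'*gen hY'*gen hT1)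
      - (1/(a*b)*(a+b)) \<cdot> (gen hY'*gen hT1)
         - (q^2/(a*b*c*d)*(1 + 1/q*c*d)) \<cdot> (gen hZ'*gen hT1) + (q/(a*b*c*d)*(c+d)) \<cdot> gen hT1) \<in> R"
  unfolding DAHA_rels_def Let_def by ((rule insertI1 | rule insertI2)+)+

sublocale ops: daha_ops q "1/q" "a*b" "1/(a*b)" "a+b" "c*d" "c+d" \<pi>
  "\<lambda>x. \<pi> (gen hT1 * x)" "\<lambda>x. \<pi> (gen hY * x)" "\<lambda>x. \<kappa> \<cdot> \<pi> (gen hY' * x)"
  "\<lambda>x. \<pi> (gen hZ * x)" "\<lambda>x. \<pi> (gen hZ' * x)"
proof
  show "q * (1/q) = 1" "a * b * (1/(a*b)) = 1" using nz by simp_all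
  \<comment> \<open>Each operator identity is \<open>k\<close> times a defining relation applied to
    \<open>x\<close>; \<open>k\<close> is \<open>\<kappa>\<close> when W = \<open>\<kappa>\<close>
    Y^-1 occurs on the left-hand side, and 1 otherwise.\<close>
  have eqI: "u = v" if "\<And>w. Poly_Mapping.lookup u w - Poly_Mapping.lookup v w
      = k * Poly_Mapping.lookup (\<pi> (r * x)) w" "r \<in> R" for k u v r x
    using that proj_rel[of r R x] by (intro poly_mapping_eqI) simp
  note expand = \<kappa>_def proj_expand power2_eq_square lookup_add lookup_minus field_simps
  fix x
  show "\<pi> (gen hY * (\<kappa> \<cdot> \<pi> (gen hY' * x))) = (a*b*(c*d)*(1/q)) \<cdot> \<pi> x"
    by (rule eqI[where k = "\<kappa>" and x = x, OF _ daha_rels(1)]) (use nz in \<open>simp add: expand\<close>)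
  show "\<kappa> \<cdot> \<pi> (gen hY' * (\<pi> (gen hY * x))) = (a*b*(c*d)*(1/q)) \<cdot> \<pi> x"
    by (rule eqI[where k = "\<kappa>" and x = x, OF _ daha_rels(2)]) (use nz in \<open>simp add: expand\<close>)
  show "\<pi> (gen hZ * (\<pi> (gen hZ' * x))) = \<pi> x"
    by (rule eqI[where k = "1" and x = x, OF _ daha_rels(3)]) (use nz in \<open>simp add: expand\<close>)
  show "\<pi> (gen hZ' * (\<pi> (gen hZ * x))) = \<pi> x"
    by (rule eqI[where k = "1" and x = x, OF _ daha_rels(4)]) (use nz in \<open>simp add: expand\<close>)
  show "\<pi> (gen hT1 * (\<pi> (gen hT1 * x))) = - (a*b+1) \<cdot> \<pi> (gen hT1 * x) - (a*b) \<cdot> \<pi> x"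
    by (rule eqI[where k = "1" and x = x, OF _ daha_rels(5)]) (use nz in \<open>simp add: expand\<close>)
  show "\<pi> (gen hT1 * (\<pi> (gen hZ * x))) = \<pi> (gen hZ' * (\<pi> (gen hT1 * x)))
      + (a*b+1) \<cdot> \<pi> (gen hZ' * x) - (a+b) \<cdot> \<pi> x"
    by (rule eqI[where k = "1" and x = x, OF _ daha_rels(6)]) (use nz in \<open>simp add: expand\<close>)
  show "\<pi> (gen hT1 * (\<pi> (gen hZ' * x))) = \<pi> (gen hZ * (\<pi> (gen hT1 * x)))
      - (a*b+1) \<cdot> \<pi> (gen hZ' * x) + (a+b) \<cdot> \<pi> x"
    by (rule eqI[where k = "1" and x = x, OF _ daha_rels(7)]) (use nz in \<open>simp add: expand\<close>)
  show "\<pi> (gen hT1 * (\<pi> (gen hY * x))) = \<kappa> \<cdot> \<pi> (gen hY' * (\<pi> (gen hT1 * x)))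
      - (a*b+1) \<cdot> \<pi> (gen hY * x) + (a*b*(1 + c*d*(1/q))) \<cdot> \<pi> x"
    by (rule eqI[where k = "1" and x = x, OF _ daha_rels(8)]) (use nz in \<open>simp add: expand\<close>)
  show "\<pi> (gen hT1 * (\<kappa> \<cdot> \<pi> (gen hY' * x))) = \<pi> (gen hY * (\<pi> (gen hT1 * x)))
      + (a*b+1) \<cdot> \<pi> (gen hY * x) - (a*b*(1 + c*d*(1/q))) \<cdot> \<pi> x"
    by (rule eqI[where k = "\<kappa>" and x = x, OF _ daha_rels(9)]) (use nz in \<open>simp add: expand\<close>)
  show "\<pi> (gen hY * (\<pi> (gen hZ * x))) = q \<cdot> \<pi> (gen hZ * (\<pi> (gen hY * x))) + ((1
      + a*b)*q*(1/(a*b))) \<cdot> \<pi> (gen hZ' * (\<kappa> \<cdot> \<pi> (gen hY' * (\<pi> (gen hT1 * x)))))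
      - ((a+b)*q*(1/(a*b))) \<cdot> \<kappa> \<cdot> \<pi> (gen hY' * (\<pi> (gen hT1 * x))) - (1
      + c*d*(1/q)) \<cdot> \<pi> (gen hZ' * (\<pi> (gen hT1 * x))) - ((1-q)*(1+a*b)*(1
      + c*d*(1/q))) \<cdot> \<pi> (gen hZ' * x) + (c+d) \<cdot> \<pi> (gen hT1 * x) + ((1-q)*(a+b)*(1
      + c*d*(1/q))) \<cdot> \<pi> x"
    by (rule eqI[where k = "1" and x = x, OF _ daha_rels(10)]) (use nz in \<open>simp add: expand\<close>)
  show "\<pi> (gen hY * (\<pi> (gen hZ' * x))) = (1/q) \<cdot> \<pi> (gen hZ' * (\<pi> (gen hY * x)))
      - ((1+a*b)*(1/q)*(1/(a*b))) \<cdot> \<pi> (gen hZ' * (\<kappa> \<cdot> \<pi> (gen hY' * (\<pi> (gen hT1 *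
      x))))) + ((a+b)*(1/q)*(1/(a*b))) \<cdot> \<kappa> \<cdot> \<pi> (gen hY' * (\<pi> (gen hT1 * x))) + ((1
      + c*d*(1/q))*(1/q)) \<cdot> \<pi> (gen hZ' * (\<pi> (gen hT1 * x))) - ((c+d)*(1/q)) \<cdot> \<pi> (gen hT1 * x)"
    by (rule eqI[where k = "1" and x = x, OF _ daha_rels(11)]) (use nz in \<open>simp add: expand\<close>)
  show "\<kappa> \<cdot> \<pi> (gen hY' * (\<pi> (gen hZ * x))) = (1/q) \<cdot> \<pi> (gen hZ * (\<kappa> \<cdot>
      \<pi> (gen hY' * x))) - (q*(1+a*b)*(1/(a*b))) \<cdot> \<pi> (gen hZ' * (\<kappa> \<cdot> \<pi> (gen hY' *
      (\<pi> (gen hT1 * x))))) + ((a+b)*(1/(a*b))) \<cdot> \<kappa> \<cdot> \<pi> (gen hY' * (\<pi> (gen hT1 * x)))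
      + (1 + c*d*(1/q)) \<cdot> \<pi> (gen hZ' * (\<pi> (gen hT1 * x))) + ((1-q)*(1+a*b)*(1
      + c*d*(1/q))) \<cdot> \<pi> (gen hZ' * x) - ((c+d)*(1/q)) \<cdot> \<pi> (gen hT1 * x)
      - ((1-q)*(1+a*b)*(c+d)*(1/q)) \<cdot> \<pi> x"
    by (rule eqI[where k = "\<kappa>" and x = x, OF _ daha_rels(12)]) (use nz in \<open>simp add: expand\<close>)
  show "\<kappa> \<cdot> \<pi> (gen hY' * (\<pi> (gen hZ' * x))) = q \<cdot> \<pi> (gen hZ' * (\<kappa> \<cdot> \<pi>
      (gen hY' * x))) + (q*(1+a*b)*(1/(a*b))) \<cdot> \<pi> (gen hZ' * (\<kappa> \<cdot> \<pi> (gen hY' * (\<pi> (gen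
      hT1 * x))))) - ((a+b)*(1/(a*b))) \<cdot> \<kappa> \<cdot> \<pi> (gen hY' * (\<pi> (gen hT1 * x))) - (q*(1
      + c*d*(1/q))) \<cdot> \<pi> (gen hZ' * (\<pi> (gen hT1 * x))) + (c+d) \<cdot> \<pi> (gen hT1 * x)"
    by (rule eqI[where k = "\<kappa>" and x = x, OF _ daha_rels(13)]) (use nz in \<open>simp add: expand\<close>)
qed (auto simp: proj_expand)

definition "k0 = gen hY + \<kappa> \<cdot> gen hY'"
definition "k1 = gen hZ + gen hZ'"
definition "emb g = (case g of tK0 \<Rightarrow> k0 | tK1 \<Rightarrow> k1 | tT1 \<Rightarrow> gen hT1)"

lemma emb_simps [simp]: "emb tK0 = k0" "emb tK1 = k1" "emb tT1 = gen hT1"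
  by (simp_all add: emb_def)

lemma embed_gen_eq: "embed_gen q a b c d = (\<lambda>g. cls R (emb g))"
  by (auto simp: embed_gen_def emb_def k0_def k1_def \<kappa>_def fun_eq_iff split: awt_gen.split)

lemma K0'_proj: "ops.K0' x = \<pi> (k0 * x)"
  by (simp add: ops.K0'_def k0_def proj_expand)

lemma K1'_proj: "ops.K1' x = \<pi> (k1 * x)"
  by (simp add: ops.K1'_def k1_def proj_expand)

lemma constants_eq:
  "ops.B = cB q a b c d" "ops.C0 = cC0 q" "ops.C1 = cC1 q a b c d" "ops.D0 = cD0 q a b c d"
  "ops.D1 = cD1 q a b c d" "ops.Q0 = cQ0 q a b c d" "ops.E = cE q c d" "ops.F0 = cF0 q c d"
  "ops.F1 = cF1 q a b c d" "ops.G = cG q a b c d"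
  by (simp_all only: ops.constants cB_def cC0_def cC1_def cD0_def cD1_def cQ0_def cE_def cF0_def cF1_def cG_def
        e1_def e2_def e3_def e4_def Let_def power_one_over) (simp_all add: algebra_simps power2_eq_square)

lemma proj_T_K0: "\<pi> (gen hT1 * (k0 * x)) = \<pi> (k0 * (gen hT1 * x))"
  using ops.T_K0[of x] by (simp add: K0'_proj proj_mult_proj)

lemma proj_T_K1: "\<pi> (gen hT1 * (k1 * x)) = \<pi> (k1 * (gen hT1 * x))"
  using ops.T_K1[of x] by (simp add: K1'_proj proj_mult_proj)

text \<open>This makes the canonical homomorphism well defined: the Hecke algebra is a module over
  itself, and applying the operator identities to 1 gives the relations.\<close>

lemma subst_emb_rels:
  assumes "r \<in> AWt_rels q a b c d"
  shows "subst emb r \<in> rel_ideal R"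
proof -
  have TT: "\<pi> (gen hT1 * gen hT1) = - (a*b+1) \<cdot> \<pi> (gen hT1) - (a*b) \<cdot> \<pi> 1"
    using ops.TT[of 1] by (simp add: proj_expand)
  note T0 = proj_T_K0[of 1] and T1 = proj_T_K1[of 1]
  note R4 = ops.rel4_all[OF ab, of 1] and R5 = ops.rel5_all[OF ab, of 1] and R6 = ops.casimir_all[OF ab, of 1]
  note R = R4 R5 R6
  note R' = R[unfolded K0'_proj K1'_proj constants_eq, simplified proj_expand]
  from assms have "\<pi> (subst emb r) = 0"
    unfolding AWt_rels_def Let_def
    apply (elim insertE emptyE; hypsubst)
         apply (simp add: TT proj_expand)
         apply (rule poly_mapping_eqI, simp add: lookup_add lookup_minus algebra_simps)
        apply (use T0 in \<open>simp add: proj_expand\<close>)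
       apply (use T1 in \<open>simp add: proj_expand\<close>)
    subgoal using R'(1) by (simp add: proj_expand power2_eq_square)
    subgoal using R'(2) by (simp add: proj_expand power2_eq_square)
    subgoal
      apply (rule poly_mapping_eqI)
      subgoal for k
        using arg_cong[OF R'(3), of "\<lambda>v. Poly_Mapping.lookup v k"]
        by (simp add: proj_expand power2_eq_square lookup_add lookup_minus algebra_simps add_divide_distrib)
      done
    done
  then show ?thesis by (simp add: proj_eq_0_iff)
qed

lemma AWt_embed_cls: "AWt_embed q a b c d (cls (AWt_rels q a b c d) y) = cls R (subst emb y)"
  unfolding AWt_embed_def embed_gen_eq DAHA_def by (rule induced_map_presented) (rule subst_emb_rels)

section \<open>The antispherical idempotent and compression by it\<close>

definition "idem = (1/(a*b-1)) \<cdot> (gen hT1 + (a*b) \<cdot> 1)"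

lemma proj_cong_mult:
  assumes "\<pi> x = \<pi> y" shows "\<pi> (u * x * v) = \<pi> (u * y * v)"
  using assms rel_ideal_mult_right[OF rel_ideal_mult_left[of "x - y" R u], of v]
  by (simp add: proj_eq_iff algebra_simps)

lemma proj_cong_left:
  assumes "\<pi> x = \<pi> y" shows "\<pi> (u * x) = \<pi> (u * y)"
  using proj_cong_mult[OF assms, of u 1] by simp

lemma proj_cong_right:
  assumes "\<pi> x = \<pi> y" shows "\<pi> (x * v) = \<pi> (y * v)"
  using proj_cong_mult[OF assms, of 1 v] by simp

lemma eig_idem: "ops.eig (-1) (\<pi> idem)"
proof -
  define k where "k = 1/(a*b-1)"
  have "\<pi> (gen hT1 * \<pi> idem) = k \<cdot> (\<pi> (gen hT1 * gen hT1) + (a*b) \<cdot> \<pi> (gen hT1))"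
    by (simp add: idem_def proj_expand flip: k_def)
  also have "\<pi> (gen hT1 * gen hT1) = - (a*b+1) \<cdot> \<pi> (gen hT1) - (a*b) \<cdot> \<pi> 1"
    using ops.TT[of 1] by (simp add: proj_expand)
  also have "k \<cdot> (- (a*b+1) \<cdot> \<pi> (gen hT1) - (a*b) \<cdot> \<pi> 1 + (a*b) \<cdot> \<pi> (gen hT1)) = - \<pi> idem"
    by (rule poly_mapping_eqI)
      (simp add: idem_def proj_expand lookup_add lookup_minus algebra_simps flip: k_def)
  finally show ?thesis by (simp add: ops.eig_def proj_proj)
qed

lemma T_idem: "\<pi> (gen hT1 * idem) = - \<pi> idem"
  using ops.eigD(4)[OF eig_idem] by (simp add: proj_mult_proj)

lemma idem_mult: "\<pi> (idem * x) = (1/(a*b-1)) \<cdot> (\<pi> (gen hT1 * x) + (a*b) \<cdot> \<pi> x)"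
  by (simp add: idem_def proj_expand)

lemma idem_idem: "\<pi> (idem * idem) = \<pi> idem"
proof -
  have *: "k * (- l + a*b*l) = k * (a*b-1) * l" for k l
    by (simp add: algebra_simps)
  have "\<pi> (idem * idem) = ((1/(a*b-1)) * (a*b-1)) \<cdot> \<pi> idem"
    unfolding idem_mult T_idem
    by (rule poly_mapping_eqI) (simp only: lookup_scale lookup_add lookup_uminus *)
  then show ?thesis using ab by simp
qed

lemma idem_k0: "\<pi> (idem * k0) = \<pi> (k0 * idem)" and idem_k1: "\<pi> (idem * k1) = \<pi> (k1 * idem)"
  unfolding idem_mult using proj_T_K0[of 1] proj_T_K1[of 1]
  by (simp_all add: idem_def proj_expand)

lemma idem_T: "\<pi> (idem * gen hT1) = \<pi> (gen hT1 * idem)"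
  by (simp add: idem_def proj_expand)

lemma idem_subst: "\<pi> (idem * subst emb y) = \<pi> (subst emb y * idem)"
proof (induction y rule: free_induct)
  case (gen g p)
  have "\<pi> (idem * emb g) = \<pi> (emb g * idem)"
    by (cases g) (simp_all add: idem_k0 idem_k1 idem_T)
  from proj_cong_right[OF this, of "subst emb p"] proj_cong_left[OF gen, of "emb g"]
  show ?case by (simp add: mult.assoc)
qed (simp_all add: proj_expand)

text \<open>The compression of \<open>x\<close> comes from the extended algebra. This property is
  stable under \<open>k1\<close> on the left and under \<open>k0\<close> and \<open>T1\<close> on
  the right, so it has to be checked by hand only for 1, Y, Z and Z Y.\<close>

definition "corner_image x \<longleftrightarrow> (\<exists>y. \<pi> (idem * x * idem) = \<pi> (subst emb y * idem))"

lemma corner_image_cong: "\<pi> x = \<pi> y \<Longrightarrow> corner_image x \<Longrightarrow> corner_image y"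
  unfolding corner_image_def using proj_cong_mult by metis

lemma corner_image_add: "corner_image x \<Longrightarrow> corner_image y \<Longrightarrow> corner_image (x + y)"
proof -
  assume "corner_image x" "corner_image y"
  then obtain u v where "\<pi> (idem * x * idem) = \<pi> (subst emb u * idem)" "\<pi> (idem * y * idem) = \<pi>
      (subst emb v * idem)"
    by (auto simp: corner_image_def)
  then have "\<pi> (idem * (x + y) * idem) = \<pi> (subst emb (u + v) * idem)"
    by (simp add: proj_expand)
  then show ?thesis unfolding corner_image_def by blast
qed

lemma corner_image_scale: "corner_image x \<Longrightarrow> corner_image (k \<cdot> x)"
  unfolding corner_image_def by (elim exE, rule_tac x="k \<cdot> y" in exI) (simp add: proj_scale)

lemma corner_image_diff: "corner_image x \<Longrightarrow> corner_image y \<Longrightarrow> corner_image (x - y)"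
  using corner_image_add[of x "(-1) \<cdot> y"] corner_image_scale[of y "-1"] by simp

lemma corner_image_k1: assumes "corner_image x" shows "corner_image (k1 * x)"
proof -
  from assms obtain y where y: "\<pi> (idem * x * idem) = \<pi> (subst emb y * idem)" by (auto simp: corner_image_def)
  have "\<pi> (idem * (k1 * x) * idem) = \<pi> (k1 * (idem * x * idem))"
    using proj_cong_right[OF idem_k1, of "x * idem"] by (simp add: mult.assoc)
  also have "\<dots> = \<pi> (subst emb (gen tK1 * y) * idem)"
    using proj_cong_left[OF y, of k1] by (simp add: mult.assoc)
  finally show ?thesis unfolding corner_image_def by blast
qed

lemma corner_image_k0: assumes "corner_image x" shows "corner_image (x * k0)"
proof -
  from assms obtain y where y: "\<pi> (idem * x * idem) = \<pi> (subst emb y * idem)" by (auto simp: corner_image_def)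
  have "\<pi> (idem * (x * k0) * idem) = \<pi> ((idem * x * idem) * k0)"
    using proj_cong_left[OF idem_k0[symmetric], of "idem * x"] by (simp add: mult.assoc)
  also have "\<dots> = \<pi> (subst emb y * (idem * k0))"
    using proj_cong_right[OF y, of k0] by (simp add: mult.assoc)
  also have "\<dots> = \<pi> (subst emb (y * gen tK0) * idem)"
    using proj_cong_left[OF idem_k0, of "subst emb y"] by (simp add: mult.assoc)
  finally show ?thesis unfolding corner_image_def by blast
qed

text \<open>Next to the idempotent, \<open>T1\<close> is the scalar -1.\<close>

lemma corner_image_T: assumes "corner_image x" shows "corner_image (x * gen hT1)"
proof -
  have "\<pi> (idem * (x * gen hT1) * idem) = - \<pi> (idem * x * idem)"
    using proj_cong_left[of "gen hT1 * idem" "- idem" "idem * x"] T_idem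
    by (simp add: mult.assoc proj_uminus)
  with assms show ?thesis
    unfolding corner_image_def by (elim exE, rule_tac x="- y" in exI) (simp add: proj_uminus)
qed

lemma corner_image_base: "corner_image 1" "corner_image (gen hY)" "corner_image (gen hZ)" "corner_image (gen hZ * gen hY)"
proof -
  note e = eig_idem
  let ?k = "1/(a*b-1)"
  show "corner_image 1"
    unfolding corner_image_def by (rule exI[of _ 1]) (simp add: idem_idem)
  \<comment> \<open>The witnesses here and below are the right-hand sides of \<open>minus_Y\<close>,
    \<open>minus_Z\<close> and \<open>minus_ZY\<close>, divided by ab - 1 to normalise the
    idempotent.\<close>
  show "corner_image (gen hY)"
    unfolding corner_image_def mult.assoc idem_mult
    apply (rule exI[of _ "?k \<cdot> ((a*b*(1 + c*d*(1/q))) \<cdot> 1 - gen tK0)"])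
    using ops.minus_Y[OF e] by (simp add: proj_expand K0'_proj)
  show "corner_image (gen hZ)"
    unfolding corner_image_def mult.assoc idem_mult
    apply (rule exI[of _ "?k \<cdot> ((a*b) \<cdot> gen tK1 - (a+b) \<cdot> 1)"])
    using ops.minus_Z[OF e] by (simp add: proj_expand K1'_proj)
  show "corner_image (gen hZ * gen hY)"
    unfolding corner_image_def mult.assoc idem_mult
    apply (rule exI[of _ "?k \<cdot> ((a*b / (q^2-1)) \<cdot> (q \<cdot> (gen tK0 * gen tK1) - gen tK1 * gen tK0
        - ops.\<gamma> (-1) \<cdot> 1) - (a+b) \<cdot> gen tK0)"])
    using ops.minus_ZY[OF e q2] by (simp add: proj_expand K0'_proj K1'_proj)
qed

section \<open>Reduction of the whole Hecke algebra to 1, Y, Z and Z Y\<close>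

definition "wY = \<kappa> \<cdot> gen hY'"

text \<open>The span, modulo the relations, of the words in Y and W followed by at most one
  \<open>T1\<close>.\<close>

inductive Ygen :: "daha_gen free \<Rightarrow> bool" where
  one: "Ygen 1"
| T: "Ygen (gen hT1)"
| Y: "Ygen x \<Longrightarrow> Ygen (gen hY * x)"
| W: "Ygen x \<Longrightarrow> Ygen (wY * x)"
| add: "Ygen x \<Longrightarrow> Ygen y \<Longrightarrow> Ygen (x + y)"
| scale: "Ygen x \<Longrightarrow> Ygen (k \<cdot> x)"
| modId: "\<pi> x = \<pi> y \<Longrightarrow> Ygen x \<Longrightarrow> Ygen y"

text \<open>
  The grading by the number of \<open>Z\<^sup>\<plusminus>\<^sup>1\<close> is needed for closure under \<open>Y\<close>: moving \<open>Y\<close> past \<open>Z\<close> in \<open>Y Z x\<close>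
  produces \<open>Y\<^sup>-\<^sup>1 T\<^sub>1 x\<close>, so the induction hypothesis is applied to \<open>T\<^sub>1
      x\<close> and not only to \<open>x\<close>.
\<close>

inductive ZYgen :: "nat \<Rightarrow> daha_gen free \<Rightarrow> bool" where
  base: "Ygen x \<Longrightarrow> ZYgen 0 x"
| mono: "ZYgen n x \<Longrightarrow> ZYgen (Suc n) x"
| Z: "ZYgen n x \<Longrightarrow> ZYgen (Suc n) (gen hZ * x)"
| Z': "ZYgen n x \<Longrightarrow> ZYgen (Suc n) (gen hZ' * x)"
| add: "ZYgen n x \<Longrightarrow> ZYgen n y \<Longrightarrow> ZYgen n (x + y)"
| scale: "ZYgen n x \<Longrightarrow> ZYgen n (k \<cdot> x)"
| modId: "\<pi> x = \<pi> y \<Longrightarrow> ZYgen n x \<Longrightarrow> ZYgen n y"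

lemma Ygen_diff: "Ygen x \<Longrightarrow> Ygen y \<Longrightarrow> Ygen (x - y)"
  using Ygen.add[of x "(-1) \<cdot> y"] Ygen.scale[of y "-1"] by simp

lemmas Ygen_intros = Ygen.one Ygen.T Ygen.Y Ygen.W Ygen.add Ygen.scale Ygen_diff

lemma ZYgen_diff: "ZYgen n x \<Longrightarrow> ZYgen n y \<Longrightarrow> ZYgen n (x - y)"
  using ZYgen.add[of n x "(-1) \<cdot> y"] ZYgen.scale[of n y "-1"] by simp

text \<open>The exchange rules \<open>TY\<close> and \<open>TW\<close> move \<open>T1\<close> to the
  right, where the quadratic relation absorbs it.\<close>

lemma Ygen_T: "Ygen x \<Longrightarrow> Ygen (gen hT1 * x)"
proof (induction rule: Ygen.induct)
  case one
  show ?case using Ygen.T by simp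
next
  case T
  show ?case
    by (rule Ygen.modId[of "- (a*b+1) \<cdot> gen hT1 - (a*b) \<cdot> 1"])
      (use ops.TT[of 1] in \<open>simp add: proj_expand\<close>, intro Ygen_intros)
next
  case (Y x)
  show ?case
    by (rule Ygen.modId[of "wY * (gen hT1 * x) - (a*b+1) \<cdot> (gen hY * x) + (a*b*(1 + c*d*(1/q))) \<cdot> x"])
      (use ops.TY[of x] in \<open>simp add: proj_expand wY_def\<close>, intro Ygen_intros Y)
next
  case (W x)
  show ?case
    by (rule Ygen.modId[of "gen hY * (gen hT1 * x) + (a*b+1) \<cdot> (gen hY * x) - (a*b*(1 + c*d*(1/q))) \<cdot> x"])
      (use ops.TW[of x] in \<open>simp add: proj_expand wY_def\<close>, intro Ygen_intros W)
next
  case (modId x y)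
  then show ?case using proj_cong_left Ygen.modId by blast
qed (auto simp: distrib_left intro!: Ygen_intros)

lemmas ZYgen_intros = ZYgen.Z ZYgen.Z' ZYgen.add ZYgen.scale ZYgen_diff

lemma ZYgen_closed: "ZYgen n x \<Longrightarrow> ZYgen n (gen hT1 * x) \<and> ZYgen n (gen hY * x) \<and> ZYgen n (wY * x)"
proof (induction n arbitrary: x)
  case 0
  then show ?case
  proof (induction "0::nat" x rule: ZYgen.induct)
    case (base x)
    then show ?case by (blast intro: ZYgen.base Ygen_T Ygen.Y Ygen.W)
  next
    case (modId x y)
    then show ?case using proj_cong_left ZYgen.modId by blast
  qed (auto simp: distrib_left intro!: ZYgen_intros)
next
  case (Suc n)
  from Suc.prems show ?case
  proof (induction "Suc n" x rule: ZYgen.induct)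
    case (mono x)
    then show ?case using Suc.IH by (blast intro: ZYgen.mono)
  next
    case (Z x)
    note x = Z(1) Suc.IH[OF Z(1)] Suc.IH[of "gen hT1 * x"]
    note m = ZYgen.mono[of n]
    have 1: "ZYgen (Suc n) (gen hT1 * (gen hZ * x))"
      by (rule ZYgen.modId[of "gen hZ' * (gen hT1 * x) + (a*b+1) \<cdot> (gen hZ' * x) - (a+b) \<cdot> x"])
        (use ops.TZ[of x] in \<open>simp add: proj_expand\<close>, use x in \<open>intro ZYgen_intros m; blast\<close>)
    have 2: "ZYgen (Suc n) (gen hY * (gen hZ * x))"
      by (rule ZYgen.modId[of "q \<cdot> (gen hZ * (gen hY * x)) + ((1
          + a*b) * q * (1/(a*b))) \<cdot> (gen hZ' * (wY * (gen hT1 * x)))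
         - ((a+b) * q * (1/(a*b))) \<cdot> (wY * (gen hT1 * x)) - (1 + c*d*(1/q)) \<cdot> (gen hZ' * (gen hT1 * x))
         - ((1-q)*(1+a*b)*(1 + c*d*(1/q))) \<cdot> (gen hZ' * x) + (c+d) \<cdot> (gen hT1 * x)
         + ((1-q)*(a+b)*(1 + c*d*(1/q))) \<cdot> x"])
        (use ops.YZ[of x] in \<open>simp add: proj_expand wY_def\<close>, use x in \<open>intro ZYgen_intros m; blast\<close>)
    have 3: "ZYgen (Suc n) (wY * (gen hZ * x))"
      by (rule ZYgen.modId[of "(1/q) \<cdot> (gen hZ * (wY * x)) - (q * (1
          + a*b) * (1/(a*b))) \<cdot> (gen hZ' * (wY * (gen hT1 * x)))
         + ((a+b) * (1/(a*b))) \<cdot> (wY * (gen hT1 * x)) + (1 + c*d*(1/q)) \<cdot> (gen hZ' * (gen hT1 * x))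
         + ((1-q)*(1+a*b)*(1 + c*d*(1/q))) \<cdot> (gen hZ' * x) - ((c+d)*(1/q)) \<cdot> (gen hT1 * x)
         - ((1-q)*(1+a*b)*(c+d)*(1/q)) \<cdot> x"])
        (use ops.WZ[of x] in \<open>simp add: proj_expand wY_def\<close>, use x in \<open>intro ZYgen_intros m; blast\<close>)
    from 1 2 3 show ?case by blast
  next
    case (Z' x)
    note x = Z'(1) Suc.IH[OF Z'(1)] Suc.IH[of "gen hT1 * x"]
    note m = ZYgen.mono[of n]
    have 1: "ZYgen (Suc n) (gen hT1 * (gen hZ' * x))"
      by (rule ZYgen.modId[of "gen hZ * (gen hT1 * x) - (a*b+1) \<cdot> (gen hZ' * x) + (a+b) \<cdot> x"])
        (use ops.TZ'[of x] in \<open>simp add: proj_expand\<close>, use x in \<open>intro ZYgen_intros m; blast\<close>)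
    have 2: "ZYgen (Suc n) (gen hY * (gen hZ' * x))"
      by (rule ZYgen.modId[of "(1/q) \<cdot> (gen hZ' * (gen hY * x)) - ((1
          + a*b) * (1/q) * (1/(a*b))) \<cdot> (gen hZ' * (wY * (gen hT1 * x)))
         + ((a+b) * (1/q) * (1/(a*b))) \<cdot> (wY * (gen hT1 * x)) + ((1 + c*d*(1/q))*(1/q)) \<cdot> (gen hZ' * (gen hT1 * x))
         - ((c+d)*(1/q)) \<cdot> (gen hT1 * x)"])
        (use ops.YZ'[of x] in \<open>simp add: proj_expand wY_def\<close>, use x in \<open>intro ZYgen_intros m; blast\<close>)
    have 3: "ZYgen (Suc n) (wY * (gen hZ' * x))"
      by (rule ZYgen.modId[of "q \<cdot> (gen hZ' * (wY * x)) + (q * (1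
          + a*b) * (1/(a*b))) \<cdot> (gen hZ' * (wY * (gen hT1 * x)))
         - ((a+b) * (1/(a*b))) \<cdot> (wY * (gen hT1 * x)) - (q*(1 + c*d*(1/q))) \<cdot> (gen hZ' * (gen hT1 * x))
         + (c+d) \<cdot> (gen hT1 * x)"])
        (use ops.WZ'[of x] in \<open>simp add: proj_expand wY_def\<close>, use x in \<open>intro ZYgen_intros m; blast\<close>)
    from 1 2 3 show ?case by blast
  next
    case (modId x y)
    then show ?case using proj_cong_left ZYgen.modId by blast
  qed (auto simp: distrib_left intro!: ZYgen_intros)
qed

lemma ZYgen_mono: "ZYgen n x \<Longrightarrow> n \<le> n' \<Longrightarrow> ZYgen n' x"
  by (induction n' rule: nat_induct) (auto simp: le_Suc_eq intro: ZYgen.mono)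

lemma ZYgen_all: "\<exists>n. ZYgen n x"
proof (induction x rule: free_induct)
  case one
  show ?case using ZYgen.base[OF Ygen.one] by blast
next
  case (gen g p)
  then obtain n where n: "ZYgen n p" by blast
  have "ZYgen n ((1/\<kappa>) \<cdot> (wY * p))"
    using n by (intro ZYgen.scale) (simp add: ZYgen_closed)
  then have "ZYgen n (gen hY' * p)"
    using nz by (simp add: wY_def \<kappa>_def)
  with n show ?case
    by (cases g) (use ZYgen_closed ZYgen.Z ZYgen.Z' in blast)+
next
  case (add p r)
  then obtain n n' where "ZYgen n p" "ZYgen n' r" by blast
  then have "ZYgen (max n n') (p + r)"
    by (intro ZYgen.add) (auto elim: ZYgen_mono)
  then show ?case by blast
qed (blast intro: ZYgen.scale)

lemma proj_YW: "\<pi> (gen hY * (wY * x)) = \<kappa> \<cdot> \<pi> x"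
  using ops.YW[of x] by (simp add: wY_def proj_expand \<kappa>_def)

lemma proj_WY: "\<pi> (wY * (gen hY * x)) = \<kappa> \<cdot> \<pi> x"
  using ops.WY[of x] by (simp add: wY_def proj_expand \<kappa>_def)

lemma k0_eq: "k0 = gen hY + wY"
  by (simp add: k0_def wY_def)

lemma proj_Y_k0: "\<pi> (gen hY * (k0 * x)) = \<pi> (k0 * (gen hY * x))"
  and proj_W_k0: "\<pi> (wY * (k0 * x)) = \<pi> (k0 * (wY * x))"
  by (simp_all add: k0_eq proj_expand proj_YW proj_WY)

text \<open>\<open>k0\<close> = Y + W commutes with Y and W because Y W = W Y =
  \<open>\<kappa>\<close>, and with \<open>T1\<close> by \<open>T_K0\<close>. It can therefore be
  carried to the right end, where compression commutes with it.\<close>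

lemma Ygen_k0: "Ygen u \<Longrightarrow> \<pi> (k0 * u) = \<pi> (u * k0)"
proof (induction rule: Ygen.induct)
  case T
  show ?case using proj_T_K0[of 1] by simp
next
  case (Y x)
  show ?case
    using proj_cong_left[OF Y.IH, of "gen hY"] proj_Y_k0[of x] by (simp add: mult.assoc)
next
  case (W x)
  show ?case
    using proj_cong_left[OF W.IH, of wY] proj_W_k0[of x] by (simp add: mult.assoc)
next
  case (modId x y)
  then show ?case
    using proj_cong_left[of x y k0] proj_cong_right[of x y k0] by simp
qed (simp_all add: distrib_left distrib_right proj_add proj_scale)

text \<open>Over \<open>k0\<close> one has Y^2 = Y \<open>k0\<close> - \<open>\<kappa>\<close> and W
  = \<open>k0\<close> - Y, so a further letter never raises the degree in Y above one. The versions
  with Y and Z in front make the induction close.\<close>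

lemma Ygen_corner_image: "Ygen u \<Longrightarrow> corner_image u \<and> corner_image (gen hY * u) \<and>
    corner_image (gen hZ * u) \<and> corner_image (gen hZ * (gen hY * u))"
proof (induction rule: Ygen.induct)
  case one
  show ?case using corner_image_base by simp
next
  case T
  show ?case using corner_image_base[THEN corner_image_T] by (simp add: mult.assoc)
next
  case (Y u)
  note k0 = Ygen_k0[OF Y.hyps]
  have *: "\<pi> (gen hY * (gen hY * u)) = \<pi> ((gen hY * u) * k0 - \<kappa> \<cdot> u)"
  proof -
    have "\<pi> ((gen hY * u) * k0) = \<pi> (gen hY * (k0 * u))"
      using proj_cong_left[OF k0, of "gen hY"] by (simp add: mult.assoc)
    then show ?thesis by (simp add: proj_diff k0_eq distrib_left distrib_right proj_add proj_scale proj_YW)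
  qed
  have 1: "corner_image (gen hY * (gen hY * u))"
    by (rule corner_image_cong[OF *[symmetric]]) (intro corner_image_diff corner_image_k0 corner_image_scale; use Y in blast)
  have "corner_image ((gen hZ * (gen hY * u)) * k0 - \<kappa> \<cdot> (gen hZ * u))"
    by (intro corner_image_diff corner_image_k0 corner_image_scale; use Y in blast)
  then have 2: "corner_image (gen hZ * (gen hY * (gen hY * u)))"
    by (rule corner_image_cong[rotated]) (use proj_cong_left[OF *, of "gen hZ"] in \<open>simp add:
        right_diff_distrib mult.assoc\<close>)
  from 1 2 Y show ?case by blast
next
  case (W u)
  note k0 = Ygen_k0[OF W.hyps]
  have *: "\<pi> (wY * u) = \<pi> (u * k0 - gen hY * u)"
    using k0 by (simp add: proj_diff k0_eq distrib_right proj_add) (metis add_diff_cancel_left')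
  have 1: "corner_image (wY * u)"
    by (rule corner_image_cong[OF *[symmetric]]) (intro corner_image_diff corner_image_k0; use W in blast)
  have "corner_image ((gen hZ * u) * k0 - gen hZ * (gen hY * u))"
    by (intro corner_image_diff corner_image_k0; use W in blast)
  then have 2: "corner_image (gen hZ * (wY * u))"
    by (rule corner_image_cong[rotated]) (use proj_cong_left[OF *, of "gen hZ"] in \<open>simp add:
        right_diff_distrib mult.assoc\<close>)
  have YW: "\<pi> (\<kappa> \<cdot> u) = \<pi> (gen hY * (wY * u))"
    by (simp add: proj_YW proj_scale)
  have 3: "corner_image (gen hY * (wY * u))"
    by (rule corner_image_cong[OF YW]) (use W corner_image_scale in blast)
  have "corner_image (\<kappa> \<cdot> (gen hZ * u))" using W corner_image_scale by blast
  then have 4: "corner_image (gen hZ * (gen hY * (wY * u)))"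
    by (rule corner_image_cong[rotated]) (use proj_cong_left[OF YW, of "gen hZ"] in simp)
  from 1 2 3 4 show ?case by blast
next
  case (modId x y)
  then show ?case using proj_cong_left corner_image_cong by meson
qed (auto simp: distrib_left intro: corner_image_add corner_image_scale)

lemma proj_ZZ': "\<pi> (gen hZ * (gen hZ' * x)) = \<pi> x" "\<pi> (gen hZ' * (gen hZ * x)) = \<pi> x"
  using ops.ZZ'[of x] ops.Z'Z[of x] by (simp_all add: proj_expand)

text \<open>Likewise Z^2 = \<open>k1\<close> Z - 1 and Z^-1 = \<open>k1\<close> - Z, now with
  \<open>k1\<close> on the left.\<close>

lemma ZYgen_corner_image: "ZYgen n x \<Longrightarrow> corner_image x \<and> corner_image (gen hZ * x)"
proof (induction rule: ZYgen.induct)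
  case (base x)
  then show ?case using Ygen_corner_image by blast
next
  case (Z n x)
  then have "corner_image (k1 * (gen hZ * x) - x)" by (blast intro: corner_image_k1 corner_image_diff)
  then have "corner_image (gen hZ * (gen hZ * x))"
    by (rule corner_image_cong[rotated]) (simp add: k1_def proj_expand proj_ZZ')
  with Z show ?case by blast
next
  case (Z' n x)
  then have "corner_image (k1 * x - gen hZ * x)" by (blast intro: corner_image_k1 corner_image_diff)
  moreover have "corner_image (gen hZ * (gen hZ' * x))"
    by (rule corner_image_cong[of x]) (use Z' in \<open>simp_all add: proj_ZZ'\<close>)
  ultimately show ?case by (simp add: k1_def distrib_right)
next
  case (modId x y)
  then show ?case using proj_cong_left corner_image_cong by meson
qed (auto simp: distrib_left intro: corner_image_add corner_image_scale)

lemma corner_image_all: "corner_image x"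
  using ZYgen_all ZYgen_corner_image by blast

section \<open>The Askey-Wilson algebra with shifted parameters and its map to the corner\<close>

abbreviation "R1 \<equiv> AW_rels q (q*a) (q*b) c d"
definition "shift g = (case g of K0 \<Rightarrow> q \<cdot> gen tK0 | K1 \<Rightarrow> gen tK1)"
text \<open>The lift of the isomorphism to free algebras, before multiplication by the
  idempotent.\<close>

definition "\<psi> U = subst emb (subst shift U)"

lemma shift_simps [simp]: "shift K0 = q \<cdot> gen tK0" "shift K1 = gen tK1"
  by (simp_all add: shift_def)

lemma \<psi>_simps [simp]:
  "\<psi> (x + y) = \<psi> x + \<psi> y" "\<psi> (x - y) = \<psi> x
      - \<psi> y" "\<psi> (k \<cdot> x) = k \<cdot> \<psi> x" "\<psi> (x * y) = \<psi> x * \<psi> y"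
  "\<psi> 0 = 0" "\<psi> 1 = 1" "\<psi> (gen K0) = q \<cdot> k0" "\<psi> (gen K1) = k1" "\<psi> (x ^ n) = \<psi> x ^ n"
  by (simp_all add: \<psi>_def)

text \<open>At the eigenvalue -1 the extra terms contribute the factor ab - 1. The powers of q are
  those produced by rescaling K0 to q K0: the first cubic relation scales by q, the other two
  relations by q^2.\<close>

lemma shifted_constants:
  "cB q (q*a) (q*b) c d = q * ops.B' (-1)" "cC1 q (q*a) (q*b) c d = q^2 * ops.C1"
  "cD0 q (q*a) (q*b) c d = q * ops.D0' (-1)" "cD1 q (q*a) (q*b) c d = q^2 * ops.D1' (-1)"
  "cQ0 q (q*a) (q*b) c d = q^2 * (ops.Q0 - (a*b-1) * ops.G)" "cC0 q = ops.C0"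
proof -
  define u where "u = 1/q"
  have u: "q * u = 1" "q * (u * k) = k" for k using nz(1) by (simp_all add: u_def)
  note defs = cB_def cC0_def cC1_def cD0_def cD1_def cQ0_def e1_def e2_def e3_def e4_def Let_def
      ops.constants ops.B'_def ops.D0'_def ops.D1'_def
  note laurent = u power2_eq_square power3_eq_cube power4_eq_xxxx algebra_simps
  show "cB q (q*a) (q*b) c d = q * ops.B' (-1)" "cC1 q (q*a) (q*b) c d = q^2 * ops.C1"
    "cD0 q (q*a) (q*b) c d = q * ops.D0' (-1)" "cD1 q (q*a) (q*b) c d = q^2 * ops.D1' (-1)"
    "cQ0 q (q*a) (q*b) c d = q^2 * (ops.Q0 - (a*b-1) * ops.G)" "cC0 q = ops.C0"
    unfolding defs unfolding power_one_over[symmetric] unfolding u_def[symmetric]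
    by (simp_all add: laurent)
qed

text \<open>The idempotent is an eigenvector of \<open>T1\<close> for -1, so the relations on
  eigenspaces apply to it; the factor \<open>k\<close> is q to the degree of the relation in
  K0.\<close>

lemma idem_rel:
  assumes "r \<in> R1" shows "\<pi> (\<psi> r * idem) = 0"
proof -
  note e = eig_idem
  note R4 = ops.rel4_eig[OF e] and R5 = ops.rel5_eig[OF e] and R6 = ops.casimir_eig[OF e]
  note R = R4[unfolded K0'_proj K1'_proj, simplified proj_mult_proj]
    R5[unfolded K0'_proj K1'_proj, simplified proj_mult_proj]
    R6[unfolded K0'_proj K1'_proj, simplified proj_mult_proj]
  have zeroI: "u = 0" if "x = y" "\<And>w. Poly_Mapping.lookup u w = k * (Poly_Mapping.lookup x w - Poly_Mapping.lookup y w)"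
    for u x y :: "daha_gen free" and k
    using that by (intro poly_mapping_eqI) simp
  have simps: "(1/q)^2 = 1/q^2" by (rule power_one_over)
  note expand = proj_expand power2_eq_square lookup_add lookup_minus
  from assms consider (1) "r = (q + 1/q) \<cdot> (gen K1*gen K0*gen K1) - gen K1^2*gen K0 - gen K0*gen K1^2
        - ((q * ops.B' (-1)) \<cdot> gen K1 + ops.C0 \<cdot> gen K0 + (q * ops.D0' (-1)) \<cdot> 1)"
    | (2) "r = (q + 1/q) \<cdot> (gen K0*gen K1*gen K0) - gen K0^2*gen K1 - gen K1*gen K0^2
        - ((q * ops.B' (-1)) \<cdot> gen K0 + (q^2 * ops.C1) \<cdot> gen K1 + (q^2 * ops.D1' (-1)) \<cdot> 1)"
    | (3) "r = gen K1*gen K0*gen K1*gen K0 - (q^2 + 1 + 1/q^2) \<cdot> (gen K0*gen K1*gen K0*gen K1) + (q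
        + 1/q) \<cdot> (gen K0^2*gen K1^2)
         + (q + 1/q) \<cdot> (ops.C0 \<cdot> gen K0^2 + (q^2 * ops.C1) \<cdot> gen K1^2)
         + (q * ops.B' (-1)) \<cdot> ((q + 1 + 1/q) \<cdot> (gen K0*gen K1) + gen K1*gen K0)
         + (q + 1 + 1/q) \<cdot> ((q * ops.D0' (-1)) \<cdot> gen K0 + (q^2 * ops.D1' (-1)) \<cdot> gen K1)
         - (q^2 * (ops.Q0 - (a*b-1) * ops.G)) \<cdot> 1"
    unfolding AW_rels_def Let_def shifted_constants by blast
  then show ?thesis
  proof cases
    case 1
    show ?thesis unfolding 1
      by (rule zeroI[OF R(1), where k = q]) (use nz(1) in \<open>simp add: expand field_simps\<close>)
  next
    case 2
    show ?thesis unfolding 2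
      by (rule zeroI[OF R(2), where k = "q^2"]) (use nz(1) in \<open>simp add: expand field_simps\<close>)
  next
    case 3
    show ?thesis unfolding 3
      by (rule zeroI[OF R(3), where k = "q^2"]) (use nz(1) in \<open>simp add: expand field_simps\<close>)
  qed
qed

lemma idem_\<psi>: "\<pi> (idem * \<psi> U) = \<pi> (\<psi> U * idem)"
  unfolding \<psi>_def by (rule idem_subst)

lemma \<psi>_idem_mult: "\<pi> ((\<psi> U * idem) * (\<psi> V * idem)) = \<pi> (\<psi> (U * V) * idem)"
proof -
  have "\<pi> (\<psi> U * (idem * \<psi> V) * idem) = \<pi> (\<psi> U * (\<psi> V * idem) * idem)"
    by (rule proj_cong_mult[OF idem_\<psi>])
  also have "\<dots> = \<pi> (\<psi> U * \<psi> V * idem)"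
    using proj_cong_left[OF idem_idem, of "\<psi> U * \<psi> V"] by (simp add: mult.assoc)
  finally show ?thesis by (simp add: mult.assoc)
qed

lemma idem_Id:
  assumes "U \<in> rel_ideal R1" shows "\<pi> (\<psi> U * idem) = 0"
  using assms
proof (rule rel_ideal_least)
  show "\<pi> (\<psi> r * idem) = 0" if "r \<in> R1" for r by (rule idem_rel[OF that])
next
  fix x y assume x: "\<pi> (\<psi> x * idem) = 0"
  then have x': "\<pi> (\<psi> x * idem) = \<pi> 0" by (simp only: proj_eq_0_iff[THEN iffD2, OF rel_ideal_zero])
  show "\<pi> (\<psi> (y * x) * idem) = 0"
    using proj_cong_left[OF x', of "\<psi> y"] x by (simp add: mult.assoc proj_eq_0_iff rel_ideal_zero)
  \<comment> \<open>For right multiplication the idempotent is first copied between the factors,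
    where it meets \<open>\<psi> x\<close>.\<close>
  show "\<pi> (\<psi> (x * y) * idem) = 0"
    unfolding \<psi>_idem_mult[of x y, symmetric] proj_cong_right[OF x']
    by (simp only: mult_zero_left proj_eq_0_iff[THEN iffD2, OF rel_ideal_zero])
qed (simp_all add: distrib_right proj_add proj_eq_0_iff[THEN iffD2, OF rel_ideal_zero])

definition "\<Phi> X = the_elem ((\<lambda>U. cls R (\<psi> U * idem)) ` X)"

lemma cls_eq_proj: "cls R x = cls R y \<longleftrightarrow> \<pi> x = \<pi> y"
  by (simp add: cls_eq_iff proj_eq_iff)

lemma \<Phi>_cls: "\<Phi> (cls R1 U) = cls R (\<psi> U * idem)"
  unfolding \<Phi>_def
proof (rule the_elem_image_cls)
  fix x y assume "x - y \<in> rel_ideal R1"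
  from idem_Id[OF this] show "cls R (\<psi> x * idem) = cls R (\<psi> y * idem)"
    by (simp add: cls_eq_proj left_diff_distrib proj_diff)
qed

lemma idem_eq: "cls R ((1/(a*b-1)) \<cdot> (gen hT1 + (a*b) \<cdot> 1)) = cls R idem"
  by (simp add: idem_def)

lemma S_minus_cls: "S_minus q a b c d (cls R x) = cls R (idem * x * idem)"
  by (simp add: S_minus_def P_sym_minus_def idem_eq DAHA_def)

lemma S_minus_emb: "S_minus q a b c d (cls R (subst emb y)) = cls R (subst emb y * idem)"
proof -
  have "\<pi> (idem * subst emb y * idem) = \<pi> (subst emb y * idem)"
    using proj_cong_right[OF idem_subst[of y], of idem] proj_cong_left[OF idem_idem, of "subst emb y"]
    by (simp add: mult.assoc)
  then show ?thesis by (simp add: S_minus_cls cls_eq_proj)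
qed

lemma carrier_antispherical:
  "S_minus q a b c d ` carrier (DAHA q a b c d) = range (\<lambda>y. cls R (subst emb y * idem))"
proof
  show "S_minus q a b c d ` carrier (DAHA q a b c d) \<subseteq> range (\<lambda>y. cls R (subst emb y * idem))"
  proof (clarsimp simp: DAHA_def)
    fix x
    from corner_image_all[of x] obtain y where "\<pi> (idem * x * idem) = \<pi> (subst emb y * idem)"
      by (auto simp: corner_image_def)
    then show "S_minus q a b c d (cls R x) \<in> range (\<lambda>y. cls R (subst emb y * idem))"
      by (auto simp: S_minus_cls cls_eq_proj)
  qed
qed (auto simp: DAHA_def simp flip: S_minus_emb)

lemma S_minus_image_eq:
  "S_minus q a b c d ` carrier (DAHA q a b c d)
    = S_minus q a b c d ` (AWt_embed q a b c d ` carrier (AWt q a b c d))"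
  unfolding carrier_antispherical AWt_def
  by (simp add: image_image AWt_embed_cls S_minus_emb)

text \<open>An inverse of \<open>shift\<close> on the corner, where \<open>T1\<close> is -1; it
  yields surjectivity.\<close>

definition "unshift g = (case g of tK0 \<Rightarrow> (1/q) \<cdot> gen K0 | tK1 \<Rightarrow> gen K1 | tT1 \<Rightarrow> - 1)"

lemma unshift: "\<pi> (subst emb y * idem) = \<pi> (\<psi> (subst unshift y) * idem)"
proof (induction y rule: free_induct)
  case (gen g p)
  have g: "\<pi> (emb g * idem) = \<pi> (\<psi> (unshift g) * idem)"
    using nz(1) by (cases g) (simp_all add: unshift_def \<psi>_def T_idem proj_uminus)
  have "\<pi> (emb g * (subst emb p * idem)) = \<pi> (emb g * (\<psi> (subst unshift p) * idem))"
    by (rule proj_cong_left[OF gen])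
  also have "\<dots> = \<pi> (emb g * (idem * \<psi> (subst unshift p)))"
    by (rule proj_cong_left[OF idem_\<psi>[symmetric]])
  also have "\<dots> = \<pi> ((\<psi> (unshift g) * idem) * \<psi> (subst unshift p))"
    using proj_cong_right[OF g] by (simp add: mult.assoc)
  also have "\<dots> = \<pi> (\<psi> (unshift g) * (\<psi> (subst unshift p) * idem))"
    using proj_cong_left[OF idem_\<psi>] by (simp add: mult.assoc)
  finally show ?case by (simp add: mult.assoc)
qed (simp_all add: proj_expand)

text \<open>Injectivity enters as a hypothesis because it rests on the basic representation;
  \<open>\<Phi>_inj\<close> supplies it.\<close>

lemma \<Phi>_alg_iso:
  assumes inj: "\<And>U. \<pi> (\<psi> U * idem) = 0 \<Longrightarrow> U \<in> rel_ideal R1"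
  shows "\<Phi> \<in> alg_iso (AW q (q*a) (q*b) c d) (antispherical q a b c d)"
proof -
  have carrier: "carrier (antispherical q a b c d) = range (\<lambda>U. cls R (\<psi> U * idem))"
  proof -
    have "range (\<lambda>y. cls R (subst emb y * idem)) = range (\<lambda>U. cls R (\<psi> U * idem))"
    proof
      show "range (\<lambda>y. cls R (subst emb y * idem)) \<subseteq> range (\<lambda>U. cls R (\<psi> U * idem))"
        by (auto simp: cls_eq_proj unshift)
    qed (auto simp: \<psi>_def)
    then show ?thesis by (simp add: antispherical_def carrier_antispherical)
  qed
  have "\<Phi> \<in> ring_hom (AW q (q*a) (q*b) c d) (antispherical q a b c d)"
  proof (rule ring_hom_memI)
    fix x y assume "x \<in> carrier (AW q (q*a) (q*b) c d)" "y \<in> carrier (AW q (q*a) (q*b) c d)"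
    then obtain U V where x: "x = cls R1 U" and y: "y = cls R1 V" by (auto simp: AW_def)
    show "\<Phi> x \<in> carrier (antispherical q a b c d)"
      unfolding carrier x \<Phi>_cls by blast
    show "\<Phi> (x \<otimes>\<^bsub>AW q (q*a) (q*b) c d\<^esub> y) = \<Phi> x \<otimes>\<^bsub>antispherical q a b
        c d\<^esub> \<Phi> y"
      using \<psi>_idem_mult[of U V]
      by (simp add: x y AW_def \<Phi>_cls antispherical_def DAHA_def cls_eq_proj del: \<psi>_simps(4))
    show "\<Phi> (x \<oplus>\<^bsub>AW q (q*a) (q*b) c d\<^esub> y) = \<Phi> x \<oplus>\<^bsub>antispherical q a b c
        d\<^esub> \<Phi> y"
      by (simp add: x y AW_def \<Phi>_cls antispherical_def DAHA_def distrib_right)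
  qed (simp add: AW_def presented_one \<Phi>_cls antispherical_def P_sym_minus_def idem_eq)
  moreover have "inj_on \<Phi> (carrier (AW q (q*a) (q*b) c d))"
    by (auto simp: inj_on_def AW_def \<Phi>_cls cls_eq_proj cls_eq_iff[of R1] left_diff_distrib proj_diff intro!: inj)
  moreover have "\<Phi> ` carrier (AW q (q*a) (q*b) c d) = carrier (antispherical q a b c d)"
    by (simp add: AW_def carrier image_image \<Phi>_cls)
  moreover have "\<Phi> (k \<odot>\<^bsub>AW q (q*a) (q*b) c d\<^esub> x) = k \<odot>\<^bsub>antispherical q a b c
      d\<^esub> \<Phi> x"
    if "x \<in> carrier (AW q (q*a) (q*b) c d)" for k x
    using that by (auto simp: AW_def \<Phi>_cls antispherical_def DAHA_def)
  ultimately show ?thesis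
    by (simp add: alg_iso_def ring_iso_def bij_betw_def)
qed

lemma tilde_eq: "tilde q a b c d U = cls (AWt_rels q a b c d) (subst shift U)"
proof -
  have "(\<lambda>g. cls (AWt_rels q a b c d) (case g of K0 \<Rightarrow> q \<cdot> gen tK0 | K1 \<Rightarrow> gen tK1))
    = (\<lambda>g. cls (AWt_rels q a b c d) (shift g))"
    by (simp add: shift_def)
  then show ?thesis by (simp add: tilde_def AWt_def eval_free_presented)
qed

lemma \<Phi>_formula:
  "\<Phi> (cls R1 U) = AWt_embed q a b c d ((1 / (a * b - 1)) \<odot>\<^bsub>AWt q a b c d\<^esub>
     (tilde q a b c d U \<otimes>\<^bsub>AWt q a b c d\<^esub> cls (AWt_rels q a b c d) (gen tT1 + (a * b) \<cdot> 1)))"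
  unfolding tilde_eq AWt_def presented_mult presented_smult AWt_embed_cls \<Phi>_cls
  by (simp add: idem_def \<psi>_def del: free.scale_right_distrib)

end

section \<open>A spanning set of the Askey-Wilson algebra\<close>

definition pol :: "complex poly \<Rightarrow> aw_gen free" where
  "pol p = fold_coeffs (\<lambda>c x. c \<cdot> 1 + gen K1 * x) p 0"

lemma pol_0 [simp]: "pol 0 = 0"
  by (simp add: pol_def)

lemma pol_pCons [simp]: "pol (pCons c p) = c \<cdot> 1 + gen K1 * pol p"
  by (cases "c = 0 \<and> p = 0") (auto simp: pol_def)

lemma pol_add: "pol (p + r) = pol p + pol r"
  by (induction p r rule: poly_induct2) (simp_all add: algebra_simps)

lemma pol_smult: "pol (smult k p) = k \<cdot> pol p"
  by (induction p) (simp_all add: algebra_simps)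

text \<open>The pair at position n, counted from 0, contributes
  \<open>K0\<^sup>n (K0 \<alpha>(K1) + K1 K0 \<beta>(K1))\<close>. Together with a polynomial in K1
  these are the normal forms.\<close>

fun horner :: "(complex poly \<times> complex poly) list \<Rightarrow> aw_gen free" where
  "horner [] = 0"
| "horner ((\<alpha>, \<beta>) # l) = gen K0 * pol \<alpha> + gen K1 * (gen K0 * pol \<beta>) + gen K0 * horner l"

lemma horner_add: "\<exists>m. horner l + horner l' = horner m"
proof (induction l arbitrary: l')
  case (Cons x l)
  obtain \<alpha> \<beta> where x: "x = (\<alpha>, \<beta>)" by fastforce
  show ?case
  proof (cases l')
    case (Cons y r)
    obtain \<gamma> \<delta> where y: "y = (\<gamma>, \<delta>)" by fastforce
    from Cons.IH obtain m where "horner l + horner r = horner m" by blast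
    from this[symmetric] have "horner (x # l) + horner (y # r) = horner ((\<alpha> + \<gamma>, \<beta> + \<delta>) # m)"
      by (simp add: x y pol_add algebra_simps)
    then show ?thesis using Cons by blast
  qed (auto intro: exI[of _ "x # l"])
qed auto

lemma horner_scale: "\<exists>m. k \<cdot> horner l = horner m"
proof (induction l)
  case (Cons x l)
  then obtain m where "k \<cdot> horner l = horner m" by blast
  then have "k \<cdot> horner (x # l) = horner ((smult k (fst x), smult k (snd x)) # m)"
    by (cases x) (simp add: pol_smult free.scale_right_distrib flip: scale_mult_right)
  then show ?case by blast
qed (auto intro: exI[of _ "[]"])

locale aw_params =
  fixes q a b c d :: complex
begin

abbreviation "S \<equiv> AW_rels q a b c d"

definition "spanned x \<longleftrightarrow> (\<exists>\<gamma> l. x - (pol \<gamma> + horner l) \<in> rel_ideal S)"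

lemma spanned_add: assumes "spanned x" "spanned y" shows "spanned (x + y)"
proof -
  from assms obtain \<gamma> l \<gamma>' l' where x: "x - (pol \<gamma> + horner l) \<in> rel_ideal S" and y: "y
      - (pol \<gamma>' + horner l') \<in> rel_ideal S"
    by (auto simp: spanned_def)
  obtain m where m: "horner l + horner l' = horner m" using horner_add by blast
  have "x + y - (pol (\<gamma> + \<gamma>') + horner m) \<in> rel_ideal S"
    using rel_ideal_add[OF x y] by (simp add: pol_add flip: m) (simp add: algebra_simps)
  then show ?thesis unfolding spanned_def by blast
qed

lemma spanned_scale: assumes "spanned x" shows "spanned (k \<cdot> x)"
proof -
  from assms obtain \<gamma> l where x: "x - (pol \<gamma> + horner l) \<in> rel_ideal S" by (auto simp: spanned_def)
  obtain m where m: "k \<cdot> horner l = horner m" using horner_scale by blast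
  have "k \<cdot> x - (pol (smult k \<gamma>) + horner m) \<in> rel_ideal S"
    using rel_ideal_scale[OF x, of k] by (simp add: pol_smult free.scale_right_diff_distrib free.scale_right_distrib flip: m)
  then show ?thesis unfolding spanned_def by blast
qed

lemma spanned_diff: "spanned x \<Longrightarrow> spanned y \<Longrightarrow> spanned (x - y)"
  using spanned_add[of x "(-1) \<cdot> y"] spanned_scale[of y "-1"] by simp

lemma spanned_cong: "x - y \<in> rel_ideal S \<Longrightarrow> spanned y \<Longrightarrow> spanned x"
proof -
  assume xy: "x - y \<in> rel_ideal S" and "spanned y"
  then obtain \<gamma> l where "y - (pol \<gamma> + horner l) \<in> rel_ideal S" by (auto simp: spanned_def)
  from rel_ideal_add[OF xy this] have "x - (pol \<gamma> + horner l) \<in> rel_ideal S" by (simp add: algebra_simps)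
  then show ?thesis unfolding spanned_def by blast
qed

lemma spanned_pol: "spanned (pol p)"
  unfolding spanned_def by (rule exI[of _ p], rule exI[of _ "[]"]) (simp add: rel_ideal_zero)

lemma spanned_K10_pol: "spanned (gen K1 * (gen K0 * pol p))"
  unfolding spanned_def by (rule exI[of _ 0], rule exI[of _ "[(0, p)]"]) (simp add: rel_ideal_zero)

lemma spanned_K0: assumes "spanned x" shows "spanned (gen K0 * x)"
proof -
  from assms obtain \<gamma> l where x: "x - (pol \<gamma> + horner l) \<in> rel_ideal S" by (auto simp: spanned_def)
  have "gen K0 * x - (pol 0 + horner ((\<gamma>, 0) # l)) \<in> rel_ideal S"
    using rel_ideal_mult_left[OF x, of "gen K0"] by (simp add: algebra_simps)
  then show ?thesis unfolding spanned_def by blast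
qed

lemmas spanned_intros = spanned_add spanned_scale spanned_diff spanned_K0

definition "B' = cB q a b c d"
definition "C0' = cC0 q"
definition "C1' = cC1 q a b c d"
definition "D0' = cD0 q a b c d"
definition "D1' = cD1 q a b c d"
definition "Q0' = cQ0 q a b c d"

text \<open>The relations as reductions of the words K1 K1 K0, K1 K0 K0 and K1 K0 K1 K0. The words
  containing none of these are exactly \<open>K0\<^sup>n K1\<^sup>m\<close> and
  \<open>K0\<^sup>n K1 K0 K1\<^sup>m\<close>.\<close>

lemma AW1: "gen K1 * (gen K1 * (gen K0 * x)) - ((q + 1/q) \<cdot> (gen K1 * (gen K0 * (gen K1 * x)))
    - gen K0 * (gen K1 * (gen K1 * x))
       - (B' \<cdot> (gen K1 * x) + C0' \<cdot> (gen K0 * x) + D0' \<cdot> x)) \<in> rel_ideal S" (is "?a \<in> _")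
  and AW2: "gen K1 * (gen K0 * (gen K0 * x)) - ((q + 1/q) \<cdot> (gen K0 * (gen K1 * (gen K0 * x)))
      - gen K0 * (gen K0 * (gen K1 * x))
       - (B' \<cdot> (gen K0 * x) + C1' \<cdot> (gen K1 * x) + D1' \<cdot> x)) \<in> rel_ideal S" (is "?b \<in> _")
  and AW3: "gen K1 * (gen K0 * (gen K1 * (gen K0 * x))) - ((q^2 + 1 + 1/q^2) \<cdot> (gen K0 * (gen K1 * (gen K0 * (gen K1 * x))))
       - (q + 1/q) \<cdot> (gen K0 * (gen K0 * (gen K1 * (gen K1 * x))))
       - (q + 1/q) \<cdot> (C0' \<cdot> (gen K0 * (gen K0 * x)) + C1' \<cdot> (gen K1 * (gen K1 * x)))
       - B' \<cdot> ((q + 1 + 1/q) \<cdot> (gen K0 * (gen K1 * x)) + gen K1 * (gen K0 * x))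
       - (q + 1 + 1/q) \<cdot> (D0' \<cdot> (gen K0 * x) + D1' \<cdot> (gen K1 * x))
           + Q0' \<cdot> x) \<in> rel_ideal S" (is "?c \<in> _")
proof -
  note cdefs = B'_def C0'_def C1'_def D0'_def D1'_def Q0'_def
  note expand = power2_eq_square mult.assoc left_diff_distrib distrib_right cdefs
  let ?r1 = "(q + 1/q) \<cdot> (gen K1*gen K0*gen K1) - gen K1^2*gen K0 - gen K0*gen K1^2 - (B' \<cdot> gen K1
      + C0' \<cdot> gen K0 + D0' \<cdot> 1)"
  let ?r2 = "(q + 1/q) \<cdot> (gen K0*gen K1*gen K0) - gen K0^2*gen K1 - gen K1*gen K0^2 - (B' \<cdot> gen K0
      + C1' \<cdot> gen K1 + D1' \<cdot> 1)"
  let ?r3 = "gen K1*gen K0*gen K1*gen K0 - (q^2 + 1 + 1/q^2) \<cdot> (gen K0*gen K1*gen K0*gen K1) + (q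
      + 1/q) \<cdot> (gen K0^2*gen K1^2)
         + (q + 1/q) \<cdot> (C0' \<cdot> gen K0^2 + C1' \<cdot> gen K1^2)
         + B' \<cdot> ((q + 1 + 1/q) \<cdot> (gen K0*gen K1) + gen K1*gen K0)
         + (q + 1 + 1/q) \<cdot> (D0' \<cdot> gen K0 + D1' \<cdot> gen K1) - Q0' \<cdot> 1"
  have R: "?r1 \<in> rel_ideal S" "?r2 \<in> rel_ideal S" "?r3 \<in> rel_ideal S"
    by (rule rel_ideal_gen, simp add: AW_rels_def Let_def cdefs)+
  have "?a = - (?r1 * x)"
    by (rule poly_mapping_eqI) (simp add: expand lookup_add lookup_minus algebra_simps)
  then show "?a \<in> rel_ideal S" using rel_ideal_uminus[OF rel_ideal_mult_right[OF R(1)]] by simp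
  have "?b = - (?r2 * x)"
    by (rule poly_mapping_eqI) (simp add: expand lookup_add lookup_minus algebra_simps)
  then show "?b \<in> rel_ideal S" using rel_ideal_uminus[OF rel_ideal_mult_right[OF R(2)]] by simp
  have "?c = ?r3 * x"
    by (rule poly_mapping_eqI) (simp add: expand lookup_add lookup_minus algebra_simps)
  then show "?c \<in> rel_ideal S" using rel_ideal_mult_right[OF R(3)] by simp
qed

text \<open>
  Since \<open>K1 K0\<^sup>2 x\<close> reduces to \<open>K0 K1 K0 x\<close> and shorter words, closure of the span under \<open>K1\<close> only
  propagates along multiplication by \<open>K0\<close> when \<open>K1 K0\<close> is controlled as well.
\<close>

definition "K1_stable x \<longleftrightarrow> spanned x \<and> spanned (gen K1 * x) \<and> spanned (gen K1 * (gen K0 * x))"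

lemma stable_add: "K1_stable x \<Longrightarrow> K1_stable y \<Longrightarrow> K1_stable (x + y)"
  by (auto simp: K1_stable_def distrib_left intro: spanned_add)

lemma stable_K0: "K1_stable x \<Longrightarrow> K1_stable (gen K0 * x)"
  unfolding K1_stable_def by (auto intro!: spanned_intros intro: spanned_cong[OF AW2])

lemma spanned_K1_pol: "spanned (gen K1 * pol p)"
  using spanned_pol[of "pCons 0 p"] by simp

lemma stable_pol: "K1_stable (pol p)"
  unfolding K1_stable_def using spanned_pol spanned_K1_pol spanned_K10_pol by blast

text \<open>\<open>AW1\<close> and \<open>AW3\<close> enter only here, directly in front of a
  polynomial in K1; \<open>AW2\<close> does the rest in \<open>stable_K0\<close>.\<close>

lemma stable_K10_pol: "K1_stable (gen K1 * (gen K0 * pol p))"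
proof -
  have K11: "gen K1 * (gen K1 * pol p) = pol (pCons 0 (pCons 0 p))" and K1: "gen K1 * pol p = pol (pCons 0 p)"
    by simp_all
  note base = spanned_pol spanned_K10_pol spanned_K1_pol
  have "spanned (gen K1 * (gen K1 * (gen K0 * pol p)))"
    by (rule spanned_cong[OF AW1]) (unfold K11 K1, intro spanned_intros base)
  moreover have "spanned (gen K1 * (gen K0 * (gen K1 * (gen K0 * pol p))))"
    by (rule spanned_cong[OF AW3]) (unfold K11 K1, intro spanned_intros base)
  ultimately show ?thesis
    unfolding K1_stable_def using spanned_K10_pol by blast
qed

lemma stable_horner: "K1_stable (horner l)"
proof (induction l)
  case Nil
  show ?case using stable_pol[of 0] by simp
next
  case (Cons x l)
  then show ?case
    by (cases x) (simp add: stable_add stable_K0 stable_pol stable_K10_pol)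
qed

lemma spanned_K1: assumes "spanned x" shows "spanned (gen K1 * x)"
proof -
  from assms obtain \<gamma> l where x: "x - (pol \<gamma> + horner l) \<in> rel_ideal S" by (auto simp: spanned_def)
  have "spanned (gen K1 * (pol \<gamma> + horner l))"
    using stable_add[OF stable_pol stable_horner] by (simp add: K1_stable_def)
  then show ?thesis
    by (rule spanned_cong[rotated]) (use rel_ideal_mult_left[OF x, of "gen K1"] in \<open>simp add: right_diff_distrib\<close>)
qed

lemma spanned_all: "spanned x"
proof (induction x rule: free_induct)
  case one
  show ?case using spanned_pol[of 1] by (simp add: one_pCons)
next
  case (gen g p)
  then show ?case by (cases g) (auto intro: spanned_K0 spanned_K1)
qed (auto intro: spanned_add spanned_scale)

end

definition fscale :: "complex \<Rightarrow> ('i \<Rightarrow> complex) \<Rightarrow> 'i \<Rightarrow> complex" where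
  "fscale k f = (\<lambda>i. k * f i)"

lemma fscale_apply [simp]: "fscale k f i = k * f i"
  by (simp add: fscale_def)

lemma minus_fun_apply [simp]: "(f - g) i = f i - (g i :: complex)" and uminus_fun_apply [simp]: "(- f) i = - (f i :: complex)"
  by (simp_all add: fun_diff_def fun_Compl_def)

section \<open>The basic representation on an orbit\<close>

text \<open>
  Functions on an orbit of points \<open>pt i\<close> under the reflections \<open>x \<mapsto> 1/x\<close> and \<open>x \<mapsto> q/x\<close> replace Laurent
  polynomials, so that the divided differences in the Demazure-Lusztig operators \<open>T1\<close> and \<open>T0\<close> are
  divisions by nonzero numbers.  \<open>Y\<close> acts as \<open>T1 T0\<close>.
\<close>

locale basic_rep = daha_params +
  fixes pt :: "'i \<Rightarrow> complex" and s s0 :: "'i \<Rightarrow> 'i"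
  assumes s_s: "s (s i) = i" and s0_s0: "s0 (s0 i) = i"
    and pt_s: "pt (s i) = 1 / pt i" and pt_s0: "pt (s0 i) = q / pt i"
    and pt_nz: "pt i \<noteq> 0" and pt_1: "pt i ^ 2 \<noteq> 1" and pt_q: "pt i ^ 2 \<noteq> q"
begin

text \<open>Coefficients of the Demazure-Lusztig operators. They satisfy u1 + v1 = -ab and u0 + v0 =
  -cd/q, so the constant function is a common eigenvector of \<open>T1\<close> and
  \<open>T0\<close>.\<close>

definition "u1 x = ((a+b)*x - (1+a*b)) / (1-x^2)"
definition "v1 x = (1-a*x)*(1-b*x) / (1-x^2)"
definition "u0 x = x*((c*d+q)*x - (c+d)*q) / (q*(q-x^2))"
definition "v0 x = - ((c-x)*(d-x) / (q-x^2))"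

definition "T1 f = (\<lambda>i. u1 (pt i) * f i + v1 (pt i) * f (s i))"
definition "T0 f = (\<lambda>i. u0 (pt i) * f i + v0 (pt i) * f (s0 i))"
definition "Zo f = (\<lambda>i. pt i * f i)"
definition "Zi f = (\<lambda>i. f i / pt i)"
text \<open>The inverses of \<open>T1\<close> and \<open>T0\<close>, solved from their quadratic
  relations.\<close>

definition "T1i f = fscale (- inverse (a*b)) (T1 f + fscale (a*b+1) f)"
definition "T0i f = fscale (- q * inverse (c*d)) (T0 f + fscale (1+c*d*inverse q) f)"

definition "\<rho> g = (case g of hT1 \<Rightarrow> T1 | hY \<Rightarrow> (\<lambda>f. T1 (T0 f)) | hY' \<Rightarrow>
    (\<lambda>f. T0i (T1i f)) | hZ \<Rightarrow> Zo | hZ' \<Rightarrow> Zi)"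

lemma \<rho>_simps: "\<rho> hT1 f = T1 f" "\<rho> hY f = T1 (T0 f)" "\<rho> hY' f = T0i (T1i f)" "\<rho> hZ f = Zo f"
    "\<rho> hZ' f = Zi f"
  by (simp_all add: \<rho>_def)

lemma lin:
  "T1 (f + g) = T1 f + T1 g" "T1 (f - g) = T1 f - T1 g" "T1 (fscale k f) = fscale k (T1 f)"
  "T0 (f + g) = T0 f + T0 g" "T0 (f - g) = T0 f - T0 g" "T0 (fscale k f) = fscale k (T0 f)"
  "Zo (f + g) = Zo f + Zo g" "Zo (f - g) = Zo f - Zo g" "Zo (fscale k f) = fscale k (Zo f)"
  "T1 (- f) = - T1 f" "T0 (- f) = - T0 f" "Zo (- f) = - Zo f" "Zi (- f) = - Zi f"
  "Zi (f + g) = Zi f + Zi g" "Zi (f - g) = Zi f - Zi g" "Zi (fscale k f) = fscale k (Zi f)"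
  by (simp_all add: fun_eq_iff T1_def T0_def Zo_def Zi_def algebra_simps add_divide_distrib diff_divide_distrib)

sublocale rep: free_action fscale \<rho>
proof
  fix g :: daha_gen and f h :: "'i \<Rightarrow> complex" and k l :: complex
  show "fscale k (f + h) = fscale k f + fscale k h" "fscale (k + l) f = fscale k f + fscale l f"
    "fscale k (fscale l f) = fscale (k * l) f" "fscale 1 f = f"
    by (simp_all add: fun_eq_iff algebra_simps)
  show "\<rho> g (f + h) = \<rho> g f + \<rho> g h" "\<rho> g (fscale k f) = fscale k (\<rho> g f)"
    by (cases g; simp add: \<rho>_simps T1i_def T0i_def lin; simp add: fun_eq_iff algebra_simps)+
qed

lemma ZZi: "Zo (Zi f) = f" "Zi (Zo f) = f"
  using pt_nz by (simp_all add: fun_eq_iff Zo_def Zi_def)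

lemma pt_nz': "1 - pt i ^ 2 \<noteq> 0" "q - pt i ^ 2 \<noteq> 0"
  using pt_1[of i] pt_q[of i] by auto

text \<open>Values at the reflected point over the denominator of the original one, so that
  \<open>hecke_aux\<close> reduces the Hecke relation to numerators.\<close>

lemma u1_inv:
  assumes "x \<noteq> 0" "1 - x^2 \<noteq> 0"
  shows "u1 (1/x) = ((1+a*b)*x^2 - (a+b)*x) / (1-x^2)" "v1 (1/x) = - ((x-a)*(x-b)) / (1-x^2)"
proof -
  have "1 - (1/x)^2 = (1-x^2) * (- 1/x^2)"
    using assms(1) by (simp add: field_simps)
  then show "u1 (1/x) = ((1+a*b)*x^2 - (a+b)*x) / (1-x^2)" "v1 (1/x) = - ((x-a)*(x-b)) / (1-x^2)"
    unfolding u1_def v1_def using assms by (simp_all add: field_simps power2_eq_square)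
qed

lemma u0_inv:
  assumes "x \<noteq> 0" "q - x^2 \<noteq> 0"
  shows "u0 (q/x) = ((c+d)*q*x - (c*d+q)*q) / (q*(q-x^2))" "v0 (q/x) = (c*x-q)*(d*x-q) / (q*(q-x^2))"
proof -
  have "q - (q/x)^2 = (q-x^2) * (- q/x^2)"
    using assms(1) by (simp add: field_simps power2_eq_square)
  then show "u0 (q/x) = ((c+d)*q*x - (c*d+q)*q) / (q*(q-x^2))" "v0 (q/x) = (c*x-q)*(d*x-q) / (q*(q-x^2))"
    unfolding u0_def v0_def using assms nz(1) by (simp_all add: field_simps power2_eq_square)
qed

lemma hecke_aux:
  assumes "w \<noteq> (0::complex)"
  shows "m + n = - k * w \<Longrightarrow> m / w + n / w = - k"
    and "m^2 + v * v' = - k * m * w - l * w^2 \<Longrightarrow> (m / w)^2 + (v / w) * (v' / w) = - k * (m / w) - l"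
proof -
  show "m / w + n / w = - k" if "m + n = - k * w"
    using that assms by (simp flip: add_divide_distrib)
  show "(m / w)^2 + (v / w) * (v' / w) = - k * (m / w) - l" if "m^2 + v * v' = - k * m * w - l * w^2"
  proof -
    have "(m / w)^2 + (v / w) * (v' / w) = (m^2 + v * v') / w^2"
      by (simp add: add_divide_distrib power_divide power2_eq_square)
    then show ?thesis
      unfolding that using assms by (simp add: diff_divide_distrib power2_eq_square)
  qed
qed

text \<open>On the values at a point and its reflection \<open>T1\<close> is a 2 by 2 matrix with
  trace -(ab + 1) and determinant ab; the relation is its Cayley-Hamilton identity.\<close>

lemma T1_T1: "T1 (T1 f) = - fscale (a*b+1) (T1 f) - fscale (a*b) f"
proof
  fix i
  let ?x = "pt i"
  note x = pt_nz[of i] pt_nz'(1)[of i]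
  have 1: "u1 ?x + u1 (1/?x) = - (a*b+1)"
    unfolding u1_inv[OF x] unfolding u1_def by (rule hecke_aux[OF x(2)]) (simp add: algebra_simps)
  have 2: "u1 ?x ^ 2 + v1 ?x * v1 (1/?x) = - (a*b+1) * u1 ?x - a*b"
    unfolding u1_inv[OF x] unfolding u1_def v1_def
    by (rule hecke_aux[OF x(2)]) (simp add: algebra_simps power2_eq_square)
  have "T1 (T1 f) i = (u1 ?x ^ 2 + v1 ?x * v1 (1/?x)) * f i + v1 ?x * (u1 ?x + u1 (1/?x)) * f (s i)"
    by (simp add: T1_def s_s pt_s algebra_simps power2_eq_square)
  then show "T1 (T1 f) i = (- fscale (a*b+1) (T1 f) - fscale (a*b) f) i"
    unfolding 1 2 by (simp add: T1_def algebra_simps)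
qed

lemma T0_T0: "T0 (T0 f) = - fscale (1+c*d/q) (T0 f) - fscale (c*d/q) f"
proof
  fix i
  let ?x = "pt i"
  note x = pt_nz[of i] pt_nz'(2)[of i]
  have w: "q * (q - ?x^2) \<noteq> 0" using x nz(1) by simp
  have v0: "v0 ?x = (- q * ((c-?x)*(d-?x))) / (q * (q - ?x^2))"
    unfolding v0_def using nz(1) by simp
  have 1: "u0 ?x + u0 (q/?x) = - (1+c*d/q)"
    unfolding u0_inv[OF x] unfolding u0_def
    by (rule hecke_aux[OF w]) (use nz(1) in \<open>simp add: field_simps power2_eq_square\<close>)
  have 2: "u0 ?x ^ 2 + v0 ?x * v0 (q/?x) = - (1+c*d/q) * u0 ?x - c*d/q"
    unfolding u0_inv[OF x] v0 unfolding u0_def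
    by (rule hecke_aux[OF w]) (use nz(1) in \<open>simp add: field_simps power2_eq_square\<close>)
  have "T0 (T0 f) i = (u0 ?x ^ 2 + v0 ?x * v0 (q/?x)) * f i + v0 ?x * (u0 ?x + u0 (q/?x)) * f (s0 i)"
    by (simp add: T0_def s0_s0 pt_s0 algebra_simps power2_eq_square)
  then show "T0 (T0 f) i = (- fscale (1+c*d/q) (T0 f) - fscale (c*d/q) f) i"
    unfolding 1 2 by (simp add: T0_def algebra_simps)
qed

text \<open>The reflection inverts the coordinate, so the reflected terms on the two sides agree.
  What remains is the definition of \<open>u1\<close> cleared of its denominator.\<close>

lemma T1_Z: "T1 (Zo f) = Zi (T1 f) + fscale (a*b+1) (Zi f) - fscale (a+b) f"
  and T1_Zi: "T1 (Zi f) = Zo (T1 f) - fscale (a*b+1) (Zi f) + fscale (a+b) f"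
proof -
  have gen: "u * x - (u/x + (a*b+1)/x - (a+b)) = ((a+b)*x - (1+a*b) - u*(1-x^2)) / x" if "x \<noteq> 0" for u x
    using that by (simp add: field_simps power2_eq_square)
  have u: "u1 (pt i) * (1 - pt i ^ 2) = (a+b) * pt i - (1+a*b)" for i
    using pt_nz'[of i] by (simp add: u1_def)
  have 1: "u1 (pt i) * pt i = u1 (pt i) / pt i + (a*b+1) / pt i - (a+b)" for i
    using gen[OF pt_nz, of "u1 (pt i)" i] by (simp add: u)
  then have 2: "u1 (pt i) / pt i = u1 (pt i) * pt i - (a*b+1) / pt i + (a+b)" for i
    by simp
  show "T1 (Zo f) = Zi (T1 f) + fscale (a*b+1) (Zi f) - fscale (a+b) f"
  proof
    fix i
    have "T1 (Zo f) i = (u1 (pt i) * pt i) * f i + v1 (pt i) * (f (s i) / pt i)"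
      by (simp add: T1_def Zo_def pt_s)
    then show "T1 (Zo f) i = (Zi (T1 f) + fscale (a*b+1) (Zi f) - fscale (a+b) f) i"
      unfolding 1 by (simp add: T1_def Zi_def algebra_simps add_divide_distrib)
  qed
  show "T1 (Zi f) = Zo (T1 f) - fscale (a*b+1) (Zi f) + fscale (a+b) f"
  proof
    fix i
    have "T1 (Zi f) i = (u1 (pt i) / pt i) * f i + v1 (pt i) * (f (s i) * pt i)"
      by (simp add: T1_def Zi_def pt_s)
    then show "T1 (Zi f) i = (Zo (T1 f) - fscale (a*b+1) (Zi f) + fscale (a+b) f) i"
      unfolding 2 by (simp add: T1_def Zo_def Zi_def algebra_simps add_divide_distrib)
  qed
qed

lemma T0_Z: "T0 (Zo f) = fscale q (Zi (T0 f)) - fscale (1+c*d/q) (Zo f) + fscale (c+d) f"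
  and T0_Zi: "T0 (Zi f) = fscale (1/q) (Zo (T0 f)) + fscale ((1+c*d/q)/q) (Zo f) - fscale ((c+d)/q) f"
proof -
  have gen: "u * x - (q * u / x - (1+c*d/q) * x + (c+d)) = ((c*d+q)*x^2 - (c+d)*q*x
      - u*q*(q-x^2)) / (q*x)" if "x \<noteq> 0" for u x
    using that nz(1) by (simp add: field_simps power2_eq_square)
  have u: "u0 (pt i) * q * (q - pt i ^ 2) = (c*d+q) * pt i ^ 2 - (c+d) * q * pt i" for i
  proof -
    have "q * (q - pt i ^ 2) \<noteq> 0" using pt_nz'[of i] nz(1) by simp
    then have "u0 (pt i) * (q * (q - pt i ^ 2)) = pt i * ((c*d+q) * pt i - (c+d)*q)"
      by (simp add: u0_def)
    then show ?thesis by (simp add: algebra_simps power2_eq_square)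
  qed
  have 1: "u0 (pt i) * pt i = q * u0 (pt i) / pt i - (1+c*d/q) * pt i + (c+d)" for i
    using gen[OF pt_nz, of "u0 (pt i)" i] by (simp add: u)
  have 2: "u0 (pt i) / pt i = u0 (pt i) * pt i / q + (1+c*d/q)/q * pt i - (c+d)/q" for i
  proof -
    have "u0 (pt i) / pt i * q = u0 (pt i) * pt i + (1+c*d/q) * pt i - (c+d)"
      using 1[of i] by simp
    then have "u0 (pt i) / pt i = (u0 (pt i) * pt i + (1+c*d/q) * pt i - (c+d)) / q"
      using nz(1) by (simp only: eq_divide_eq) simp
    then show ?thesis by (simp add: add_divide_distrib diff_divide_distrib distrib_right)
  qed
  show "T0 (Zo f) = fscale q (Zi (T0 f)) - fscale (1+c*d/q) (Zo f) + fscale (c+d) f"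
  proof
    fix i
    have "T0 (Zo f) i = (u0 (pt i) * pt i) * f i + v0 (pt i) * (q * f (s0 i) / pt i)"
      by (simp add: T0_def Zo_def pt_s0)
    then show "T0 (Zo f) i = (fscale q (Zi (T0 f)) - fscale (1+c*d/q) (Zo f) + fscale (c+d) f) i"
      unfolding 1 by (simp add: T0_def Zo_def Zi_def algebra_simps add_divide_distrib)
  qed
  show "T0 (Zi f) = fscale (1/q) (Zo (T0 f)) + fscale ((1+c*d/q)/q) (Zo f) - fscale ((c+d)/q) f"
  proof
    fix i
    have "T0 (Zi f) i = (u0 (pt i) / pt i) * f i + v0 (pt i) * (f (s0 i) * pt i / q)"
      by (simp add: T0_def Zi_def pt_s0)
    then show "T0 (Zi f) i = (fscale (1/q) (Zo (T0 f)) + fscale ((1+c*d/q)/q) (Zo f) - fscale ((c+d)/q) f) i"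
      unfolding 2 by (simp add: T0_def Zo_def Zi_def algebra_simps add_divide_distrib)
  qed
qed

text \<open>With Y = T1 T0 every relation unfolds to the quadratic relations and the exchange rules
  of \<open>T1\<close> and \<open>T0\<close> with Z.\<close>

lemma rep_rels:
  assumes "r \<in> R" shows "rep.A r f = 0"
  using assms unfolding DAHA_rels_def Let_def
  apply (elim insertE emptyE; hypsubst)
  apply (simp_all add: rep.act_diff rep.act_add rep.act_scale rep.act_mult rep.act_gen rep.act_uminus power2_eq_square
     \<rho>_simps T1i_def T0i_def lin T1_T1 T0_T0 T1_Z T1_Zi T0_Z T0_Zi ZZi)
  apply (simp_all add: fun_eq_iff)
  using nz
  apply (simp_all add: field_simps power2_eq_square)
  done

end

section \<open>Generic orbits and the leading behaviour of K0\<close>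

context daha_params
begin

text \<open>The first condition keeps the denominators 1 - x^2 and q - x^2 nonzero along the orbit,
  the second the numerators of \<open>v1\<close> and \<open>v0\<close>. Inverse parameters appear
  because the orbit contains both z and 1/z.\<close>

definition "generic z \<longleftrightarrow> z \<noteq> 0 \<and> (\<forall>k::int. z^2 \<noteq> q powi k
   \<and> (\<forall>x\<in>{a, b, c, d, 1/a, 1/b, 1/c, 1/d}. z \<noteq> x * q powi k))"

end

locale generic_point = daha_params +
  fixes z assumes generic: "generic z"
begin

lemma z_nz: "z \<noteq> 0" and z2: "z^2 \<noteq> q powi k" and zx: "x \<in> {a, b, c, d, 1/a, 1/b, 1/c, 1/d}
    \<Longrightarrow> z \<noteq> x * q powi k"
  using generic unfolding generic_def by blast+

text \<open>The index \<open>(k, True)\<close> stands for \<open>q\<^sup>k z\<close> and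
  \<open>(k, False)\<close> for \<open>q\<^sup>k / z\<close>; with functions on indices, supports
  are read off from integers.\<close>

definition "pt i = q powi fst i * (if snd i then z else 1/z)" for i :: "int \<times> bool"
definition "s i = (- fst i, \<not> snd i)" for i :: "int \<times> bool"
definition "s0 i = (1 - fst i, \<not> snd i)" for i :: "int \<times> bool"

lemma pt_square: "pt i ^ 2 \<noteq> q powi k"
proof
  obtain j \<sigma> where i: "i = (j, \<sigma>)" by fastforce
  assume *: "pt i ^ 2 = q powi k"
  show False
  proof (cases \<sigma>)
    case True
    with * have "z^2 = q powi k / (q powi j)^2" using nz(1) by (simp add: pt_def i field_simps)
    also have "\<dots> = q powi (k - 2*j)" using nz(1) by (simp add: power_int_diff power_int_mult_distrib
        power_int_mult mult.commute flip: power_int_numeral)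
    finally show False using z2 by blast
  next
    case False
    with * have "z^2 = (q powi j)^2 / q powi k" using nz(1) z_nz by (simp add: pt_def i field_simps)
    also have "\<dots> = q powi (2*j - k)" using nz(1) by (simp add: power_int_diff power_int_mult mult.commute)
    finally show False using z2 by blast
  qed
qed

lemma pt_nz: "pt i \<noteq> 0"
  using nz(1) z_nz by (simp add: pt_def)

sublocale basic_rep q a b c d pt s s0
proof
  fix i
  show "s (s i) = i" "s0 (s0 i) = i" by (simp_all add: s_def s0_def)
  show "pt (s i) = 1 / pt i" "pt (s0 i) = q / pt i"
    using nz(1) z_nz by (auto simp: pt_def s_def s0_def power_int_minus power_int_diff field_simps)
  show "pt i \<noteq> 0" by (rule pt_nz)
  show "pt i ^ 2 \<noteq> 1" "pt i ^ 2 \<noteq> q" using pt_square[of i 0] pt_square[of i 1] by simp_all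
qed

lemma pt_ne: "x \<in> {a, b, c, d} \<Longrightarrow> pt i \<noteq> x \<and> x * pt i \<noteq> 1"
proof -
  assume x: "x \<in> {a, b, c, d}"
  then have x0: "x \<noteq> 0" using nz by auto
  obtain j \<sigma> where i: "i = (j, \<sigma>)" by fastforce
  have "x * q powi (-j) \<noteq> z" "x * q powi j \<noteq> z" "1/x * q powi (-j) \<noteq> z" "1/x * q powi j \<noteq> z"
    using zx[of x] zx[of "1/x"] x by fastforce+
  then show ?thesis
    using nz(1) z_nz x0 by (cases \<sigma>) (auto simp: pt_def i power_int_minus field_simps)
qed

text \<open>The factor by which \<open>K0op\<close> moves a value outward on the branch of z. Its
  vanishing would put the inverse of a parameter on the orbit.\<close>

lemma coeff_nz: "v1 (pt i) * v0 (1 / pt i) \<noteq> 0"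
proof -
  have "q - (1/pt i)^2 \<noteq> 0"
    using pt_nz'(2)[of "s i"] by (simp add: pt_s)
  moreover have "c - 1/pt i \<noteq> 0" "d - 1/pt i \<noteq> 0"
    using pt_ne[of c i] pt_ne[of d i] pt_nz[of i] by (auto simp: field_simps)
  ultimately have "v0 (1/pt i) \<noteq> 0"
    by (simp add: v0_def)
  moreover have "v1 (pt i) \<noteq> 0"
    using pt_ne[of a i] pt_ne[of b i] pt_nz'(1)[of i] by (auto simp: v1_def)
  ultimately show ?thesis by simp
qed

text \<open>
  \<open>K0\<close> enlarges a support by one step on each of the two branches of the orbit, and the value at
  the new end point is a nonzero multiple of the value at the old one.
\<close>

definition "low n f \<longleftrightarrow> (\<forall>k < - n. f (k, True) = 0) \<and> (\<forall>k > n. f (k, False) =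
    (0::complex))" for n :: int

definition "act_\<psi> U = rep.A (\<psi> U)"
definition "K0op f = T1 (T0 f) + fscale \<kappa> (T0i (T1i f))"

lemma act_\<psi>_simps:
  "act_\<psi> (x + y) f = act_\<psi> x f + act_\<psi> y f" "act_\<psi> (k \<cdot> x) f = fscale k (act_\<psi> x f)"
  "act_\<psi> (gen K0 * x) f = fscale q (K0op (act_\<psi> x f))"
  "act_\<psi> (gen K1 * x) f i = (pt i + 1 / pt i) * act_\<psi> x f i" "act_\<psi> 0 f = 0" "act_\<psi> 1 f = f"
  by (simp_all add: act_\<psi>_def k0_def k1_def K0op_def rep.act_add rep.act_scale rep.act_mult rep.act_gen
      \<rho>_simps distrib_right) (simp add: Zo_def Zi_def)

lemma low_add: "low n f \<Longrightarrow> low n g \<Longrightarrow> low n (f + g)"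
  and low_scale: "low n f \<Longrightarrow> low n (fscale k f)"
  and low_mono: "low n f \<Longrightarrow> n \<le> n' \<Longrightarrow> low n' f"
  by (auto simp: low_def)

lemma low_K1: "low n (act_\<psi> x f) \<Longrightarrow> low n (act_\<psi> (gen K1 * x) f)"
  by (auto simp: low_def act_\<psi>_simps)

text \<open>For k < -n every index reached from \<open>(k, True)\<close> lies outside the support,
  except possibly \<open>(k + 1, True)\<close>, which only the product T1 T0 reaches.\<close>

lemma K0op_True:
  assumes "low n f" "k < - n"
  shows "K0op f (k, True) = v1 (pt (k, True)) * v0 (1 / pt (k, True)) * f (k + 1, True)"
  using assms pt_s[of "(k, True)"]
  by (simp add: K0op_def T1_def T0_def T1i_def T0i_def s_def s0_def low_def add.commute)

lemma low_K0:
  assumes "low n f" shows "low (n + 1) (K0op f)"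
  unfolding low_def
proof (intro conjI allI impI)
  fix k :: int assume k: "k < - (n + 1)"
  then show "K0op f (k, True) = 0"
    using K0op_True[OF assms, of k] assms by (simp add: low_def)
next
  fix k :: int assume k: "k > n + 1"
  then show "K0op f (k, False) = 0"
    using assms by (simp add: K0op_def T1_def T0_def T1i_def T0i_def s_def s0_def low_def)
qed

lemma act_pol: "act_\<psi> (pol p) f i = poly p (pt i + 1 / pt i) * f i"
  by (induction p) (simp_all add: act_\<psi>_simps algebra_simps)

lemma low_pol: "low n f \<Longrightarrow> low n (act_\<psi> (pol p) f)"
  by (simp add: low_def act_pol)

lemma low_level:
  "low 0 f \<Longrightarrow> low 1 (act_\<psi> (gen K0 * pol \<alpha> + gen K1 * (gen K0 * pol \<beta>)) f)"
  using low_K0[OF low_pol, of 0 f] by (auto simp: act_\<psi>_simps(1,3) intro!: low_add low_K1 low_scale)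

lemma low_power: "low n (act_\<psi> x f) \<Longrightarrow> low (n + int m) (act_\<psi> (gen K0 ^ m * x) f)"
proof (induction m)
  case (Suc m)
  have n: "n + int (Suc m) = n + int m + 1" by simp
  show ?case
    unfolding power_Suc mult.assoc act_\<psi>_simps(3) n
    by (rule low_scale[OF low_K0[OF Suc.IH[OF Suc.prems]]])
qed simp

lemma power_end:
  assumes "low n (act_\<psi> x f)"
  shows "\<exists>w. w \<noteq> 0 \<and> act_\<psi> (gen K0 ^ m * x) f (- n - int m, True) = w * act_\<psi> x f (- n, True)"
proof (induction m)
  case 0
  show ?case by (rule exI[of _ 1]) simp
next
  case (Suc m)
  then obtain w where w: "w \<noteq> 0" "act_\<psi> (gen K0 ^ m * x) f (- n - int m, True) = w * act_\<psi> x f (- n, True)"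
    by blast
  let ?k = "- n - int (Suc m)"
  have "act_\<psi> (gen K0 ^ Suc m * x) f (?k, True)
      = q * (v1 (pt (?k, True)) * v0 (1 / pt (?k, True)) * act_\<psi> (gen K0 ^ m * x) f (?k + 1, True))"
    using K0op_True[OF low_power[OF assms], of ?k m] by (simp add: mult.assoc act_\<psi>_simps)
  also have "?k + 1 = - n - int m" by simp
  finally show ?case
    using w coeff_nz[of "(?k, True)"] nz(1)
    by (intro exI[of _ "q * (v1 (pt (?k, True)) * v0 (1 / pt (?k, True))) * w"]) simp
qed

lemma low_horner: "low 0 f \<Longrightarrow> low (int (length l)) (act_\<psi> (horner l) f)"
proof (induction l)
  case (Cons x l)
  then have 1: "low (int (length l)) (act_\<psi> (horner l) f)" by blast
  have 2: "low (int (length (x # l))) (act_\<psi> (gen K0 * horner l) f)"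
    using low_scale[OF low_K0[OF 1]] by (simp add: act_\<psi>_simps add.commute)
  obtain \<alpha> \<beta> where x: "x = (\<alpha>, \<beta>)" by fastforce
  have "low (int (length (x # l))) (act_\<psi> (gen K0 * pol \<alpha> + gen K1 * (gen K0 * pol \<beta>)) f)"
    using low_level[OF Cons.prems] by (rule low_mono) simp
  from low_add[OF this 2] show ?case
    unfolding x by (simp only: horner.simps act_\<psi>_simps(1))
qed (simp add: low_def act_\<psi>_simps)

lemma horner_snoc:
  "horner (l @ [(\<alpha>, \<beta>)]) = horner l + gen K0 ^ length l * (gen K0 * pol \<alpha> + gen K1 * (gen K0 * pol \<beta>))"
  by (induction l rule: horner.induct) (simp_all add: algebra_simps mult.assoc)

text \<open>A point mass pushed into the corner: whenever \<open>\<psi> U * idem\<close> vanishes in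
  the Hecke algebra, \<open>U\<close> kills this function.\<close>

definition "probe = rep.A idem (\<lambda>i. if i = (0, True) then 1 else 0)"

lemma probe: "low 0 probe" "probe (0, True) \<noteq> 0"
proof -
  let ?\<delta> = "\<lambda>i::int\<times>bool. if i = (0, True) then 1 else (0::complex)"
  have p: "probe = fscale (1/(a*b-1)) (T1 ?\<delta> + fscale (a*b) ?\<delta>)"
    by (simp add: probe_def idem_def rep.act_scale rep.act_add rep.act_gen \<rho>_simps)
  show "low 0 probe"
    by (auto simp: p low_def T1_def s_def)
  have z: "pt (0, True) = z" by (simp add: pt_def)
  have "probe (0, True) = (1/(a*b-1)) * (u1 z + a*b)"
    by (simp add: p T1_def s_def z)
  also have "u1 z + a*b = - v1 z"
    using pt_nz'(1)[of "(0, True)"] unfolding z by (simp add: u1_def v1_def field_simps power2_eq_square)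
  finally show "probe (0, True) \<noteq> 0"
    using ab coeff_nz[of "(0, True)"] by (auto simp: z)
qed

lemma rep_Id:
  assumes "x \<in> rel_ideal R" shows "rep.A x f = 0"
proof -
  have A0: "rep.A y 0 = 0" for y
    using rep.act_vscale[of y 0 0] by simp
  have "\<forall>f. rep.A x f = 0"
    using assms
  proof (rule rel_ideal_least)
    show "\<forall>f. rep.A (y * x) f = 0" "\<forall>f. rep.A (x * y) f = 0" if "\<forall>f. rep.A x f = 0" for x y
      using that by (simp_all only: rep.act_mult A0 simp_thms)
  qed (simp_all only: rep_rels rep.act_add rep.act_zero add_0_left simp_thms)
  then show ?thesis by blast
qed

lemma act_probe:
  assumes "\<pi> (\<psi> U * idem) = 0" shows "act_\<psi> U probe = 0"
  using rep_Id[of "\<psi> U * idem"] assms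
  by (simp add: act_\<psi>_def probe_def proj_eq_0_iff rep.act_mult)

lemma pol_end:
  assumes "\<pi> (\<psi> (pol \<gamma>) * idem) = 0" shows "poly \<gamma> (z + 1/z) = 0"
  using fun_cong[OF act_probe[OF assms], of "(0, True)"] probe(2) by (simp add: act_pol pt_def)

text \<open>At the far end of the support only the last pair survives. Its polynomials are evaluated
  at z, before \<open>K0\<close> moves the value to z/q, while the outer \<open>K1\<close> acts at
  z/q; hence the two different arguments.\<close>

lemma horner_end:
  assumes "\<pi> (\<psi> (pol \<gamma> + horner (l @ [(\<alpha>, \<beta>)])) * idem) = 0"
  shows "poly \<alpha> (z + 1/z) + (z/q + q/z) * poly \<beta> (z + 1/z) = 0"
proof -
  let ?x = "gen K0 * pol \<alpha> + gen K1 * (gen K0 * pol \<beta>)"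
  let ?m = "int (length l)"
  \<comment> \<open>On this branch the shorter terms are supported from -m upward; the last pair, of
    degree m + 1 in K0, alone reaches -m - 1.\<close>
  let ?k = "- 1 - ?m"
  have "low ?m (act_\<psi> (pol \<gamma> + horner l) probe)"
    using low_add[OF low_mono[OF low_pol[OF probe(1)], of ?m] low_horner[OF probe(1)]]
    by (simp add: act_\<psi>_simps)
  then have "act_\<psi> (pol \<gamma> + horner l) probe (?k, True) = 0"
    by (simp add: low_def)
  moreover have "act_\<psi> (pol \<gamma> + horner (l @ [(\<alpha>, \<beta>)])) probe (?k, True)
      = act_\<psi> (pol \<gamma> + horner l) probe (?k, True) + act_\<psi> (gen K0 ^ length l * ?x) probe (?k, True)"
    by (simp add: horner_snoc act_\<psi>_simps(1))
  ultimately have 0: "act_\<psi> (gen K0 ^ length l * ?x) probe (?k, True) = 0"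
    using act_probe[OF assms] by simp
  obtain w where "w \<noteq> 0" "act_\<psi> (gen K0 ^ length l * ?x) probe (?k, True) = w * act_\<psi> ?x probe (- 1, True)"
    using power_end[OF low_level[OF probe(1)]] by blast
  with 0 have 1: "act_\<psi> ?x probe (- 1, True) = 0" by simp
  have K0: "act_\<psi> (gen K0 * pol p) probe (- 1, True)
      = q * (v1 (pt (-1, True)) * v0 (1 / pt (-1, True))) * probe (0, True) * poly p (z + 1/z)" for p
    using K0op_True[OF low_pol[OF probe(1)], of "-1" p] by (simp add: act_\<psi>_simps act_pol pt_def)
  have pt1: "pt (-1, True) + 1 / pt (-1, True) = z/q + q/z"
    using nz(1) z_nz by (simp add: pt_def power_int_minus field_simps)
  have "q * (v1 (pt (-1, True)) * v0 (1 / pt (-1, True))) * probe (0, True)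
      * (poly \<alpha> (z + 1/z) + (z/q + q/z) * poly \<beta> (z + 1/z)) = 0"
    using 1 unfolding act_\<psi>_simps(1) plus_fun_apply act_\<psi>_simps(4) K0 pt1 by (simp only: algebra_simps)
  then show ?thesis
    using nz(1) coeff_nz[of "(-1, True)"] probe(2) by simp
qed

end

section \<open>Linear independence of the normal forms and injectivity\<close>

context daha_params
begin

lemma generic_inverse: "generic z \<Longrightarrow> generic (1/z)"
  unfolding generic_def
proof (intro conjI allI ballI; elim conjE)
  fix k x
  assume z: "z \<noteq> 0" and *: "\<forall>k::int. z^2 \<noteq> q powi k \<and> (\<forall>x\<in>{a, b, c, d, 1/a,
      1/b, 1/c, 1/d}. z \<noteq> x * q powi k)"
  show "(1/z)^2 \<noteq> q powi k"
    using *[rule_format, of "- k"] z nz(1) by (auto simp: power_int_minus field_simps)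
  assume x: "x \<in> {a, b, c, d, 1/a, 1/b, 1/c, 1/d}"
  then have "1/x \<in> {a, b, c, d, 1/a, 1/b, 1/c, 1/d}" "x \<noteq> 0" using nz by auto
  then have "z \<noteq> 1/x * q powi (- k)" using * by blast
  then show "1/z \<noteq> x * q powi k"
    using z nz(1) \<open>x \<noteq> 0\<close> by (auto simp: power_int_minus field_simps)
qed simp

text \<open>The excluded points form a countable set, and the complex plane is uncountable.\<close>

lemma infinite_generic: "infinite {z. generic z}"
proof
  assume fin: "finite {z. generic z}"
  let ?X = "{a, b, c, d, 1/a, 1/b, 1/c, 1/d}"
  have sq: "finite {z::complex. z^2 = w}" for w
  proof -
    have "{z. z^2 = w} = {z. poly [:-w, 0, 1:] z = 0}"
      by (auto simp: power2_eq_square)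
    then show ?thesis by (metis poly_roots_finite pCons_eq_0_iff one_neq_zero)
  qed
  have "- {z. generic z} = {0} \<union> (\<Union>k::int. {z. z^2 = q powi k}) \<union> (\<Union>k::int. (\<lambda>x.
      x * q powi k) ` ?X)"
    unfolding generic_def by auto
  also have "countable \<dots>"
  proof (intro countable_Un)
    show "countable (\<Union>k::int. {z. z^2 = q powi k})"
      by (rule countable_UN) (auto intro: countable_finite sq)
    show "countable (\<Union>k::int. (\<lambda>x. x * q powi k) ` ?X)"
      by (rule countable_UN) (auto intro!: countable_finite)
  qed simp
  finally have "countable (- {z. generic z} \<union> {z. generic z})"
    using countable_finite[OF fin] by (rule countable_Un)
  then have "countable (UNIV :: complex set)" by (simp add: Compl_partition2)
  then show False using uncountable_UNIV_complex by simp
qed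

text \<open>A value y of z + 1/z is attained only at the roots of z^2 - y z + 1, so a nonzero
  polynomial would leave only finitely many generic points.\<close>

lemma poly_eq_0_generic:
  assumes "\<And>z. generic z \<Longrightarrow> poly p (z + 1/z) = 0" shows "p = 0"
proof (rule ccontr)
  assume "p \<noteq> 0"
  then have fin: "finite {y. poly p y = 0}" by (rule poly_roots_finite)
  have "{z. generic z} \<subseteq> (\<Union>y\<in>{y. poly p y = 0}. {z. poly [:1, -y, 1:] z = 0})"
  proof safe
    fix z assume z: "generic z"
    then have "z \<noteq> 0" by (simp add: generic_def)
    then have "poly [:1, -(z+1/z), 1:] z = 0" by (simp add: field_simps)
    with assms[OF z] show "z \<in> (\<Union>y\<in>{y. poly p y = 0}. {z. poly [:1, -y, 1:] z = 0})" by blast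
  qed
  moreover have "finite (\<Union>y\<in>{y. poly p y = 0}. {z. poly [:1, -y, 1:] z = 0})"
  proof (rule finite_UN_I[OF fin])
    show "finite {z. poly [:1, -y, 1:] z = 0}" for y :: complex
      by (rule poly_roots_finite) simp
  qed
  ultimately show False using infinite_generic finite_subset by blast
qed

text \<open>
  The relation for \<open>1/z\<close> has the same \<open>z + 1/z\<close> but a different coefficient of \<open>\<beta>\<close>, which
  separates \<open>\<alpha>\<close> from \<open>\<beta>\<close>.
\<close>

lemma horner_top:
  assumes "\<pi> (\<psi> (pol \<gamma> + horner (l @ [(\<alpha>, \<beta>)])) * idem) = 0"
  shows "\<alpha> = 0 \<and> \<beta> = 0"
proof -
  have eq: "poly \<alpha> (z + 1/z) + (z/q + q/z) * poly \<beta> (z + 1/z) = 0" if "generic z" for z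
  proof -
    interpret generic_point q a b c d z by unfold_locales (rule that)
    show ?thesis by (rule horner_end[OF assms])
  qed
  have diff: "(u - v) * y = 0" if "x + u * y = 0" "x + v * y = 0" for u v x y :: complex
  proof -
    have "(u - v) * y = (x + u * y) - (x + v * y)" by (simp add: left_diff_distrib)
    also have "\<dots> = 0" unfolding that by simp
    finally show ?thesis .
  qed
  have "poly \<beta> (z + 1/z) = 0" if z: "generic z" for z
  proof -
    have z0: "z \<noteq> 0" and "z^2 \<noteq> q powi 0" using z unfolding generic_def by blast+
    then have z1: "z^2 \<noteq> 1" by simp
    have "poly \<alpha> (z + 1/z) + (1/(z*q) + q*z) * poly \<beta> (z + 1/z) = 0"
      using eq[OF generic_inverse[OF z]] by (simp add: add.commute mult.commute)
    from diff[OF eq[OF z] this] have "((z/q + q/z) - (1/(z*q) + q*z)) * poly \<beta> (z + 1/z) = 0" .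
    moreover have "(z/q + q/z) - (1/(z*q) + q*z) = (z^2 - 1) * (1 - q^2) / (q*z)"
      using z0 nz(1) by (simp add: field_simps power2_eq_square)
    ultimately show ?thesis using z0 z1 nz(1) q2 by auto
  qed
  then have "\<beta> = 0" by (rule poly_eq_0_generic)
  with eq have "\<alpha> = 0" by (intro poly_eq_0_generic) simp
  with \<open>\<beta> = 0\<close> show ?thesis by simp
qed

lemma horner_snoc_0: "horner (l @ [(0, 0)]) = horner l"
  by (induction l rule: horner.induct) simp_all

text \<open>Reverse induction strips the top degree in K0. The conclusion concerns the element and
  not the list, since trailing zero pairs are possible.\<close>

lemma normal_form_eq_0:
  "\<pi> (\<psi> (pol \<gamma> + horner l) * idem) = 0 \<Longrightarrow> pol \<gamma> + horner l = 0"
proof (induction l rule: rev_induct)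
  case Nil
  have "poly \<gamma> (z + 1/z) = 0" if "generic z" for z
  proof -
    interpret generic_point q a b c d z by unfold_locales (rule that)
    show ?thesis using pol_end Nil by simp
  qed
  then have "\<gamma> = 0" by (rule poly_eq_0_generic)
  then show ?case by simp
next
  case (snoc x l)
  obtain \<alpha> \<beta> where x: "x = (\<alpha>, \<beta>)" by fastforce
  from horner_top[OF snoc.prems[unfolded x]] have "x = (0, 0)" by (simp add: x)
  with snoc show ?case by (simp add: horner_snoc_0)
qed

text \<open>Modulo the relations \<open>U\<close> is a normal form with the same image in the
  corner, and a normal form with image zero is zero.\<close>

lemma \<Phi>_inj:
  assumes "\<pi> (\<psi> U * idem) = 0" shows "U \<in> rel_ideal R1"
proof -
  interpret aw: aw_params q "q*a" "q*b" c d .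
  obtain \<gamma> l where U: "U - (pol \<gamma> + horner l) \<in> rel_ideal R1"
    using aw.spanned_all[of U] by (auto simp: aw.spanned_def)
  have "\<pi> (\<psi> (pol \<gamma> + horner l) * idem) = 0"
    using idem_Id[OF U] assms by (simp only: \<psi>_simps(2) left_diff_distrib proj_diff) simp
  then have "pol \<gamma> + horner l = 0" by (rule normal_form_eq_0)
  with U show ?thesis by simp
qed

end

theorem theorem4p2:
  fixes q a b c d :: complex
  assumes "q \<noteq> 0" and "\<And>m::nat. m \<ge> 1 \<Longrightarrow> q ^ m \<noteq> 1"
    and "a \<noteq> 0" and "b \<noteq> 0" and "c \<noteq> 0" and "d \<noteq> 0"
    and "\<And>m::nat. a * b * c * d \<noteq> 1 / q ^ m"
    and "a * b \<noteq> 1"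
  shows "S_minus q a b c d ` carrier (DAHA q a b c d)
           = S_minus q a b c d ` (AWt_embed q a b c d ` carrier (AWt q a b c d))
       \<and> (\<exists>\<Phi> \<in> alg_iso (AW q (q * a) (q * b) c d) (antispherical q a b c d).
            \<forall>U. \<Phi> (cls (AW_rels q (q * a) (q * b) c d) U)
              = AWt_embed q a b c d
                  ((1 / (a * b - 1)) \<odot>\<^bsub>AWt q a b c d\<^esub>
                    (tilde q a b c d U \<otimes>\<^bsub>AWt q a b c d\<^esub>
                      cls (AWt_rels q a b c d) (gen tT1 + (a * b) \<cdot> 1))))"
proof -
  interpret daha_params q a b c d
    using assms(1,3-6,8) assms(2)[of 2] by unfold_locales simp_all
  show ?thesis
    using S_minus_image_eq \<Phi>_alg_iso[OF \<Phi>_inj] \<Phi>_formula by blast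
qed

end
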